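(* For any $n\ge1$ and any stable lattice $\mathcal L\subset\mathbb R^n$, $$\mu(\mathcal L)\le\sqrt3\,\overline\mu(\mathcal L)\le\sqrt{3n}\,L_n.$$
   Context: A lattice $\mathcal L\subset\mathbb R^n$ is the set of all integer linear combinations of $n$ linearly independent vectors of $\mathbb R^n$. A sublattice of $\mathcal L$ is an additive subgroup $\mathcal L'\subseteq\mathcal L$ (possibly of lower rank). If $\mathcal L'$ has a $\mathbb Z$-basis given by the columns of a matrix $B'$, then $\det(\mathcal L'):=\sqrt{\det(B'^TB')}$, and $\det(\{0\}):=1$. $\mathcal L$ is stable if $\det(\mathcal L)=1$ and $\det(\mathcal L')\ge1$ for all sublattices $\mathcal L'\subseteq\mathcal L$. The covering radius is $\mu(\mathcal L):=\max_{x\in\mathbb R^n}\min_{y\in\mathcal L}\|x-y\|$ (Euclidean norm). The Voronoi cell is $\mathcal V(\mathcal L):=\{x\in\mathbb R^n:\langle x,y\rangle\le\|y\|^2/2\ \ \forall y\in\mathcal L\}$, and $$\overline\mu(\mathcal L):=\sqrt{\frac1{\det(\mathcal L)}\int_{\mathcal V(\mathcal L)}\|x\|^2\,dx}.$$ A convex body is a convex compact set with non-empty interior; it is symmetric if $-K=K$; a symmetric convex body $K\subset\mathbb R^d$ is isotropic if $\int_Kxx^T\,dx=\alpha I_d$ for some scalar $\alpha>0$. The (symmetric) isotropic constant $L_n>0$ is defined by $$L_n^2:=\max_{d\le n}\frac1d\sup_K\int_K\|x\|^2\,dx,$$ where $1\le d\le n$ and the supremum is over all isotropic symmetric convex bodies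 $K\subset\mathbb R^d$ of volume one. *)

theory Defs
  imports "HOL-Analysis.Analysis" "Jordan_Normal_Form.Determinant"
begin

section \<open>Lattices and their sublattices\<close>

definition int_comb :: "'a::real_vector list \<Rightarrow> (nat \<Rightarrow> int) \<Rightarrow> 'a" where
  "int_comb bs c = (\<Sum>i<length bs. of_int (c i) *\<^sub>R bs ! i)"

definition is_lattice :: "'a::euclidean_space set \<Rightarrow> bool" where
  "is_lattice L \<longleftrightarrow>
     (\<exists>bs. length bs = DIM('a) \<and> distinct bs \<and> independent (set bs) \<and> L = range (int_comb bs))"

definition sublattice :: "'a::euclidean_space set \<Rightarrow> 'a set \<Rightarrow> bool" where
  "sublattice M L \<longleftrightarrow> M \<subseteq> L \<and> 0 \<in> M \<and> (\<forall>x\<in>M. \<forall>y\<in>M. x - y \<in> M)"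

definition int_basis :: "'a::real_vector list \<Rightarrow> 'a set \<Rightarrow> bool" where
  "int_basis bs M \<longleftrightarrow>
     range (int_comb bs) = M \<and> (\<forall>c. int_comb bs c = 0 \<longrightarrow> (\<forall>i<length bs. c i = 0))"

text \<open>For the matrix \<open>B\<close> with columns \<open>bs\<close>, this is the product of the transpose of \<open>B\<close> with \<open>B\<close>.\<close>

definition gram_mat :: "'a::real_inner list \<Rightarrow> real mat" where
  "gram_mat bs = Matrix.mat (length bs) (length bs) (\<lambda>(i, j). bs ! i \<bullet> bs ! j)"

text \<open>For a sublattice of a lattice an integral basis exists and the value does not depend on the
  one chosen. The basis of \<open>{0}\<close> is the empty list,
  whose Gram matrix is the \<open>0 \<times> 0\<close> matrix, so that \<open>lattice_det {0} = 1\<close>.\<close>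

definition lattice_det :: "'a::euclidean_space set \<Rightarrow> real" where
  "lattice_det M = sqrt (Determinant.det (gram_mat (SOME bs. int_basis bs M)))"

definition stable_lattice :: "'a::euclidean_space set \<Rightarrow> bool" where
  "stable_lattice L \<longleftrightarrow>
     is_lattice L \<and> lattice_det L = 1 \<and> (\<forall>M. sublattice M L \<longrightarrow> lattice_det M \<ge> 1)"

text \<open>For a lattice, both the infimum and the supremum are attained.\<close>

definition covering_radius :: "'a::euclidean_space set \<Rightarrow> real" where
  "covering_radius L = (SUP x. INF y\<in>L. norm (x - y))"

definition voronoi_cell :: "'a::euclidean_space set \<Rightarrow> 'a set" where
  "voronoi_cell L = {x. \<forall>y\<in>L. x \<bullet> y \<le> (norm y)\<^sup>2 / 2}"

definition mean_covering_radius :: "'a::euclidean_space set \<Rightarrow> real" where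
  "mean_covering_radius L =
     sqrt (1 / lattice_det L * (LINT x:voronoi_cell L|lborel. (norm x)\<^sup>2))"

section \<open>The isotropic constant\<close>

text \<open>The dimension \<open>d\<close> varies inside the definition of the isotropic constant, so the space of
  dimension \<open>d\<close> is taken to be \<^const>\<open>Euclidean_space\<close> \<open>d\<close>, whose points are the functions
  \<open>x :: nat \<Rightarrow> real\<close> with \<open>x i = 0\<close> for all \<open>i \<ge> d\<close>. The measure below is the \<open>d\<close>-dimensional
  Lebesgue measure on this space; it assigns measure \<open>0\<close> to the complement of the space.\<close>

definition lborel_Euclidean :: "nat \<Rightarrow> (nat \<Rightarrow> real) measure" where
  "lborel_Euclidean d =
     distr (\<Pi>\<^sub>M i\<in>{..<d}. lborel) borel (\<lambda>x i. if i < d then x i else 0)"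

definition convex_body :: "nat \<Rightarrow> (nat \<Rightarrow> real) set \<Rightarrow> bool" where
  "convex_body d K \<longleftrightarrow>
     compactin (Euclidean_space d) K \<and>
     (\<forall>x\<in>K. \<forall>y\<in>K. \<forall>u\<in>{0..1}. (\<lambda>i. (1 - u) * x i + u * y i) \<in> K) \<and>
     Euclidean_space d interior_of K \<noteq> {}"

definition symmetric_convex_body :: "nat \<Rightarrow> (nat \<Rightarrow> real) set \<Rightarrow> bool" where
  "symmetric_convex_body d K \<longleftrightarrow> convex_body d K \<and> (\<lambda>x i. - x i) ` K = K"

definition isotropic :: "nat \<Rightarrow> (nat \<Rightarrow> real) set \<Rightarrow> bool" where
  "isotropic d K \<longleftrightarrow>
     (\<exists>\<alpha>>0. \<forall>i<d. \<forall>j<d.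
        (LINT x:K|lborel_Euclidean d. x i * x j) = (if i = j then \<alpha> else 0))"

definition isotropic_bodies :: "nat \<Rightarrow> (nat \<Rightarrow> real) set set" where
  "isotropic_bodies d =
     {K. symmetric_convex_body d K \<and> isotropic d K \<and> emeasure (lborel_Euclidean d) K = 1}"

text \<open>The supremum is finite for each \<open>d \<ge> 1\<close>: an isotropic symmetric convex body of volume one
  contains the open ball of radius \<open>sqrt \<alpha>\<close>, which bounds \<open>\<alpha>\<close> in terms of \<open>d\<close>.\<close>

definition isotropic_constant :: "nat \<Rightarrow> real" where
  "isotropic_constant n =
     sqrt (MAX d\<in>{1..n}. 1 / real d *
       (SUP K\<in>isotropic_bodies d. LINT x:K|lborel_Euclidean d. (\<Sum>i<d. (x i)\<^sup>2)))"

end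

theory Submission
  imports Defs
begin

text \<open>The bound on the covering radius is an averaging argument over the torus. If \<open>a\<close> and \<open>b\<close> are
  shortest representatives of the classes of \<open>x\<close> and \<open>z - x\<close> modulo the lattice, the parallelogram
  law gives \<open>dist(x)\<^sup>2 + dist(z - x)\<^sup>2 \<ge> (dist(z)\<^sup>2 + dist(2 x - z)\<^sup>2) / 2\<close>. Averaged over \<open>x\<close>, all
  terms but \<open>dist(z)\<^sup>2\<close> become the mean squared distance, which is therefore at least \<open>dist(z)\<^sup>2 / 3\<close>.

  For the second inequality, reduction theory makes the set of stable lattices of rank \<open>d\<close>
  compact, so the mean squared distance, which is upper semicontinuous, has a maximizer. If the
  maximizer has a proper nonzero sublattice of determinant one, then this sublattice and the
  projection orthogonal to it are stable, the mean squared distance is subadditive, and induction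
  applies. Otherwise all small transvections keep the lattice stable. The mean squared distance of
  the deformed lattice has derivative \<open>2 \<integral> \<langle>z, p\<rangle> \<langle>z, q\<rangle> dz\<close> over the Voronoi cell for the transvection
  \<open>z \<mapsto> z + t \<langle>z, q\<rangle> p\<close>, and its vanishing for all orthonormal \<open>p\<close>, \<open>q\<close> says that the Voronoi cell is
  isotropic.\<close>

section \<open>Gram determinants and orthogonalization\<close>

text \<open>The type fixes the ambient dimension, but the induction descends to sublattices and
  projections of smaller rank. A lattice is therefore given by \<open>d\<close> vectors of the
  ambient space, and integrals are taken over coordinates, in \<open>leb d\<close>, or over their
  image \<open>span_leb d b\<close>. The main obstacle is that the Voronoi cell moves with the
  lattice. In coordinates the squared distance to the lattice is periodic, so it may be integrated
  over the unit cube or over the cell of a fixed reference basis; a deformation then changes the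
  integrand only. As an infimum of squared norms the integrand gives semicontinuity, and dominated
  convergence gives the derivative. Transvections with orthogonal \<open>p\<close>, \<open>q\<close>
  preserve the lattice determinant exactly. They probe only mixed second moments, but for every
  orthonormal pair, which is enough to make the moment matrix scalar. The bound
  \<open>real d * J\<close> proved by induction is linear in the rank, with one \<open>J\<close> for
  all ranks up to \<open>n\<close>: it adds up when a lattice is split, and it explains the maximum
  over all dimensions up to \<open>n\<close> in the isotropic constant.\<close>

no_notation scalar_prod (infix "\<bullet>" 70)

definition lincomb :: "nat \<Rightarrow> (nat \<Rightarrow> 'a::real_vector) \<Rightarrow> (nat \<Rightarrow> real) \<Rightarrow> 'a" where
  "lincomb d b x = (\<Sum>i<d. x i *\<^sub>R b i)"

text \<open>Independence of the family, not of its set of values: a repeated vector is a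
  dependency.\<close>

definition lin_indep :: "nat \<Rightarrow> (nat \<Rightarrow> 'a::real_vector) \<Rightarrow> bool" where
  "lin_indep d b \<longleftrightarrow> (\<forall>x. lincomb d b x = 0 \<longrightarrow> (\<forall>i<d. x i = 0))"

definition gram_det :: "nat \<Rightarrow> (nat \<Rightarrow> 'a::real_inner) \<Rightarrow> real" where
  "gram_det d b = Determinant.det (Matrix.mat d d (\<lambda>(i, j). b i \<bullet> b j))"

text \<open>Over a general ring, because integral transition matrices must have integral
  determinants.\<close>

definition coldet :: "nat \<Rightarrow> (nat \<Rightarrow> nat \<Rightarrow> 'a::comm_ring_1) \<Rightarrow> 'a" where
  "coldet d U = Determinant.det (Matrix.mat d d (\<lambda>(i, j). U i j))"

text \<open>Gram-Schmidt without normalization. A vanishing \<open>gso b j\<close> contributes a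
  zero summand, so the recursion also makes sense for dependent families.\<close>

fun gso :: "(nat \<Rightarrow> 'a::real_inner) \<Rightarrow> nat \<Rightarrow> 'a" where
  "gso b i = b i - (\<Sum>j<i. (b i \<bullet> gso b j / (gso b j \<bullet> gso b j)) *\<^sub>R gso b j)"

declare gso.simps [simp del]

lemma lincomb_cong: "(\<And>i. i < d \<Longrightarrow> x i = y i) \<Longrightarrow> (\<And>i. i < d \<Longrightarrow> b i = c i) \<Longrightarrow> lincomb d b x = lincomb d c y"
  unfolding lincomb_def by (intro sum.cong) auto

lemma lincomb_add: "lincomb d b (\<lambda>i. x i + y i) = lincomb d b x + lincomb d b y"
  by (simp add: lincomb_def scaleR_left_distrib sum.distrib)

lemma lincomb_diff: "lincomb d b (\<lambda>i. x i - y i) = lincomb d b x - lincomb d b y"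
  by (simp add: lincomb_def scaleR_left_diff_distrib sum_subtractf)

lemma lincomb_uminus: "lincomb d b (\<lambda>i. - x i) = - lincomb d b x"
  by (simp add: lincomb_def sum_negf)

lemma lincomb_scale: "lincomb d b (\<lambda>i. c * x i) = c *\<^sub>R lincomb d b x"
  by (simp add: lincomb_def scaleR_sum_right)

lemma lincomb_Suc: "lincomb (Suc d) b x = lincomb d b x + x d *\<^sub>R b d"
  by (simp add: lincomb_def)

lemma lincomb_linear: "linear T \<Longrightarrow> T (lincomb d b x) = lincomb d (\<lambda>i. T (b i)) x"
  by (simp add: lincomb_def linear_sum linear_cmul)

lemma lincomb_in_span: "lincomb d b x \<in> span (b ` {..<d})"
  unfolding lincomb_def by (intro span_sum span_scale span_base) auto

lemma span_eq_range_lincomb: "span (b ` {..<d}) = range (lincomb d b)"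
proof (induction d)
  case 0
  then show ?case by (auto simp: lincomb_def)
next
  case (Suc d)
  have e: "b ` {..<Suc d} = insert (b d) (b ` {..<d})"
    by (auto simp: lessThan_Suc)
  show ?case
  proof (intro equalityI subsetI)
    fix y assume "y \<in> span (b ` {..<Suc d})"
    then obtain k where "y - k *\<^sub>R b d \<in> span (b ` {..<d})"
      unfolding e by (auto simp: span_insert)
    then obtain x where x: "y - k *\<^sub>R b d = lincomb d b x" using Suc by auto
    have "y = lincomb (Suc d) b (x(d := k))"
      unfolding lincomb_Suc using x lincomb_cong[of d "x(d := k)" x b b] by (auto simp: algebra_simps)
    then show "y \<in> range (lincomb (Suc d) b)" by blast
  qed (use lincomb_in_span in blast)
qed

section \<open>Gram-Schmidt orthogonalization\<close>

lemma gso_span_aux: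
  "gso b i - b i \<in> span (gso b ` {..<i})"
proof -
  have "(\<Sum>j<i. (b i \<bullet> gso b j / (gso b j \<bullet> gso b j)) *\<^sub>R gso b j) \<in> span (gso b ` {..<i})"
    by (intro span_sum span_scale span_base) auto
  from span_neg[OF this] show ?thesis by (subst gso.simps) simp
qed

lemma span_gso: "span (gso b ` {..<k}) = span (b ` {..<k})"
proof (induction k)
  case (Suc k)
  have e: "f ` {..<Suc k} = insert (f k) (f ` {..<k})" for f :: "nat \<Rightarrow> 'a"
    by (auto simp: lessThan_Suc)
  have "span (insert (gso b k) (gso b ` {..<k})) = span (insert (b k) (gso b ` {..<k}))"
    by (rule eq_span_insert_eq[OF gso_span_aux])
  then show ?case unfolding e by (simp only: span_insert Suc)
qed simp

lemma gso_diff_in_span: "b i - gso b i \<in> span (b ` {..<i})"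
  using gso_span_aux[of b i] span_gso[of b i] span_neg by fastforce

lemma gso_orthogonal_less: "j < i \<Longrightarrow> gso b i \<bullet> gso b j = 0"
proof (induction i arbitrary: j rule: less_induct)
  case (less i)
  have orth: "gso b k \<bullet> gso b j = 0" if "k < i" "k \<noteq> j" for k
    using less that by (metis inner_commute linorder_neqE_nat less_trans)
  have "(\<Sum>k<i. (b i \<bullet> gso b k / (gso b k \<bullet> gso b k)) * (gso b k \<bullet> gso b j)) =
     (b i \<bullet> gso b j / (gso b j \<bullet> gso b j)) * (gso b j \<bullet> gso b j)"
    using less.prems by (subst sum.remove[of _ j]) (auto intro!: sum.neutral simp: orth)
  also have "\<dots> = b i \<bullet> gso b j" by simp
  finally show ?case
    by (subst gso.simps) (simp add: inner_diff_left inner_sum_left)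
qed

lemma gso_orthogonal: "i \<noteq> j \<Longrightarrow> gso b i \<bullet> gso b j = 0"
  by (metis gso_orthogonal_less inner_commute linorder_neqE_nat)

lemma orthogonal_span_of_gens:
  assumes "y \<in> span S" "\<And>x. x \<in> S \<Longrightarrow> z \<bullet> x = 0" shows "z \<bullet> y = 0"
  using assms by (induction rule: span_induct_alt) (auto simp: inner_add_right)

lemma gso_orthogonal_span: "y \<in> span (b ` {..<i}) \<Longrightarrow> gso b i \<bullet> y = 0"
  using orthogonal_span_of_gens[of y "gso b ` {..<i}" "gso b i"] unfolding span_gso
  by (force simp: gso_orthogonal_less)

lemma inner_gso_self: "b i \<bullet> gso b i = gso b i \<bullet> gso b i"
  using gso_orthogonal_span[OF gso_diff_in_span[of b i]] by (simp add: inner_diff_right inner_commute)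

lemma inner_gso_less: "i < j \<Longrightarrow> b i \<bullet> gso b j = 0"
  using gso_orthogonal_span[of "b i" b j] by (simp add: span_base inner_commute)

text \<open>The difference of two candidates lies in the span of the earlier vectors and is
  orthogonal to it, hence vanishes. This identifies the Gram-Schmidt vectors of modified
  bases.\<close>

lemma gso_eqI:
  assumes "b i - y \<in> span (b ` {..<i})" "\<And>j. j < i \<Longrightarrow> y \<bullet> b j = 0"
  shows "gso b i = y"
proof -
  have 1: "gso b i - y \<in> span (b ` {..<i})"
    using span_diff[OF assms(1) gso_diff_in_span[of b i]] by (simp add: algebra_simps)
  have "y \<bullet> (gso b i - y) = 0" using assms(2) by (intro orthogonal_span_of_gens[OF 1]) auto
  moreover have "gso b i \<bullet> (gso b i - y) = 0" by (rule gso_orthogonal_span[OF 1])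
  ultimately have "(gso b i - y) \<bullet> (gso b i - y) = 0" by (simp add: inner_diff_left)
  then show ?thesis by simp
qed

text \<open>By Pythagoras, the orthogonal component is the shortest vector in the coset of
  \<open>b i\<close> modulo the span of the earlier ones.\<close>

lemma norm_gso_le:
  assumes "y \<in> span (b ` {..<i})" shows "norm (gso b i) \<le> norm (b i - y)"
proof -
  have "b i - gso b i - y \<in> span (b ` {..<i})" using gso_diff_in_span assms by (rule span_diff)
  from gso_orthogonal_span[OF this]
  have "(norm (gso b i + (b i - gso b i - y)))\<^sup>2 = (norm (gso b i))\<^sup>2 + (norm (b i - gso b i - y))\<^sup>2"
    by (intro norm_add_Pythagorean) (simp add: real_inner_class.orthogonal_def)
  then have "(norm (gso b i))\<^sup>2 \<le> (norm (b i - y))\<^sup>2" by simp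
  then show ?thesis using abs_le_square_iff by fastforce
qed

section \<open>Gram determinants under base change\<close>

lemma gram_det_lincomb:
  "gram_det d (\<lambda>j. lincomb d b (\<lambda>i. U i j)) = (coldet d U)\<^sup>2 * gram_det d b"
proof -
  let ?G = "Matrix.mat d d (\<lambda>(i, j). b i \<bullet> b j)" and ?U = "Matrix.mat d d (\<lambda>(i, j). U i j)"
  have "lincomb d b (\<lambda>k. U k i) \<bullet> lincomb d b (\<lambda>k. U k j)
      = (\<Sum>k<d. U k i * (\<Sum>l<d. (b k \<bullet> b l) * U l j))" for i j
    unfolding lincomb_def inner_sum_left inner_scaleR_left inner_sum_right inner_scaleR_right sum_distrib_left
    by (subst sum.swap) (simp add: mult_ac)
  \<comment> \<open>Column \<open>j\<close> of \<open>U\<close> holds the coefficients of the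
    \<open>j\<close>-th new vector, so the new Gram matrix is \<open>U^T G U\<close>.\<close>
  then have "Matrix.mat d d (\<lambda>(i, j). lincomb d b (\<lambda>k. U k i) \<bullet> lincomb d b (\<lambda>k. U k j)) =
    transpose_mat ?U * (?G * ?U)"
    by (intro eq_matI) (auto simp: scalar_prod_def atLeast0LessThan)
  moreover have "Determinant.det (transpose_mat ?U * (?G * ?U)) = Determinant.det (transpose_mat ?U) * Determinant.det (?G * ?U)"
    by (rule det_mult[of _ d]) auto
  moreover have "Determinant.det (?G * ?U) = Determinant.det ?G * Determinant.det ?U"
    by (rule det_mult[of _ d]) auto
  moreover have "Determinant.det (transpose_mat ?U) = Determinant.det ?U"
    by (rule det_transpose[of _ d]) auto
  ultimately show ?thesis unfolding gram_det_def coldet_def by (simp only: power2_eq_square mult_ac)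
qed

lemma coldet_upper_triangular:
  assumes "\<And>i j. j < i \<Longrightarrow> i < d \<Longrightarrow> U i j = 0" shows "coldet d U = (\<Prod>i<d. U i i)"
proof -
  have "upper_triangular (Matrix.mat d d (\<lambda>(i, j). U i j))"
    using assms by (intro upper_triangularI) auto
  then show ?thesis unfolding coldet_def
    by (subst det_upper_triangular[of _ d]) (auto simp: prod_list_diag_prod atLeast0LessThan)
qed

lemma gram_det_cong: "(\<And>i. i < d \<Longrightarrow> b i = c i) \<Longrightarrow> gram_det d b = gram_det d c"
  unfolding gram_det_def by (intro arg_cong[of _ _ Determinant.det] eq_matI) auto

lemma coldet_cong: "(\<And>i j. i < d \<Longrightarrow> j < d \<Longrightarrow> U i j = V i j) \<Longrightarrow> coldet d U = coldet d V"
  unfolding coldet_def by (intro arg_cong[of _ _ Determinant.det] eq_matI) auto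

lemma coldet_mult: "coldet d (\<lambda>i j. \<Sum>k<d. U i k * V k j) = coldet d U * coldet d V"
proof -
  have "Matrix.mat d d (\<lambda>(i, j). \<Sum>k<d. U i k * V k j) =
      Matrix.mat d d (\<lambda>(i, j). U i j) * Matrix.mat d d (\<lambda>(i, j). V i j)"
    by (rule eq_matI) (auto simp: scalar_prod_def atLeast0LessThan)
  then show ?thesis unfolding coldet_def by (simp add: det_mult[of _ d])
qed

lemma coldet_id: "coldet d (\<lambda>i j. if i = j then 1 else 0) = 1"
  by (subst coldet_upper_triangular) auto

lemma coldet_of_int: "coldet d (\<lambda>i j. real_of_int (U i j)) = real_of_int (coldet d U)"
proof -
  have "Matrix.mat d d (\<lambda>(i, j). real_of_int (U i j)) = map_mat real_of_int (Matrix.mat d d (\<lambda>(i, j). U i j))"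
    by (rule eq_matI) auto
  then show ?thesis unfolding coldet_def by simp
qed

lemma gso_expansion:
  assumes "j < d"
  shows "b j = lincomb d (gso b) (\<lambda>i. if i < j then b j \<bullet> gso b i / (gso b i \<bullet> gso b i) else if i = j then 1 else 0)"
    (is "_ = lincomb d _ ?U")
proof -
  have "lincomb d (gso b) ?U = (\<Sum>i\<in>{..<Suc j}. ?U i *\<^sub>R gso b i)"
    unfolding lincomb_def using assms by (intro sum.mono_neutral_right) auto
  also have "\<dots> = (\<Sum>i<j. (b j \<bullet> gso b i / (gso b i \<bullet> gso b i)) *\<^sub>R gso b i) + gso b j"
    by simp
  finally show ?thesis by (simp add: gso.simps[of b j])
qed

text \<open>The base change to \<open>gso b\<close> is unitriangular and preserves the determinant,
  and the Gram matrix of \<open>gso b\<close> is diagonal. As this covers dependent families too,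
  nonnegativity and the criterion for independence can be read off.\<close>

lemma gram_det_gso: "gram_det d b = (\<Prod>i<d. (norm (gso b i))\<^sup>2)"
proof -
  let ?U = "\<lambda>i j. if i < j then b j \<bullet> gso b i / (gso b i \<bullet> gso b i) else if i = j then 1 else 0"
  have "gram_det d b = gram_det d (\<lambda>j. lincomb d (gso b) (\<lambda>i. ?U i j))"
    by (rule gram_det_cong) (rule gso_expansion)
  also have "\<dots> = gram_det d (gso b)"
    unfolding gram_det_lincomb by (subst coldet_upper_triangular) auto
  also have "\<dots> = coldet d (\<lambda>i j. gso b i \<bullet> gso b j)" by (simp add: gram_det_def coldet_def)
  also have "\<dots> = (\<Prod>i<d. (norm (gso b i))\<^sup>2)"
    by (subst coldet_upper_triangular) (auto simp: gso_orthogonal power2_norm_eq_inner)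
  finally show ?thesis .
qed

lemma gram_det_nonneg: "0 \<le> gram_det d b"
  unfolding gram_det_gso by (intro prod_nonneg) auto

lemma gram_det_Suc: "gram_det (Suc d) b = gram_det d b * (norm (gso b d))\<^sup>2"
  by (simp add: gram_det_gso)

lemma gram_det_0 [simp]: "gram_det 0 b = 1"
  by (simp add: gram_det_gso)

lemma gram_det_nonzero_iff: "gram_det d b \<noteq> 0 \<longleftrightarrow> (\<forall>i<d. gso b i \<noteq> 0)"
  by (auto simp: gram_det_gso)

lemma lin_indep_iff_gram_det: "lin_indep d b \<longleftrightarrow> gram_det d b \<noteq> 0"
proof
  assume li: "lin_indep d b"
  show "gram_det d b \<noteq> 0" unfolding gram_det_nonzero_iff
  proof (intro allI impI notI)
    fix i assume i: "i < d" and z: "gso b i = 0"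
    then have "b i \<in> span (b ` {..<i})" using gso_diff_in_span[of b i] by simp
    then obtain x where x: "b i = lincomb i b x" by (auto simp: span_eq_range_lincomb)
    let ?y = "\<lambda>j. if j < i then x j else if j = i then - 1 else 0"
    have "lincomb d b ?y = lincomb (Suc i) b ?y"
      unfolding lincomb_def using i by (intro sum.mono_neutral_right) auto
    also have "\<dots> = lincomb i b x - b i"
      using lincomb_cong[of i ?y x b b] by (simp add: lincomb_Suc)
    finally have "lincomb d b ?y = 0" using x by simp
    then have "?y i = 0" using li i unfolding lin_indep_def by blast
    then show False by simp
  qed
next
  assume nz: "gram_det d b \<noteq> 0"
  show "lin_indep d b" unfolding lin_indep_def
  proof (intro allI impI, rule ccontr)
    fix x i assume x: "lincomb d b x = 0" and i: "i < d" "x i \<noteq> 0"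
    \<comment> \<open>The last nonzero coefficient: \<open>gso b m\<close> is orthogonal to all
      earlier vectors, and the later ones do not occur, so pairing with it isolates
      \<open>x m\<close>.\<close>
    define m where "m = Max {i. i < d \<and> x i \<noteq> 0}"
    have "m \<in> {i. i < d \<and> x i \<noteq> 0}" unfolding m_def using i by (intro Max_in) auto
    then have m: "m < d" "x m \<noteq> 0" by auto
    have "x j = 0" if "m < j" "j < d" for j
    proof (rule ccontr)
      assume "x j \<noteq> 0"
      then have "j \<le> m" unfolding m_def using that by (intro Max_ge) auto
      then show False using that by simp
    qed
    then have "x j * (b j \<bullet> gso b m) = (if j = m then x m * (gso b m \<bullet> gso b m) else 0)" if "j < d" for j
      using that inner_gso_less[of j m b] inner_gso_self[of b m] by (cases j m rule: linorder_cases) auto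
    then have "lincomb d b x \<bullet> gso b m = (\<Sum>j<d. if j = m then x m * (gso b m \<bullet> gso b m) else 0)"
      unfolding lincomb_def inner_sum_left by (intro sum.cong) auto
    then have "x m * (gso b m \<bullet> gso b m) = 0" using x m by simp
    then show False using m nz gram_det_nonzero_iff by auto
  qed
qed

lemma lin_indep_pos: "lin_indep d b \<longleftrightarrow> 0 < gram_det d b"
  using gram_det_nonneg[of d b] lin_indep_iff_gram_det[of d b] by linarith

lemma lin_indep_mono: "lin_indep d (b :: nat \<Rightarrow> 'a::real_inner) \<Longrightarrow> k \<le> d \<Longrightarrow> lin_indep k b"
  by (auto simp: lin_indep_iff_gram_det gram_det_nonzero_iff)

lemma lin_indep_unique:
  assumes "lin_indep d b" "lincomb d b x = lincomb d b y" "i < d" shows "x i = y i"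
  using assms unfolding lin_indep_def
  by (metis (no_types, lifting) eq_iff_diff_eq_0 lincomb_diff)

lemma lin_indep_independent: "lin_indep d b \<longleftrightarrow> inj_on b {..<d} \<and> independent (b ` {..<d})"
proof
  assume li: "lin_indep d b"
  have inj: "inj_on b {..<d}"
  proof (rule inj_onI, simp, rule ccontr)
    fix i j assume ij: "i < d" "j < d" "b i = b j" "i \<noteq> j"
    have "lincomb d b (\<lambda>k. if k = i then 1 else if k = j then -1 else 0) =
      (\<Sum>k<d. (if k = i then b k else 0) - (if k = j then b k else 0))"
      unfolding lincomb_def using ij by (intro sum.cong) auto
    also have "\<dots> = 0" using ij by (simp add: sum_subtractf)
    finally have "(if i = i then 1 else if i = j then -1 else 0::real) = 0"
      using li ij(1) unfolding lin_indep_def by blast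
    then show False by simp
  qed
  have "independent (b ` {..<d})"
  proof (rule independent_if_scalars_zero)
    fix f x assume "(\<Sum>x\<in>b ` {..<d}. f x *\<^sub>R x) = 0" "x \<in> b ` {..<d}"
    then have "lincomb d b (f \<circ> b) = 0" using inj by (simp add: sum.reindex lincomb_def)
    then show "f x = 0" using \<open>x \<in> b ` {..<d}\<close> li unfolding lin_indep_def by auto
  qed simp
  with inj show "inj_on b {..<d} \<and> independent (b ` {..<d})" by simp
next
  assume a: "inj_on b {..<d} \<and> independent (b ` {..<d})"
  show "lin_indep d b" unfolding lin_indep_def
  proof (intro allI impI)
    fix x i assume x: "lincomb d b x = 0" "i < d"
    have "(\<Sum>v\<in>b ` {..<d}. x (inv_into {..<d} b v) *\<^sub>R v) = lincomb d b x"
      using a by (simp add: sum.reindex lincomb_def)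
    then have "\<forall>v\<in>b ` {..<d}. x (inv_into {..<d} b v) = 0"
      using a x independentD[of "b ` {..<d}" "b ` {..<d}" "\<lambda>v. x (inv_into {..<d} b v)"] by auto
    then show "x i = 0" using a x by auto
  qed
qed

section \<open>Integral spans\<close>

definition zspan :: "nat \<Rightarrow> (nat \<Rightarrow> 'a::real_vector) \<Rightarrow> 'a set" where
  "zspan d b = range (\<lambda>c. lincomb d b (\<lambda>i. real_of_int (c i)))"

lemma zspan_0: "0 \<in> zspan d b"
  unfolding zspan_def by (rule image_eqI[of _ _ "\<lambda>_. 0"]) (auto simp: lincomb_def)

lemma zspan_add: "x \<in> zspan d b \<Longrightarrow> y \<in> zspan d b \<Longrightarrow> x + y \<in> zspan d b"
proof -
  assume "x \<in> zspan d b" "y \<in> zspan d b"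
  then obtain c e where "x = lincomb d b (\<lambda>i. real_of_int (c i))" "y = lincomb d b (\<lambda>i. real_of_int (e i))"
    unfolding zspan_def by auto
  then have "x + y = lincomb d b (\<lambda>i. real_of_int (c i + e i))" by (simp add: lincomb_add)
  then show ?thesis unfolding zspan_def by (intro image_eqI[of _ _ "\<lambda>i. c i + e i"]) auto
qed

lemma zspan_scale: "x \<in> zspan d b \<Longrightarrow> real_of_int m *\<^sub>R x \<in> zspan d b"
proof -
  assume "x \<in> zspan d b"
  then obtain c where "x = lincomb d b (\<lambda>i. real_of_int (c i))" unfolding zspan_def by auto
  then have "real_of_int m *\<^sub>R x = lincomb d b (\<lambda>i. real_of_int (m * c i))" by (simp add: lincomb_scale)
  then show ?thesis unfolding zspan_def by (intro image_eqI[of _ _ "\<lambda>i. m * c i"]) auto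
qed

lemma zspan_uminus: "x \<in> zspan d b \<Longrightarrow> - x \<in> zspan d b"
  using zspan_scale[of x d b "-1"] by simp

lemma zspan_diff: "x \<in> zspan d b \<Longrightarrow> y \<in> zspan d b \<Longrightarrow> x - y \<in> zspan d b"
  using zspan_add[of x d b "- y"] zspan_uminus[of y] by simp

lemma zspan_sum: "(\<And>i. i \<in> I \<Longrightarrow> f i \<in> zspan d b) \<Longrightarrow> sum f I \<in> zspan d b"
  by (induction I rule: infinite_finite_induct) (auto intro: zspan_0 zspan_add)

lemma zspan_base: "i < d \<Longrightarrow> b i \<in> zspan d b"
proof -
  assume i: "i < d"
  have "lincomb d b (\<lambda>j. real_of_int (if j = i then 1 else 0)) = (\<Sum>j<d. if j = i then b i else 0)"
    unfolding lincomb_def by (intro sum.cong) auto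
  also have "\<dots> = b i" using i by simp
  finally show ?thesis unfolding zspan_def by (metis rangeI)
qed

lemma zspan_lincomb: "lincomb d b (\<lambda>i. real_of_int (c i)) \<in> zspan d b"
  by (auto simp: zspan_def)

lemma zspan_subsetI: "(\<And>i. i < k \<Longrightarrow> c i \<in> zspan d b) \<Longrightarrow> zspan k c \<subseteq> zspan d b"
  unfolding zspan_def[of k c] lincomb_def by (auto intro!: zspan_sum zspan_scale)

lemma zspan_mono: "k \<le> d \<Longrightarrow> zspan k b \<subseteq> zspan d b"
  by (auto intro!: zspan_subsetI zspan_base)

lemma zspan_cong: "(\<And>i. i < d \<Longrightarrow> b i = c i) \<Longrightarrow> zspan d b = zspan d c"
  unfolding zspan_def by (intro image_cong refl lincomb_cong) auto

lemma zspan_subset_span: "zspan d b \<subseteq> span (b ` {..<d})"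
  unfolding zspan_def using lincomb_in_span by blast

lemma span_zspan: "span (zspan d b) = span (b ` {..<d})"
  by (intro equalityI span_minimal zspan_subset_span subspace_span image_subsetI)
    (auto intro: span_base zspan_base)

section \<open>Integral transition matrices\<close>

lemma zspan_matrix:
  assumes "\<And>j. j < k \<Longrightarrow> c j \<in> zspan d b"
  obtains U where "\<And>j. j < k \<Longrightarrow> c j = lincomb d b (\<lambda>i. real_of_int (U i j))"
proof -
  have "\<forall>j. \<exists>u. j < k \<longrightarrow> c j = lincomb d b (\<lambda>i. real_of_int (u i))"
    using assms unfolding zspan_def by blast
  then obtain u where "\<forall>j. j < k \<longrightarrow> c j = lincomb d b (\<lambda>i. real_of_int (u j i))" by metis
  then show ?thesis by (intro that[of "\<lambda>i j. u j i"]) auto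
qed

text \<open>The integer is the determinant of the transition matrix; for independent families its
  absolute value is the index of the sublattice.\<close>

lemma gram_det_zspan:
  assumes "\<And>j. j < d \<Longrightarrow> c j \<in> zspan d b"
  obtains m :: int where "gram_det d c = (real_of_int m)\<^sup>2 * gram_det d b"
proof -
  obtain U where U: "\<And>j. j < d \<Longrightarrow> c j = lincomb d b (\<lambda>i. real_of_int (U i j))"
    using zspan_matrix[of d c d b] assms by blast
  have "gram_det d c = gram_det d (\<lambda>j. lincomb d b (\<lambda>i. real_of_int (U i j)))"
    by (rule gram_det_cong) (rule U)
  then show ?thesis
    using that[of "coldet d U"] by (simp add: gram_det_lincomb[of d b "\<lambda>i j. real_of_int (U i j)"] coldet_of_int)
qed

lemma dim_lin_indep: "lin_indep d b \<Longrightarrow> dim (b ` {..<d}) = d" for b :: "nat \<Rightarrow> 'a::euclidean_space"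
  by (simp add: lin_indep_independent dim_eq_card_independent card_image)

text \<open>Both families span the same space of dimension \<open>d\<close>, and \<open>d\<close>
  vectors spanning it must be independent.\<close>

lemma lin_indep_if_zspan_eq:
  fixes b c :: "nat \<Rightarrow> 'a::euclidean_space"
  assumes "lin_indep d b" "zspan d c = zspan d b"
  shows "lin_indep d c"
proof -
  have "dim (c ` {..<d}) = d"
    using dim_lin_indep[OF assms(1)] span_zspan[of d b] span_zspan[of d c] assms(2) dim_span by metis
  then have "card (c ` {..<d}) = d" "independent (c ` {..<d})"
    using dim_le_card'[of "c ` {..<d}"] card_image_le[of "{..<d}" c] card_le_dim_spanning[of "c ` {..<d}" "span (c ` {..<d})"]
    by (auto simp: span_superset)
  then show ?thesis unfolding lin_indep_independent by (auto intro: eq_card_imp_inj_on)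
qed

text \<open>Each determinant is the other times the square of a nonzero integer, so neither can be
  larger.\<close>

lemma gram_det_eq_if_zspan_eq:
  fixes b c :: "nat \<Rightarrow> 'a::euclidean_space"
  assumes "lin_indep d b" "zspan d c = zspan d b"
  shows "gram_det d c = gram_det d b"
proof -
  have c: "lin_indep d c" using lin_indep_if_zspan_eq[OF assms] .
  obtain m :: int where m: "gram_det d c = (real_of_int m)\<^sup>2 * gram_det d b"
    using gram_det_zspan[of d c b] assms(2) zspan_base by metis
  obtain n :: int where n: "gram_det d b = (real_of_int n)\<^sup>2 * gram_det d c"
    using gram_det_zspan[of d b c] assms(2) zspan_base by metis
  have "m \<noteq> 0" "n \<noteq> 0" using m n assms(1) c by (auto simp: lin_indep_iff_gram_det)
  then have "1 \<le> \<bar>real_of_int m\<bar>" "1 \<le> \<bar>real_of_int n\<bar>" by linarith+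
  then have "1 \<le> (real_of_int m)\<^sup>2" "1 \<le> (real_of_int n)\<^sup>2"
    using one_le_power[of "\<bar>real_of_int m\<bar>" 2] one_le_power[of "\<bar>real_of_int n\<bar>" 2] by simp_all
  then have "1 * gram_det d b \<le> (real_of_int m)\<^sup>2 * gram_det d b"
    "1 * gram_det d c \<le> (real_of_int n)\<^sup>2 * gram_det d c"
    by (intro mult_right_mono gram_det_nonneg; simp)+
  then have "gram_det d b \<le> gram_det d c" "gram_det d c \<le> gram_det d b"
    unfolding m[symmetric] n[symmetric] by simp_all
  then show ?thesis by simp
qed

section \<open>Bases adapted to a sublattice\<close>

lemma lin_indep_Suc:
  fixes b :: "nat \<Rightarrow> 'a::real_inner"
  assumes "lin_indep d b" "v \<notin> span (b ` {..<d})"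
  shows "lin_indep (Suc d) (b(d := v))"
proof -
  have e: "(b(d := v)) ` {..<d} = b ` {..<d}" by auto
  have "gso (b(d := v)) d \<noteq> 0" using gso_diff_in_span[of "b(d := v)" d] assms(2) unfolding e by auto
  moreover have "gram_det d (b(d := v)) = gram_det d b" by (rule gram_det_cong) auto
  ultimately show ?thesis using assms(1) by (simp add: lin_indep_iff_gram_det gram_det_Suc)
qed

text \<open>Steinitz exchange; the new vectors are taken from \<open>b\<close> itself, so they
  remain in the lattice.\<close>

lemma lin_indep_extend:
  fixes b c :: "nat \<Rightarrow> 'a::euclidean_space"
  assumes "lin_indep d b" "lin_indep k c" "\<And>j. j < k \<Longrightarrow> c j \<in> zspan d b" "k \<le> d"
  shows "\<exists>e. lin_indep d e \<and> (\<forall>j<d. e j \<in> zspan d b) \<and> (\<forall>j<k. e j = c j)"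
proof -
  have "\<exists>e. lin_indep j e \<and> (\<forall>i<j. e i \<in> zspan d b) \<and> (\<forall>i<k. e i = c i)" if "k \<le> j" "j \<le> d" for j
    using that
  proof (induction j rule: dec_induct)
    case base
    then show ?case using assms by blast
  next
    case (step j)
    then obtain e where e: "lin_indep j e" "\<forall>i<j. e i \<in> zspan d b" "\<forall>i<k. e i = c i" by auto
    have "\<exists>i<d. b i \<notin> span (e ` {..<j})"
    proof (rule ccontr)
      assume "\<not> ?thesis"
      then have "b ` {..<d} \<subseteq> span (e ` {..<j})" by auto
      then have "dim (b ` {..<d}) \<le> dim (e ` {..<j})" by (metis dim_span dim_subset)
      then show False using step dim_lin_indep[OF assms(1)] dim_lin_indep[OF e(1)] by simp
    qed
    then obtain i where i: "i < d" "b i \<notin> span (e ` {..<j})" by auto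
    have "(\<forall>l<Suc j. (e(j := b i)) l \<in> zspan d b) \<and> (\<forall>l<k. (e(j := b i)) l = c l)"
      using e(2,3) step.hyps zspan_base[OF i(1)] by (auto simp: less_Suc_eq)
    with lin_indep_Suc[OF e(1) i(2)] show ?case by blast
  qed
  from this[of d] show ?thesis using assms(4) by auto
qed

text \<open>The transition matrix is the identity with one column replaced. It is upper triangular
  because the coefficients beyond \<open>i\<close> vanish, and \<open>x i\<close> is the only
  diagonal entry that may differ from one.\<close>

lemma gram_det_update:
  assumes "i < d" "\<And>j. i < j \<Longrightarrow> j < d \<Longrightarrow> x j = 0"
  shows "gram_det d (b(i := lincomb d b x)) = (x i)\<^sup>2 * gram_det d b"
proof -
  let ?U = "\<lambda>l j. if j = i then x l else if l = j then 1 else 0"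
  have "(b(i := lincomb d b x)) j = lincomb d b (\<lambda>l. ?U l j)" if "j < d" for j
  proof (cases "j = i")
    case False
    have "lincomb d b (\<lambda>l. ?U l j) = (\<Sum>l<d. if l = j then b j else 0)"
      unfolding lincomb_def using False by (intro sum.cong) auto
    then show ?thesis using False that by simp
  qed simp
  then have "gram_det d (b(i := lincomb d b x)) = gram_det d (\<lambda>j. lincomb d b (\<lambda>l. ?U l j))"
    by (intro gram_det_cong)
  also have "\<dots> = (coldet d ?U)\<^sup>2 * gram_det d b" by (rule gram_det_lincomb)
  also have "coldet d ?U = (\<Prod>l<d. ?U l l)"
    using assms by (intro coldet_upper_triangular) auto
  also have "\<dots> = (\<Prod>l<d. if l = i then x i else 1)" by (intro prod.cong) auto
  also have "\<dots> = x i" using assms(1) by simp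
  finally show ?thesis .
qed

text \<open>A family of lattice vectors minimizing the index, among those whose first \<open>k\<close> members lie
  in the given subspace, generates the lattice: otherwise some member could be replaced by a lattice
  vector with a smaller leading coefficient.\<close>

lemma adapted_basis:
  fixes b c :: "nat \<Rightarrow> 'a::euclidean_space"
  assumes b: "lin_indep d b" and c: "lin_indep k c" "\<And>j. j < k \<Longrightarrow> c j \<in> zspan d b" and k: "k \<le> d"
  obtains e where "zspan d e = zspan d b" "\<And>j. j < k \<Longrightarrow> e j \<in> span (c ` {..<k})"
proof -
  define S where "S = {e. lin_indep d e \<and> (\<forall>j<d. e j \<in> zspan d b) \<and> (\<forall>j<k. e j \<in> span (c ` {..<k}))}"
  \<comment> \<open>The index in the lattice, as a natural number so that a minimum is attained. The
    quotient of the Gram determinants is its square.\<close>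
  define ind where "ind e = nat \<lfloor>sqrt (gram_det d e / gram_det d b)\<rfloor>" for e :: "nat \<Rightarrow> 'a"
  have gb: "gram_det d b > 0" using b lin_indep_pos by blast
  have ind: "gram_det d e = (real (ind e))\<^sup>2 * gram_det d b" if "e \<in> S" for e
  proof -
    have "e j \<in> zspan d b" if "j < d" for j using \<open>e \<in> S\<close> that by (auto simp: S_def)
    then obtain m :: int where m: "gram_det d e = (real_of_int m)\<^sup>2 * gram_det d b"
      by (rule gram_det_zspan)
    then have "sqrt (gram_det d e / gram_det d b) = \<bar>real_of_int m\<bar>" using gb by simp
    then have "ind e = nat \<bar>m\<bar>" unfolding ind_def by (metis floor_of_int of_int_abs)
    then show ?thesis using m by simp
  qed
  obtain e0 where e0: "lin_indep d e0" "\<forall>j<d. e0 j \<in> zspan d b" "\<forall>j<k. e0 j = c j"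
    using lin_indep_extend[OF b c k] by blast
  then have "e0 \<in> S" by (auto simp: S_def intro: span_base)
  then obtain e where e: "e \<in> S" and min: "\<And>e'. e' \<in> S \<Longrightarrow> ind e \<le> ind e'"
    using ex_has_least_nat[of "\<lambda>e. e \<in> S" e0 ind] by blast
  have li: "lin_indep d e" and ez: "\<And>j. j < d \<Longrightarrow> e j \<in> zspan d b"
    and ec: "\<And>j. j < k \<Longrightarrow> e j \<in> span (c ` {..<k})"
    using e by (auto simp: S_def)
  have sub: "zspan d e \<subseteq> zspan d b" using ez by (rule zspan_subsetI)
  have sp: "span (e ` {..<d}) = span (b ` {..<d})"
  proof -
    have "e ` {..<d} \<subseteq> span (b ` {..<d})" using ez zspan_subset_span by blast
    then show ?thesis
      using dim_lin_indep[OF li] dim_lin_indep[OF b]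
      by (metis dim_eq_span dim_span order_refl span_span)
  qed
  have "z \<in> zspan d e" if z: "z \<in> zspan d b" for z
  proof -
    obtain x where x: "z = lincomb d e x"
      using z zspan_subset_span[of d b] sp span_eq_range_lincomb[of e d] by blast
    have "x i \<in> \<int>" if "i < d" for i
    proof (rule ccontr)
      assume xi: "x i \<notin> \<int>"
      define N where "N = {i. i < d \<and> x i \<notin> \<int>}"
      \<comment> \<open>Beyond the last non-integral coefficient all fractional parts vanish. So
        exchanging \<open>e m\<close> for the vector \<open>w\<close> below is a triangular change,
        which scales the index by \<open>frac (x m)\<close>, strictly between 0 and 1.\<close>
      define m where "m = Max N"
      have fN: "finite N" and nN: "N \<noteq> {}" using xi that by (auto simp: N_def)
      have mN: "m \<in> N" unfolding m_def using fN nN by (rule Max_in)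
      then have md: "m < d" "x m \<notin> \<int>" by (auto simp: N_def)
      have big: "frac (x j) = 0" if "m < j" "j < d" for j
      proof (rule ccontr)
        assume "frac (x j) \<noteq> 0"
        then have "j \<in> N" using that by (simp add: N_def frac_eq_0_iff)
        then have "j \<le> m" unfolding m_def using fN by (intro Max_ge)
        then show False using that by simp
      qed
      define w where "w = lincomb d e (\<lambda>j. frac (x j))"
      have weq: "w = z - lincomb d e (\<lambda>j. real_of_int \<lfloor>x j\<rfloor>)"
        unfolding w_def x frac_def lincomb_diff ..
      have wz: "w \<in> zspan d b"
        unfolding weq by (intro zspan_diff z subsetD[OF sub] zspan_lincomb)
      \<comment> \<open>If \<open>m < k\<close>, only the first \<open>k\<close> vectors contribute
        to \<open>w\<close>, so the exchange respects the prescribed subspace.\<close>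
      have wc: "w \<in> span (c ` {..<k})" if "m < k"
        unfolding w_def lincomb_def
      proof (rule span_sum)
        fix j assume "j \<in> {..<d}"
        show "frac (x j) *\<^sub>R e j \<in> span (c ` {..<k})"
        proof (cases "m < j")
          case True
          then have "frac (x j) = 0" using big \<open>j \<in> {..<d}\<close> by blast
          then show ?thesis by (simp only: scaleR_zero_left span_zero)
        next
          case False
          then show ?thesis using ec[of j] that by (simp add: span_scale)
        qed
      qed
      have gd: "gram_det d (e(m := w)) = (frac (x m))\<^sup>2 * gram_det d e"
        unfolding w_def by (rule gram_det_update) (use md big in auto)
      have fr: "0 < frac (x m)" "frac (x m) < 1" using md by (auto simp: frac_gt_0_iff frac_lt_1)
      have pos: "gram_det d e > 0" using li lin_indep_pos by blast
      then have "lin_indep d (e(m := w))" using gd fr lin_indep_pos by force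
      then have S': "e(m := w) \<in> S" using wz wc ez ec by (auto simp: S_def)
      have "gram_det d (e(m := w)) < gram_det d e"
        unfolding gd using fr pos by (simp add: power_less_one_iff)
      then have "(real (ind (e(m := w))))\<^sup>2 < (real (ind e))\<^sup>2"
        using ind[OF S'] ind[OF e] gb by simp
      then have "ind (e(m := w)) < ind e" using power2_less_imp_less by fastforce
      then show False using min[OF S'] by simp
    qed
    then have "\<forall>i. \<exists>n. i < d \<longrightarrow> x i = real_of_int n" by (meson Ints_cases)
    then obtain n where "\<forall>i<d. x i = real_of_int (n i)" by metis
    then have "z = lincomb d e (\<lambda>i. real_of_int (n i))" unfolding x by (intro lincomb_cong) auto
    then show ?thesis using zspan_lincomb by blast
  qed
  then have "zspan d e = zspan d b" using sub by blast
  then show ?thesis using that ec by blast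
qed

text \<open>The coordinates extend to linear functionals on the whole space, and these are
  bounded.\<close>

lemma lin_indep_coeff_bound:
  fixes b :: "nat \<Rightarrow> 'a::euclidean_space"
  assumes "lin_indep d b"
  obtains C where "C > 0" "\<And>x i. i < d \<Longrightarrow> \<bar>x i\<bar> \<le> C * norm (lincomb d b x)"
proof -
  have "\<exists>f. linear f \<and> (\<forall>j<d. f (b j) = (if j = i then 1 else 0 :: real))" for i
  proof -
    have inj: "inj_on b {..<d}" and ind: "independent (b ` {..<d})" using assms lin_indep_independent by auto
    obtain f :: "'a \<Rightarrow> real" where "linear f" "\<forall>v\<in>b ` {..<d}. f v = (if inv_into {..<d} b v = i then 1 else 0)"
      using linear_independent_extend[OF ind, of "\<lambda>v. if inv_into {..<d} b v = i then 1 else (0::real)"] by blast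
    then show ?thesis using inj by (intro exI[of _ f]) auto
  qed
  then obtain f where f: "\<And>i. linear (f i)" "\<And>i j. j < d \<Longrightarrow> f i (b j) = (if j = i then 1 else 0 :: real)"
    by metis
  have "\<exists>B>0. \<forall>z. norm (f i z) \<le> B * norm z" for i
    using linear_bounded_pos[OF f(1)[of i]] by blast
  then obtain B where B: "\<And>i. B i > 0" "\<And>i z. norm (f i z) \<le> B i * norm z" by metis
  have fx: "f i (lincomb d b x) = x i" if "i < d" for i x
  proof -
    have "f i (lincomb d b x) = (\<Sum>j<d. if j = i then x i else 0)"
      unfolding lincomb_def linear_sum[OF f(1)] linear_cmul[OF f(1)] using f(2) by (intro sum.cong) auto
    then show ?thesis using that by simp
  qed
  show ?thesis
  proof (rule that[of "1 + (\<Sum>i<d. B i)"])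
    show "0 < 1 + (\<Sum>i<d. B i)" using B(1) by (simp add: add_pos_nonneg sum_nonneg less_imp_le)
    fix x i assume i: "i < d"
    have "\<bar>x i\<bar> \<le> B i * norm (lincomb d b x)" using B(2)[of i "lincomb d b x"] fx[OF i] by simp
    also have "B i \<le> (\<Sum>i<d. B i)" using i B(1) by (intro member_le_sum) (auto simp: less_imp_le)
    finally show "\<bar>x i\<bar> \<le> (1 + (\<Sum>i<d. B i)) * norm (lincomb d b x)"
      by (smt (verit) \<open>B i \<le> sum B {..<d}\<close> \<open>\<bar>x i\<bar> \<le> B i * norm (lincomb d b x)\<close> mult_right_mono norm_ge_zero)
  qed
qed

lemma finite_zspan_ball:
  fixes b :: "nat \<Rightarrow> 'a::euclidean_space"
  assumes "lin_indep d b"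
  shows "finite {z \<in> zspan d b. norm z \<le> R}"
proof -
  obtain C where C: "C > 0" "\<And>x i. i < d \<Longrightarrow> \<bar>x i\<bar> \<le> C * norm (lincomb d b x)"
    using lin_indep_coeff_bound[OF assms] by blast
  define N where "N = \<lceil>C * R\<rceil>"
  have "{z \<in> zspan d b. norm z \<le> R} \<subseteq> (\<lambda>c. lincomb d b (\<lambda>i. real_of_int (c i))) ` (PiE {..<d} (\<lambda>_. {-N..N}))"
  proof clarify
    fix z assume z: "z \<in> zspan d b" "norm z \<le> R"
    then obtain c where c: "z = lincomb d b (\<lambda>i. real_of_int (c i))" by (auto simp: zspan_def)
    have "c i \<in> {-N..N}" if "i < d" for i
    proof -
      have "\<bar>real_of_int (c i)\<bar> \<le> C * R"
        using C(2)[OF that, of "\<lambda>i. real_of_int (c i)"] z(2) C(1) unfolding c[symmetric]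
        by (meson less_imp_le mult_left_mono order_trans)
      then show ?thesis unfolding N_def atLeastAtMost_iff by linarith
    qed
    then have "restrict c {..<d} \<in> PiE {..<d} (\<lambda>_. {-N..N})" by auto
    moreover have "z = lincomb d b (\<lambda>i. real_of_int (restrict c {..<d} i))"
      unfolding c by (intro lincomb_cong) auto
    ultimately show "z \<in> (\<lambda>c. lincomb d b (\<lambda>i. real_of_int (c i))) ` (PiE {..<d} (\<lambda>_. {-N..N}))" by blast
  qed
  then show ?thesis by (rule finite_subset) (auto intro!: finite_imageI finite_PiE)
qed

section \<open>Reduced bases\<close>

text \<open>Nearest plane rounding, from the last coefficient to the first: the vectors before
  \<open>c i\<close> are orthogonal to \<open>gso c i\<close>, so a coefficient once reduced stays
  reduced.\<close>

lemma size_reduce: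
  "\<exists>z\<in>zspan i c. \<forall>j<i. \<bar>(x - z) \<bullet> gso c j\<bar> \<le> (gso c j \<bullet> gso c j) / 2"
proof (induction i arbitrary: x)
  case 0
  then show ?case using zspan_0 by auto
next
  case (Suc i)
  define m where "m = round (x \<bullet> gso c i / (gso c i \<bullet> gso c i))"
  define x' where "x' = x - real_of_int m *\<^sub>R c i"
  obtain z where z: "z \<in> zspan i c" "\<And>j. j < i \<Longrightarrow> \<bar>(x' - z) \<bullet> gso c j\<bar> \<le> (gso c j \<bullet> gso c j) / 2"
    using Suc by blast
  have "z \<bullet> gso c i = 0"
    using gso_orthogonal_span[of z c i] z(1) zspan_subset_span by (auto simp: inner_commute)
  then have "(x' - z) \<bullet> gso c i = x \<bullet> gso c i - real_of_int m * (gso c i \<bullet> gso c i)"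
    by (simp add: x'_def inner_diff_left inner_gso_self)
  moreover have "\<bar>x \<bullet> gso c i - real_of_int m * (gso c i \<bullet> gso c i)\<bar> \<le> (gso c i \<bullet> gso c i) / 2"
  proof (cases "gso c i = 0")
    case False
    then have p: "gso c i \<bullet> gso c i > 0" by simp
    have "x \<bullet> gso c i - real_of_int m * (gso c i \<bullet> gso c i) =
        (x \<bullet> gso c i / (gso c i \<bullet> gso c i) - real_of_int m) * (gso c i \<bullet> gso c i)"
      using p by (simp add: field_simps)
    then have "\<bar>x \<bullet> gso c i - real_of_int m * (gso c i \<bullet> gso c i)\<bar> =
        \<bar>x \<bullet> gso c i / (gso c i \<bullet> gso c i) - real_of_int m\<bar> * (gso c i \<bullet> gso c i)"
      using p by (simp add: abs_mult)
    also have "\<dots> \<le> (1/2) * (gso c i \<bullet> gso c i)"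
      using of_int_round_abs_le[of "x \<bullet> gso c i / (gso c i \<bullet> gso c i)"] p
      unfolding m_def by (intro mult_right_mono) (auto simp: abs_minus_commute)
    finally show ?thesis by simp
  qed simp
  ultimately have "\<bar>(x' - z) \<bullet> gso c j\<bar> \<le> (gso c j \<bullet> gso c j) / 2" if "j < Suc i" for j
    using z(2) that by (cases "j = i") auto
  moreover have "x' - z = x - (real_of_int m *\<^sub>R c i + z)" by (simp add: x'_def)
  moreover have "real_of_int m *\<^sub>R c i + z \<in> zspan (Suc i) c"
    using z(1) zspan_mono[of i "Suc i" c] by (intro zspan_add zspan_scale zspan_base) auto
  ultimately show ?case by (metis (no_types, lifting))
qed

lemma zspan_unitriangular:
  assumes "\<And>i. i < d \<Longrightarrow> c' i - c i \<in> zspan i c" "k \<le> d"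
  shows "zspan k c' = zspan k c"
  using assms(2)
proof (induction k)
  case 0
  then show ?case by (simp add: zspan_def lincomb_def)
next
  case (Suc k)
  have IH: "zspan k c' = zspan k c" using Suc by simp
  have m: "zspan k e \<subseteq> zspan (Suc k) e" for e :: "nat \<Rightarrow> 'a" by (rule zspan_mono) simp
  have d: "c' k - c k \<in> zspan k c" using assms(1)[of k] Suc.prems by simp
  have 1: "c' k \<in> zspan (Suc k) c"
    using zspan_add[of "c' k - c k" "Suc k" c "c k"] d m zspan_base[of k "Suc k" c] by auto
  have "c' k - c k \<in> zspan k c'" using d IH by simp
  then have 2: "c k \<in> zspan (Suc k) c'"
    using zspan_diff[of "c' k" "Suc k" c' "c' k - c k"] m zspan_base[of k "Suc k" c'] by auto
  show ?case
  proof (intro equalityI zspan_subsetI)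
    fix i assume "i < Suc k"
    then show "c' i \<in> zspan (Suc k) c" using 1 IH m zspan_base[of i k c'] by (cases "i = k") auto
  next
    fix i assume "i < Suc k"
    then show "c i \<in> zspan (Suc k) c'" using 2 IH m zspan_base[of i k c] by (cases "i = k") auto
  qed
qed

text \<open>A unitriangular change preserves every initial span and alters each vector only within
  the span of its predecessors, so the orthogonal components stay the same.\<close>

lemma gso_unitriangular:
  assumes "\<And>i. i < d \<Longrightarrow> c' i - c i \<in> zspan i c" "i < d"
  shows "gso c' i = gso c i"
proof (rule gso_eqI)
  have s: "span (c' ` {..<i}) = span (c ` {..<i})"
    using zspan_unitriangular[of d c' c i] assms by (metis less_imp_le span_zspan)
  have "c' i - c i \<in> span (c ` {..<i})" using assms zspan_subset_span by blast
  from span_add[OF this gso_diff_in_span[of c i]]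
  show "c' i - gso c i \<in> span (c' ` {..<i})" by (simp add: s)
  fix j assume "j < i"
  then show "gso c i \<bullet> c' j = 0"
    using s span_base[of "c' j" "c' ` {..<i}"] by (intro gso_orthogonal_span) auto
qed

text \<open>Gram determinants are squared lattice determinants. Sublattices are represented by their
  bases, so the condition ranges over independent families in \<open>L\<close>; for
  \<open>a = 1\<close> it is the inequality in the definition of stability.\<close>

definition dets_ge :: "real \<Rightarrow> 'a::real_inner set \<Rightarrow> bool" where
  "dets_ge a L \<longleftrightarrow> (\<forall>k c. (\<forall>j<k. c j \<in> L) \<longrightarrow> lin_indep k c \<longrightarrow> a \<le> gram_det k c)"

lemma dets_geD: "dets_ge a L \<Longrightarrow> (\<And>j. j < k \<Longrightarrow> c j \<in> L) \<Longrightarrow> lin_indep k c \<Longrightarrow> a \<le> gram_det k c"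
  by (auto simp: dets_ge_def)

text \<open>The bases whose potential, the product of all leading Gram determinants, is within a factor
  \<open>4/3\<close> of the infimum satisfy the Lovasz condition: exchanging two neighbours can not lower the
  potential by more than this factor.\<close>

lemma exists_lovasz_basis:
  fixes b :: "nat \<Rightarrow> 'a::euclidean_space"
  assumes b: "lin_indep d b" and a: "a > 0" and dets: "dets_ge a (zspan d b)"
  obtains c where "zspan d c = zspan d b"
    "\<And>i. Suc i < d \<Longrightarrow> (norm (gso c i))\<^sup>2 \<le> 2 * (norm (gso c (Suc i)))\<^sup>2"
proof -
  define Bs where "Bs = {c. zspan d c = zspan d b}"
  define \<Phi> where "\<Phi> c = (\<Prod>k\<le>d. gram_det k c)" for c :: "nat \<Rightarrow> 'a"
  have li: "lin_indep d c" if "c \<in> Bs" for c using that b lin_indep_if_zspan_eq by (auto simp: Bs_def)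
  have pos: "gram_det k c > 0" if "c \<in> Bs" "k \<le> d" for c k
    using lin_indep_mono[OF li[OF that(1)] that(2)] lin_indep_pos by blast
  have low: "a ^ Suc d \<le> \<Phi> c" if "c \<in> Bs" for c
  proof -
    have "a \<le> gram_det k c" if "k \<le> d" for k
    proof (rule dets_geD[OF dets])
      show "lin_indep k c" using lin_indep_mono li \<open>c \<in> Bs\<close> that by blast
      show "c j \<in> zspan d b" if "j < k" for j
        using \<open>c \<in> Bs\<close> zspan_base[of j d c] that \<open>k \<le> d\<close> by (auto simp: Bs_def)
    qed
    then have "(\<Prod>k\<le>d. a) \<le> \<Phi> c" unfolding \<Phi>_def using a by (intro prod_mono) auto
    then show ?thesis by simp
  qed
  have "b \<in> Bs" by (simp add: Bs_def)
  define I where "I = Inf (\<Phi> ` Bs)"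
  have I0: "a ^ Suc d \<le> I" unfolding I_def using low \<open>b \<in> Bs\<close> by (intro cInf_greatest) auto
  have Ile: "I \<le> \<Phi> c" if "c \<in> Bs" for c
    unfolding I_def using low that by (intro cInf_lower bdd_belowI2[of _ "a ^ Suc d"]) auto
  have "I < 4/3 * I" using I0 a zero_less_power[OF a, of "Suc d"] by linarith
  then obtain c where c: "c \<in> Bs" "\<Phi> c < 4/3 * I"
    unfolding I_def using \<open>b \<in> Bs\<close> cInf_lessD[of "\<Phi> ` Bs"] by blast
  have near: "\<Phi> c \<le> 4/3 * \<Phi> c'" if "c' \<in> Bs" for c'
    using c(2) Ile[OF that] by simp
  have "(norm (gso c i))\<^sup>2 \<le> 2 * (norm (gso c (Suc i)))\<^sup>2" if i: "Suc i < d" for i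
  proof -
    obtain z where z: "z \<in> zspan (Suc i) c"
      "\<And>j. j < Suc i \<Longrightarrow> \<bar>(c (Suc i) - z) \<bullet> gso c j\<bar> \<le> (gso c j \<bullet> gso c j) / 2"
      using size_reduce by blast
    define v where "v = c (Suc i) - z"
    \<comment> \<open>Size-reduce the vector at \<open>Suc i\<close>, then exchange it with its
      predecessor. Only the lattice of the first \<open>Suc i\<close> vectors changes, so only one
      factor of the potential does.\<close>
    define e where "e = c(i := v, Suc i := c i)"
    have ze: "zspan k e = zspan k c" if k2: "Suc i < k" for k
    proof -
      have zk: "z \<in> zspan k c" using z(1) zspan_mono[of "Suc i" k c] k2 by auto
      have cz: "c j \<in> zspan k c" if "j < k" for j using zspan_base that by blast
      have vz: "v \<in> zspan k c" unfolding v_def using zk cz k2 by (intro zspan_diff) auto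
      have "zspan k e \<subseteq> zspan k c"
        using vz cz k2 by (intro zspan_subsetI) (auto simp: e_def)
      moreover have "zspan k c \<subseteq> zspan k e"
      proof (rule zspan_subsetI)
        have base: "e j \<in> zspan k e" if "j < k" for j using zspan_base that by blast
        have ii: "c i \<in> zspan k e" using base[of "Suc i"] k2 by (simp add: e_def)
        have ee: "c j \<in> zspan k e" if "j < Suc i" for j
          using ii base[of j] that k2 by (cases "j = i") (auto simp: e_def)
        have "zspan (Suc i) c \<subseteq> zspan k e" using ee by (rule zspan_subsetI)
        then have "c (Suc i) \<in> zspan k e"
          using zspan_add[of v k e z] z(1) base[of i] k2 by (auto simp: e_def v_def)
        then show "c j \<in> zspan k e" if "j < k" for j
          using ee[of j] base[of j] that by (cases "j = Suc i"; cases "j < Suc i") (auto simp: e_def)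
      qed
      ultimately show ?thesis by blast
    qed
    then have eB: "e \<in> Bs" using c(1) i by (simp add: Bs_def)
    have same: "gram_det k e = gram_det k c" if k: "k \<le> d" "k \<noteq> Suc i" for k
    proof (cases "k \<le> i")
      case True
      then show ?thesis by (intro gram_det_cong) (auto simp: e_def)
    next
      case False
      then show ?thesis
        using k by (intro gram_det_eq_if_zspan_eq[OF lin_indep_mono[OF li[OF c(1)] k(1)]] ze) simp
    qed
    have split: "\<Phi> f = gram_det (Suc i) f * (\<Prod>k\<in>{..d} - {Suc i}. gram_det k f)" for f
      unfolding \<Phi>_def using i by (intro prod.remove) auto
    have "(\<Prod>k\<in>{..d} - {Suc i}. gram_det k e) = (\<Prod>k\<in>{..d} - {Suc i}. gram_det k c)"
      using same by (intro prod.cong) auto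
    moreover have "(\<Prod>k\<in>{..d} - {Suc i}. gram_det k c) > 0" using pos[OF c(1)] by (intro prod_pos) auto
    ultimately have "gram_det (Suc i) c \<le> 4/3 * gram_det (Suc i) e"
      using near[OF eB] unfolding split by (simp add: mult.assoc[symmetric])
    moreover have "gram_det i e = gram_det i c" using same[of i] i by simp
    ultimately have le: "(norm (gso c i))\<^sup>2 \<le> 4/3 * (norm (gso e i))\<^sup>2"
      using pos[OF c(1), of i] i by (simp add: gram_det_Suc field_simps)
    \<comment> \<open>Size reduction without the exchange is unitriangular, so the components of
      \<open>v\<close> can be read off from the old Gram-Schmidt vectors.\<close>
    define c1 where "c1 = c(Suc i := v)"
    have c1: "gso c1 j = gso c j" if "j < Suc (Suc i)" for j
    proof (rule gso_unitriangular[of "Suc (Suc i)"])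
      show "c1 l - c l \<in> zspan l c" if "l < Suc (Suc i)" for l
        using zspan_uminus[OF z(1)] zspan_0 by (auto simp: c1_def v_def)
    qed fact
    define q where "q = v \<bullet> gso c i / (gso c i \<bullet> gso c i)"
    have "v = gso c1 (Suc i) + (\<Sum>j<Suc i. (v \<bullet> gso c1 j / (gso c1 j \<bullet> gso c1 j)) *\<^sub>R gso c1 j)"
      using gso.simps[of c1 "Suc i"] by (simp add: c1_def)
    also have "\<dots> = gso c (Suc i) + q *\<^sub>R gso c i + (\<Sum>j<i. (v \<bullet> gso c j / (gso c j \<bullet> gso c j)) *\<^sub>R gso c j)"
      using c1 by (simp add: q_def algebra_simps)
    finally have ve: "v - (\<Sum>j<i. (v \<bullet> gso c j / (gso c j \<bullet> gso c j)) *\<^sub>R gso c j) = gso c (Suc i) + q *\<^sub>R gso c i"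
      by (simp add: algebra_simps)
    have "(\<Sum>j<i. (v \<bullet> gso c j / (gso c j \<bullet> gso c j)) *\<^sub>R gso c j) \<in> span (gso c ` {..<i})"
      by (intro span_sum span_scale span_base) auto
    also have "span (gso c ` {..<i}) = span (e ` {..<i})"
      unfolding span_gso by (intro arg_cong[of _ _ span]) (auto simp: e_def)
    finally have "norm (gso e i) \<le> norm (e i - (\<Sum>j<i. (v \<bullet> gso c j / (gso c j \<bullet> gso c j)) *\<^sub>R gso c j))"
      by (rule norm_gso_le)
    also have "\<dots> = norm (gso c (Suc i) + q *\<^sub>R gso c i)" using ve by (simp add: e_def)
    finally have "(norm (gso e i))\<^sup>2 \<le> (norm (gso c (Suc i) + q *\<^sub>R gso c i))\<^sup>2" by (intro power_mono) auto
    also have "\<dots> = (norm (gso c (Suc i)))\<^sup>2 + (norm (q *\<^sub>R gso c i))\<^sup>2"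
      by (intro norm_add_Pythagorean) (simp add: real_inner_class.orthogonal_def gso_orthogonal)
    also have "(norm (q *\<^sub>R gso c i))\<^sup>2 = q\<^sup>2 * (norm (gso c i))\<^sup>2" by (simp add: power_mult_distrib)
    \<comment> \<open>A reduced coefficient is at most 1/2 in absolute value. Multiplied by 4/3, the
      quarter becomes one third of the left side; absorbing it leaves 2/3 against 4/3, which is the
      factor 2 of the claim.\<close>
    also have "\<dots> \<le> (1/4) * (norm (gso c i))\<^sup>2"
    proof (rule mult_right_mono)
      have "\<bar>q\<bar> \<le> 1/2" using z(2)[of i] pos[OF c(1), of "Suc i"] i
        unfolding q_def v_def abs_divide
        by (cases "gso c i = 0") (auto simp: field_simps abs_of_pos)
      then show "q\<^sup>2 \<le> 1/4" using power_mono[of "\<bar>q\<bar>" "1/2" 2] by (simp add: power2_eq_square)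
    qed simp
    finally show ?thesis using le by simp
  qed
  then show ?thesis using that c(1) by (auto simp: Bs_def)
qed

text \<open>If all Gram-Schmidt vectors from \<open>i\<close> on were long, the determinant would
  exceed \<open>A\<close>, because the first \<open>i\<close> vectors contribute at least
  \<open>a\<close>. So some later one is short, and the Lovasz condition carries its bound back to
  \<open>i\<close> at the cost of a power of two. Size reduction passes from the Gram-Schmidt
  vectors to the basis.\<close>

lemma exists_reduced_basis:
  fixes b :: "nat \<Rightarrow> 'a::euclidean_space"
  assumes b: "lin_indep d b" and a: "0 < a" and dets: "dets_ge a (zspan d b)" and A: "gram_det d b \<le> A"
  obtains c where "zspan d c = zspan d b"
    "\<And>i. i < d \<Longrightarrow> norm (c i) \<le> real d * sqrt (2 ^ d * max 1 (A / a))"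
proof -
  obtain e where e: "zspan d e = zspan d b"
    and lov: "\<And>i. Suc i < d \<Longrightarrow> (norm (gso e i))\<^sup>2 \<le> 2 * (norm (gso e (Suc i)))\<^sup>2"
    using exists_lovasz_basis[OF b a dets] by blast
  have li: "lin_indep d e" using lin_indep_if_zspan_eq[OF b e] .
  have gd: "gram_det d e = gram_det d b" using gram_det_eq_if_zspan_eq[OF b e] .
  \<comment> \<open>At least one, so that \<open>Q\<close> is bounded by its own powers.\<close>
  define Q where "Q = max 1 (A / a)"
  have Q1: "1 \<le> Q" by (simp add: Q_def)
  have chain: "(norm (gso e i))\<^sup>2 \<le> 2 ^ (j - i) * (norm (gso e j))\<^sup>2" if "i \<le> j" "j < d" for i j
    using that
  proof (induction j rule: dec_induct)
    case (step j)
    have "(norm (gso e i))\<^sup>2 \<le> 2 ^ (j - i) * (norm (gso e j))\<^sup>2" using step by simp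
    also have "\<dots> \<le> 2 ^ (j - i) * (2 * (norm (gso e (Suc j)))\<^sup>2)"
      using lov[of j] step by (intro mult_left_mono) auto
    finally show ?case using step by (simp add: Suc_diff_le)
  qed simp
  have g: "(norm (gso e i))\<^sup>2 \<le> 2 ^ d * Q" if i: "i < d" for i
  proof -
    have "\<exists>j. i \<le> j \<and> j < d \<and> (norm (gso e j))\<^sup>2 \<le> Q"
    proof (rule ccontr)
      assume "\<not> ?thesis"
      then have big: "Q < (norm (gso e j))\<^sup>2" if "i \<le> j" "j < d" for j using that by (metis not_le)
      have "Q \<le> Q ^ (d - i)" using Q1 i by (intro self_le_power) auto
      also have "\<dots> = (\<Prod>j\<in>{i..<d}. Q)" by simp
      also have "\<dots> < (\<Prod>j\<in>{i..<d}. (norm (gso e j))\<^sup>2)"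
      proof (rule prod_mono_strict[of i])
        show "0 \<le> Q \<and> Q \<le> (norm (gso e j))\<^sup>2" "0 < (norm (gso e j))\<^sup>2" if "j \<in> {i..<d}" for j
          using big[of j] that Q1 by (auto simp del: zero_less_power2 zero_less_norm_iff)
      qed (use big[of i] i in auto)
      finally have lt: "Q < (\<Prod>j\<in>{i..<d}. (norm (gso e j))\<^sup>2)" .
      have "a \<le> gram_det i e"
      proof (rule dets_geD[OF dets])
        show "e j \<in> zspan d b" if "j < i" for j using zspan_base[of j d e] e that i by auto
        show "lin_indep i e" using lin_indep_mono[OF li] i by simp
      qed
      have "{..<d} = {..<i} \<union> {i..<d}" using i by auto
      then have "gram_det d e = (\<Prod>j\<in>{..<i} \<union> {i..<d}. (norm (gso e j))\<^sup>2)"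
        unfolding gram_det_gso by (rule arg_cong)
      also have "\<dots> = gram_det i e * (\<Prod>j\<in>{i..<d}. (norm (gso e j))\<^sup>2)"
        unfolding gram_det_gso by (rule prod.union_disjoint) auto
      also have "\<dots> \<ge> a * (\<Prod>j\<in>{i..<d}. (norm (gso e j))\<^sup>2)"
        using \<open>a \<le> gram_det i e\<close> by (intro mult_right_mono prod_nonneg) auto
      finally have "a * (\<Prod>j\<in>{i..<d}. (norm (gso e j))\<^sup>2) \<le> A" using A gd by simp
      then have "(\<Prod>j\<in>{i..<d}. (norm (gso e j))\<^sup>2) \<le> A / a" using a by (simp add: field_simps)
      then show False using lt by (simp add: Q_def)
    qed
    then obtain j where j: "i \<le> j" "j < d" "(norm (gso e j))\<^sup>2 \<le> Q" by blast
    have "(norm (gso e i))\<^sup>2 \<le> 2 ^ (j - i) * (norm (gso e j))\<^sup>2" using chain j by blast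
    also have "\<dots> \<le> 2 ^ d * Q" using j Q1 by (intro mult_mono power_increasing) auto
    finally show ?thesis .
  qed
  have "\<exists>z\<in>zspan i e. \<forall>j<i. \<bar>(e i - z) \<bullet> gso e j\<bar> \<le> (gso e j \<bullet> gso e j) / 2" for i
    using size_reduce by blast
  then obtain z where z: "\<And>i. z i \<in> zspan i e"
    "\<And>i j. j < i \<Longrightarrow> \<bar>(e i - z i) \<bullet> gso e j\<bar> \<le> (gso e j \<bullet> gso e j) / 2" by metis
  define c where "c i = e i - z i" for i
  have tri: "c i - e i \<in> zspan i e" for i using zspan_uminus[OF z(1)[of i]] by (simp add: c_def)
  have zc: "zspan d c = zspan d e" using zspan_unitriangular[of d c e d] tri by blast
  have gc: "gso c i = gso e i" if "i < d" for i using gso_unitriangular[of d c e] tri that by blast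
  have "norm (c i) \<le> real d * sqrt (2 ^ d * Q)" if i: "i < d" for i
  proof -
    have gn: "norm (gso e j) \<le> sqrt (2 ^ d * Q)" if "j < d" for j
      using g[OF that] real_le_rsqrt by blast
    have "c i = gso e i + (\<Sum>j<i. (c i \<bullet> gso e j / (gso e j \<bullet> gso e j)) *\<^sub>R gso e j)"
      using gso.simps[of c i] gc i by simp
    then have "norm (c i) \<le> norm (gso e i) + norm (\<Sum>j<i. (c i \<bullet> gso e j / (gso e j \<bullet> gso e j)) *\<^sub>R gso e j)"
      by (metis norm_triangle_ineq)
    also have "norm (\<Sum>j<i. (c i \<bullet> gso e j / (gso e j \<bullet> gso e j)) *\<^sub>R gso e j) \<le> (\<Sum>j<i. sqrt (2 ^ d * Q))"
    proof (rule sum_norm_le)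
      fix j assume "j \<in> {..<i}"
      then have j: "j < i" by simp
      have "\<bar>c i \<bullet> gso e j / (gso e j \<bullet> gso e j)\<bar> \<le> 1"
      proof (cases "gso e j = 0")
        case False
        then show ?thesis using z(2)[OF j] unfolding c_def abs_divide by (simp add: divide_le_eq)
      qed simp
      then have "norm ((c i \<bullet> gso e j / (gso e j \<bullet> gso e j)) *\<^sub>R gso e j) \<le> 1 * norm (gso e j)"
        unfolding norm_scaleR by (intro mult_right_mono) auto
      then show "norm ((c i \<bullet> gso e j / (gso e j \<bullet> gso e j)) *\<^sub>R gso e j) \<le> sqrt (2 ^ d * Q)"
        using gn[of j] j i by simp
    qed
    also have "norm (gso e i) + (\<Sum>j<i. sqrt (2 ^ d * Q)) \<le> real (Suc i) * sqrt (2 ^ d * Q)"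
      using gn[OF i] by (simp add: algebra_simps)
    also have "\<dots> \<le> real d * sqrt (2 ^ d * Q)"
      using i Q1 by (intro mult_right_mono) auto
    finally show ?thesis by simp
  qed
  then show ?thesis using that zc e unfolding Q_def by blast
qed

section \<open>Lebesgue measure and the torus\<close>

abbreviation leb :: "nat \<Rightarrow> (nat \<Rightarrow> real) measure" where
  "leb d \<equiv> PiM {..<d} (\<lambda>_. lborel)"

definition unit_cube :: "nat \<Rightarrow> (nat \<Rightarrow> real) set" where
  "unit_cube d = PiE {..<d} (\<lambda>_. {0..<1})"

text \<open>The torus is represented by the unit cube as a fundamental domain. The underlying space
  is still that of \<open>leb d\<close>, so the same functions can be integrated against both
  measures.\<close>

definition tor :: "nat \<Rightarrow> (nat \<Rightarrow> real) measure" where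
  "tor d = density (leb d) (indicator (unit_cube d))"

text \<open>Extensional functions, so that each integer vector is counted once.\<close>

definition int_pts :: "nat \<Rightarrow> (nat \<Rightarrow> int) set" where
  "int_pts d = PiE {..<d} (\<lambda>_. UNIV)"

definition shift :: "nat \<Rightarrow> (nat \<Rightarrow> real) \<Rightarrow> (nat \<Rightarrow> real) \<Rightarrow> (nat \<Rightarrow> real)" where
  "shift d t x = (\<lambda>i\<in>{..<d}. x i + t i)"

abbreviation ishift :: "nat \<Rightarrow> (nat \<Rightarrow> int) \<Rightarrow> (nat \<Rightarrow> real) \<Rightarrow> (nat \<Rightarrow> real)" where
  "ishift d v \<equiv> shift d (\<lambda>i. real_of_int (v i))"

interpretation lebp: product_sigma_finite "\<lambda>_::nat. lborel :: real measure" by standard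

lemma space_leb: "space (leb d) = PiE {..<d} (\<lambda>_. UNIV)"
  by (simp add: space_PiM)

lemma sets_tor [simp, measurable_cong]: "sets (tor d) = sets (leb d)"
  by (simp add: tor_def)

lemma space_tor [simp]: "space (tor d) = space (leb d)"
  by (simp add: tor_def)

lemma unit_cube_sets [measurable]: "unit_cube d \<in> sets (leb d)"
  unfolding unit_cube_def by (intro sets_PiM_I_finite) auto

lemma nn_integral_tor:
  "G \<in> borel_measurable (leb d) \<Longrightarrow> (\<integral>\<^sup>+x. G x \<partial>tor d) = (\<integral>\<^sup>+x. G x * indicator (unit_cube d) x \<partial>leb d)"
  unfolding tor_def by (subst nn_integral_density) (auto simp: mult.commute)

lemma emeasure_unit_cube: "emeasure (leb d) (unit_cube d) = 1"
  unfolding unit_cube_def by (subst lebp.emeasure_PiM) auto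

lemma emeasure_tor_space: "emeasure (tor d) (space (tor d)) = 1"
proof -
  have "emeasure (tor d) (space (tor d)) = (\<integral>\<^sup>+x. indicator (unit_cube d) x \<partial>leb d)"
    unfolding tor_def by (subst emeasure_density) (auto intro!: nn_integral_cong)
  also have "\<dots> = 1" by (simp add: emeasure_unit_cube)
  finally show ?thesis .
qed

lemma finite_measure_tor: "finite_measure (tor d)"
  by (rule finite_measureI) (use emeasure_tor_space in auto)

lemma measurable_shift [measurable]: "shift d t \<in> measurable (leb d) (leb d)"
  unfolding shift_def by measurable

lemma shift_space: "shift d t x \<in> space (leb d)"
  by (simp add: shift_def space_leb)

lemma countable_int_pts: "countable (int_pts d)"
  unfolding int_pts_def by (intro countable_PiE) auto

section \<open>Affine and triangular substitutions\<close>

lemma leb_affine: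
  assumes c: "\<And>i. i < d \<Longrightarrow> c i \<noteq> 0" and G [measurable]: "G \<in> borel_measurable (leb d)"
  shows "(\<integral>\<^sup>+x. G x \<partial>leb d) = ennreal (\<Prod>i<d. \<bar>c i\<bar>) * (\<integral>\<^sup>+x. G (\<lambda>i\<in>{..<d}. t i + c i * x i) \<partial>leb d)"
proof -
  let ?T = "\<lambda>x. \<lambda>i\<in>{..<d}. t i + c i * x i :: real"
  have [measurable]: "?T \<in> measurable (leb d) (leb d)" by measurable
  have "density (distr (leb d) (leb d) ?T) (\<lambda>_. ennreal (\<Prod>i<d. \<bar>c i\<bar>)) = leb d"
  proof (rule lebp.PiM_eqI)
    fix A :: "nat \<Rightarrow> real set" assume A: "\<And>i. i \<in> {..<d} \<Longrightarrow> A i \<in> sets lborel"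
    have PA: "PiE {..<d} A \<in> sets (leb d)" using A by (intro sets_PiM_I_finite) auto
    have pre: "?T -` PiE {..<d} A \<inter> space (leb d) = PiE {..<d} (\<lambda>i. (\<lambda>x. t i + c i * x) -` A i)"
      by (auto simp: space_leb PiE_iff)
    have meas: "(\<lambda>x. t i + c i * x) -` A i \<in> sets lborel" if "i < d" for i
      using measurable_sets_borel[of "\<lambda>x. t i + c i * x" borel "A i"] A that by simp
    have one: "ennreal \<bar>c i\<bar> * emeasure lborel ((\<lambda>x. t i + c i * x) -` A i) = emeasure lborel (A i)" if "i < d" for i
    proof -
      have Ai: "A i \<in> sets borel" using A[of i] that by simp
      have "emeasure lborel (A i) = emeasure (density (distr lborel borel (\<lambda>x. t i + c i * x)) (\<lambda>_. ennreal \<bar>c i\<bar>)) (A i)"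
        using lborel_real_affine[OF c[OF that], of "t i"] by simp
      also have "\<dots> = ennreal \<bar>c i\<bar> * emeasure (distr lborel borel (\<lambda>x. t i + c i * x)) (A i)"
        using Ai by (subst emeasure_density_const) auto
      also have "emeasure (distr lborel borel (\<lambda>x. t i + c i * x)) (A i) = emeasure lborel ((\<lambda>x. t i + c i * x) -` A i)"
        using Ai by (subst emeasure_distr) auto
      finally show ?thesis by simp
    qed
    have "emeasure (density (distr (leb d) (leb d) ?T) (\<lambda>_. ennreal (\<Prod>i<d. \<bar>c i\<bar>))) (PiE {..<d} A)
        = ennreal (\<Prod>i<d. \<bar>c i\<bar>) * emeasure (distr (leb d) (leb d) ?T) (PiE {..<d} A)"
      using PA by (subst emeasure_density_const) auto
    also have "emeasure (distr (leb d) (leb d) ?T) (PiE {..<d} A) = (\<Prod>i<d. emeasure lborel ((\<lambda>x. t i + c i * x) -` A i))"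
      using PA meas by (subst emeasure_distr) (auto simp: pre intro!: lebp.emeasure_PiM)
    also have "ennreal (\<Prod>i<d. \<bar>c i\<bar>) * \<dots> = (\<Prod>i<d. ennreal \<bar>c i\<bar> * emeasure lborel ((\<lambda>x. t i + c i * x) -` A i))"
      by (simp add: prod.distrib prod_ennreal)
    also have "\<dots> = (\<Prod>i<d. emeasure lborel (A i))" using one by (intro prod.cong) auto
    finally show "emeasure (density (distr (leb d) (leb d) ?T) (\<lambda>_. ennreal (\<Prod>i<d. \<bar>c i\<bar>))) (PiE {..<d} A)
      = (\<Prod>i<d. emeasure lborel (A i))" .
  qed auto
  then have "(\<integral>\<^sup>+x. G x \<partial>leb d) = (\<integral>\<^sup>+x. G x \<partial>density (distr (leb d) (leb d) ?T) (\<lambda>_. ennreal (\<Prod>i<d. \<bar>c i\<bar>)))"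
    by simp
  also have "\<dots> = (\<integral>\<^sup>+x. ennreal (\<Prod>i<d. \<bar>c i\<bar>) * G (?T x) \<partial>leb d)"
    by (subst nn_integral_density, simp, simp, subst nn_integral_distr) auto
  also have "\<dots> = ennreal (\<Prod>i<d. \<bar>c i\<bar>) * (\<integral>\<^sup>+x. G (?T x) \<partial>leb d)"
    by (rule nn_integral_cmult) measurable
  finally show ?thesis .
qed

lemma leb_shift:
  assumes [measurable]: "G \<in> borel_measurable (leb d)"
  shows "(\<integral>\<^sup>+x. G (shift d t x) \<partial>leb d) = (\<integral>\<^sup>+x. G x \<partial>leb d)"
  using leb_affine[of d "\<lambda>_. 1" G t] by (simp add: shift_def add.commute)

lemma measurable_shear:
  assumes "k < d" and [measurable]: "s \<in> borel_measurable (leb d)"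
  shows "(\<lambda>x. x(k := x k + s x)) \<in> measurable (leb d) (leb d)"
proof (rule measurable_fun_upd)
  show "{..<d} = {..<d} \<union> {k}" using assms(1) by auto
  have "(\<lambda>x. x k) \<in> measurable (leb d) lborel"
    using assms(1) by (intro measurable_component_singleton) auto
  then show "(\<lambda>x. x k + s x) \<in> measurable (leb d) lborel" by simp
qed simp

lemma floor_eq_iff_frac: "\<lfloor>y\<rfloor> = n \<longleftrightarrow> 0 \<le> y - real_of_int n \<and> y - real_of_int n < 1"
  by linarith

text \<open>Integrate over the \<open>k\<close>-th coordinate first: with the others fixed, the
  shear is a translation.\<close>

lemma leb_shear:
  assumes k: "k < d" and s [measurable]: "s \<in> borel_measurable (leb d)"
    and indep: "\<And>x y. s (x(k := y)) = s x" and G [measurable]: "G \<in> borel_measurable (leb d)"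
  shows "(\<integral>\<^sup>+x. G (x(k := x k + s x)) \<partial>leb d) = (\<integral>\<^sup>+x. G x \<partial>leb d)"
proof -
  let ?I = "{..<d} - {k}"
  have ins: "{..<d} = insert k ?I" using k by auto
  note [measurable] = measurable_shear[OF k s]
  have L: "(\<integral>\<^sup>+x. H x \<partial>leb d) = (\<integral>\<^sup>+x. (\<integral>\<^sup>+y. H (x(k := y)) \<partial>lborel) \<partial>(PiM ?I (\<lambda>_. lborel)))"
    if H: "H \<in> borel_measurable (leb d)" for H
    using lebp.product_nn_integral_insert[of ?I k H] H ins by auto
  have "(\<integral>\<^sup>+x. G (x(k := x k + s x)) \<partial>leb d) =
      (\<integral>\<^sup>+x. (\<integral>\<^sup>+y. G (x(k := s x + 1 * y)) \<partial>lborel) \<partial>(PiM ?I (\<lambda>_. lborel)))"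
    by (subst L) (auto simp: indep add.commute)
  also have "\<dots> = (\<integral>\<^sup>+x. (\<integral>\<^sup>+y. G (x(k := y)) \<partial>lborel) \<partial>(PiM ?I (\<lambda>_. lborel)))"
  proof (rule nn_integral_cong)
    fix x assume "x \<in> space (PiM ?I (\<lambda>_. lborel :: real measure))"
    then have "(\<lambda>y. x(k := y)) \<in> measurable lborel (PiM (insert k ?I) (\<lambda>_. lborel))"
      by (intro measurable_component_update) auto
    then have "(\<lambda>y. G (x(k := y))) \<in> borel_measurable borel"
      using measurable_compose[of "\<lambda>y. x(k := y)" lborel "leb d" G borel] G ins by simp
    from nn_integral_real_affine[OF this, of 1 "s x"]
    show "(\<integral>\<^sup>+y. G (x(k := s x + 1 * y)) \<partial>lborel) = (\<integral>\<^sup>+y. G (x(k := y)) \<partial>lborel)" by simp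
  qed
  also have "\<dots> = (\<integral>\<^sup>+x. G x \<partial>leb d)" by (subst L) auto
  finally show ?thesis .
qed

text \<open>A composition of shears, one coordinate at a time from the first on. The correction of
  coordinate \<open>k\<close> involves only later coordinates, which have not been altered
  yet.\<close>

lemma leb_unitriangular:
  assumes G [measurable]: "G \<in> borel_measurable (leb d)"
  shows "(\<integral>\<^sup>+x. G (\<lambda>i\<in>{..<d}. x i + (\<Sum>j\<in>{i<..<d}. m i j * x j)) \<partial>leb d) = (\<integral>\<^sup>+x. G x \<partial>leb d)"
proof -
  define T where "T k x = (\<lambda>i\<in>{..<d}. x i + (if i < k then (\<Sum>j\<in>{i<..<d}. m i j * x j) else 0))" for k x
  have [measurable]: "T k \<in> measurable (leb d) (leb d)" for k
    unfolding T_def by measurable auto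
  have "(\<integral>\<^sup>+x. G (T k x) \<partial>leb d) = (\<integral>\<^sup>+x. G x \<partial>leb d)" if "k \<le> d" "G \<in> borel_measurable (leb d)" for k G
    using that
  proof (induction k arbitrary: G)
    case 0
    have "T 0 x = x" if "x \<in> space (leb d)" for x
      using that by (auto simp: T_def space_leb PiE_iff extensional_def fun_eq_iff)
    then show ?case by (auto intro!: nn_integral_cong)
  next
    case (Suc k)
    note [measurable] = Suc.prems(2)
    let ?s = "\<lambda>y. \<Sum>j\<in>{k<..<d}. m k j * y j"
    have [measurable]: "?s \<in> borel_measurable (leb d)" by measurable
    have T: "T (Suc k) x = (T k x)(k := T k x k + ?s (T k x))" for x
      using Suc.prems(1) by (auto simp: T_def fun_eq_iff intro!: sum.cong)
    have upd: "(\<lambda>x. x(k := x k + ?s x)) \<in> measurable (leb d) (leb d)"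
      using Suc.prems(1) by (intro measurable_shear) auto
    have "(\<integral>\<^sup>+x. G (T (Suc k) x) \<partial>leb d) = (\<integral>\<^sup>+x. G ((T k x)(k := T k x k + ?s (T k x))) \<partial>leb d)"
      by (simp only: T)
    also have "\<dots> = (\<integral>\<^sup>+x. G (x(k := x k + ?s x)) \<partial>leb d)"
      using Suc.IH[of "\<lambda>y. G (y(k := y k + ?s y))"] Suc.prems measurable_compose[OF upd, of G borel] by simp
    also have "\<dots> = (\<integral>\<^sup>+x. G x \<partial>leb d)"
      using Suc.prems(1) by (intro leb_shear) auto
    finally show ?case .
  qed
  from this[of d G] show ?thesis unfolding T_def by (simp cong: restrict_cong)
qed

text \<open>The integer translates of the unit cube tile the space. Inserting the sum of their
  indicators, exchanging it with the integral and translating each tile back to the cube gives the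
  sum over the orbit.\<close>

lemma leb_unfold:
  assumes G [measurable]: "G \<in> borel_measurable (leb d)"
  shows "(\<integral>\<^sup>+x. G x \<partial>leb d) = (\<integral>\<^sup>+x. (\<integral>\<^sup>+v. G (ishift d v x) \<partial>count_space (int_pts d)) \<partial>tor d)"
proof -
  have ind: "(\<integral>\<^sup>+v. G x * indicator (unit_cube d) (ishift d (\<lambda>i. - v i) x) \<partial>count_space (int_pts d)) = G x"
    if x: "x \<in> space (leb d)" for x
  proof -
    define v0 where "v0 = (\<lambda>i\<in>{..<d}. \<lfloor>x i\<rfloor>)"
    have v0: "v0 \<in> int_pts d" by (auto simp: v0_def int_pts_def)
    have "indicator (unit_cube d) (ishift d (\<lambda>i. - v i) x) = (indicator {v0} v :: ennreal)" if "v \<in> int_pts d" for v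
    proof -
      have "ishift d (\<lambda>i. - v i) x \<in> unit_cube d \<longleftrightarrow> (\<forall>i<d. \<lfloor>x i\<rfloor> = v i)"
        by (auto simp: unit_cube_def shift_def PiE_iff floor_eq_iff_frac)
      also have "\<dots> \<longleftrightarrow> v = v0"
        using that by (auto simp: v0_def int_pts_def PiE_iff extensional_def fun_eq_iff)
      finally show ?thesis by (auto simp: indicator_def)
    qed
    then have "(\<integral>\<^sup>+v. G x * indicator (unit_cube d) (ishift d (\<lambda>i. - v i) x) \<partial>count_space (int_pts d)) =
        (\<integral>\<^sup>+v. G x * indicator {v0} v \<partial>count_space (int_pts d))"
      by (intro nn_integral_cong) auto
    also have "\<dots> = G x" using v0 by (subst nn_integral_cmult_indicator) auto
    finally show ?thesis .
  qed
  have "(\<integral>\<^sup>+x. G x \<partial>leb d) =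
      (\<integral>\<^sup>+x. (\<integral>\<^sup>+v. G x * indicator (unit_cube d) (ishift d (\<lambda>i. - v i) x) \<partial>count_space (int_pts d)) \<partial>leb d)"
    by (intro nn_integral_cong) (simp only: ind[unfolded of_int_minus] of_int_minus)
  also have "\<dots> = (\<integral>\<^sup>+v. (\<integral>\<^sup>+x. G x * indicator (unit_cube d) (ishift d (\<lambda>i. - v i) x) \<partial>leb d) \<partial>count_space (int_pts d))"
    by (intro nn_integral_count_space_nn_integral countable_int_pts) measurable
  also have "\<dots> = (\<integral>\<^sup>+v. (\<integral>\<^sup>+x. G (ishift d v x) * indicator (unit_cube d) x \<partial>leb d) \<partial>count_space (int_pts d))"
  proof (rule nn_integral_cong)
    fix v
    have "(\<integral>\<^sup>+x. G x * indicator (unit_cube d) (ishift d (\<lambda>i. - v i) x) \<partial>leb d) =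
      (\<integral>\<^sup>+x. G (ishift d v x) * indicator (unit_cube d) (ishift d (\<lambda>i. - v i) (ishift d v x)) \<partial>leb d)"
      by (subst leb_shift[of "\<lambda>x. G x * indicator (unit_cube d) (ishift d (\<lambda>i. - v i) x)", symmetric]) auto
    also have "\<dots> = (\<integral>\<^sup>+x. G (ishift d v x) * indicator (unit_cube d) x \<partial>leb d)"
    proof (rule nn_integral_cong)
      fix x :: "nat \<Rightarrow> real" assume "x \<in> space (leb d)"
      then have "ishift d (\<lambda>i. - v i) (ishift d v x) = x"
        by (auto simp: shift_def space_leb PiE_iff extensional_def fun_eq_iff)
      then show "G (ishift d v x) * indicator (unit_cube d) (ishift d (\<lambda>i. - v i) (ishift d v x)) =
        G (ishift d v x) * indicator (unit_cube d) x" by simp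
    qed
    finally show "(\<integral>\<^sup>+x. G x * indicator (unit_cube d) (ishift d (\<lambda>i. - v i) x) \<partial>leb d) =
      (\<integral>\<^sup>+x. G (ishift d v x) * indicator (unit_cube d) x \<partial>leb d)" .
  qed
  also have "\<dots> = (\<integral>\<^sup>+v. (\<integral>\<^sup>+x. G (ishift d v x) \<partial>tor d) \<partial>count_space (int_pts d))"
    by (intro nn_integral_cong) (subst nn_integral_tor, auto)
  also have "\<dots> = (\<integral>\<^sup>+x. (\<integral>\<^sup>+v. G (ishift d v x) \<partial>count_space (int_pts d)) \<partial>tor d)"
    by (intro nn_integral_count_space_nn_integral[symmetric] countable_int_pts) measurable
  finally show ?thesis .
qed

section \<open>Integrals of periodic functions\<close>

definition periodic :: "nat \<Rightarrow> ((nat \<Rightarrow> real) \<Rightarrow> 'b) \<Rightarrow> bool" where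
  "periodic d g \<longleftrightarrow> (\<forall>v x. g (ishift d v x) = g x)"

text \<open>Counting representatives modulo the integer vectors, rather than asking for exactly one, lets the
  principle cover multiplication by two besides translations and Voronoi cells.\<close>

lemma leb_periodic:
  assumes g [measurable]: "g \<in> borel_measurable (leb d)" and per: "periodic d g"
    and S [measurable]: "S \<in> sets (leb d)" and
    count: "AE x in tor d. emeasure (count_space (int_pts d)) {v \<in> int_pts d. ishift d v x \<in> S} = n"
  shows "(\<integral>\<^sup>+x. g x * indicator S x \<partial>leb d) = n * (\<integral>\<^sup>+x. g x \<partial>tor d)"
proof -
  have "(\<integral>\<^sup>+x. g x * indicator S x \<partial>leb d) =
      (\<integral>\<^sup>+x. (\<integral>\<^sup>+v. g (ishift d v x) * indicator S (ishift d v x) \<partial>count_space (int_pts d)) \<partial>tor d)"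
    by (rule leb_unfold) measurable
  also have "\<dots> = (\<integral>\<^sup>+x. (\<integral>\<^sup>+v. g x * indicator {v \<in> int_pts d. ishift d v x \<in> S} v \<partial>count_space (int_pts d)) \<partial>tor d)"
    using per by (intro nn_integral_cong) (auto simp: periodic_def indicator_def)
  also have "\<dots> = (\<integral>\<^sup>+x. n * g x \<partial>tor d)"
  proof (rule nn_integral_cong_AE)
    show "AE x in tor d. (\<integral>\<^sup>+v. g x * indicator {v \<in> int_pts d. ishift d v x \<in> S} v \<partial>count_space (int_pts d)) = n * g x"
      using count
    proof eventually_elim
      case (elim x)
      then show ?case by (subst nn_integral_cmult_indicator) (auto simp: mult.commute)
    qed
  qed
  also have "\<dots> = n * (\<integral>\<^sup>+x. g x \<partial>tor d)" by (rule nn_integral_cmult) measurable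
  finally show ?thesis .
qed

text \<open>The translated cube again meets every class modulo the integer vectors in exactly one
  point.\<close>

lemma tor_shift:
  assumes g [measurable]: "g \<in> borel_measurable (leb d)" and per: "periodic d g"
  shows "(\<integral>\<^sup>+x. g (shift d t x) \<partial>tor d) = (\<integral>\<^sup>+x. g x \<partial>tor d)"
proof -
  let ?S = "{x \<in> space (leb d). shift d (\<lambda>i. - t i) x \<in> unit_cube d}"
  have bk: "shift d (\<lambda>i. - t i) (shift d t x) = x" if "x \<in> space (leb d)" for x
    using that by (auto simp: shift_def space_leb PiE_iff extensional_def fun_eq_iff)
  have sp: "shift d t x \<in> space (leb d)" for t x by (simp add: shift_def space_leb)
  have "(\<integral>\<^sup>+x. g (shift d t x) \<partial>tor d) = (\<integral>\<^sup>+x. g (shift d t x) * indicator (unit_cube d) x \<partial>leb d)"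
    by (rule nn_integral_tor) measurable
  also have "\<dots> = (\<integral>\<^sup>+x. g (shift d t x) * indicator ?S (shift d t x) \<partial>leb d)"
    using bk sp by (intro nn_integral_cong) (auto simp: indicator_def)
  also have "\<dots> = (\<integral>\<^sup>+x. g x * indicator ?S x \<partial>leb d)"
    by (rule leb_shift[of "\<lambda>x. g x * indicator ?S x"]) measurable
  also have "\<dots> = 1 * (\<integral>\<^sup>+x. g x \<partial>tor d)"
  proof (rule leb_periodic[OF g per])
    have "{v \<in> int_pts d. ishift d v x \<in> ?S} = {\<lambda>i\<in>{..<d}. - \<lfloor>x i - t i\<rfloor>}" for x
    proof -
      have "v \<in> int_pts d \<and> ishift d v x \<in> ?S \<longleftrightarrow> v = (\<lambda>i\<in>{..<d}. - \<lfloor>x i - t i\<rfloor>)" for v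
      proof -
        have "ishift d v x \<in> ?S \<longleftrightarrow> (\<forall>i<d. \<lfloor>x i - t i\<rfloor> = - v i)"
          by (auto simp: unit_cube_def shift_def space_leb PiE_iff floor_eq_iff_frac algebra_simps)
        also have "\<dots> \<longleftrightarrow> (\<forall>i<d. v i = - \<lfloor>x i - t i\<rfloor>)" by (intro all_cong) auto
        finally show ?thesis
          by (auto simp: int_pts_def PiE_iff extensional_def fun_eq_iff)
      qed
      then show ?thesis by blast
    qed
    then show "AE x in tor d. emeasure (count_space (int_pts d)) {v \<in> int_pts d. ishift d v x \<in> ?S} = 1"
      by (auto simp: int_pts_def)
  qed measurable
  finally show ?thesis by simp
qed

text \<open>The image of the cube has side two and contains \<open>2 ^ d\<close> points of each
  class, which cancels the Jacobian \<open>2 ^ d\<close>.\<close>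

lemma tor_double:
  assumes g [measurable]: "g \<in> borel_measurable (leb d)" and per: "periodic d g"
  shows "(\<integral>\<^sup>+x. g (\<lambda>i\<in>{..<d}. t i + 2 * x i) \<partial>tor d) = (\<integral>\<^sup>+x. g x \<partial>tor d)"
proof -
  let ?T = "\<lambda>x. \<lambda>i\<in>{..<d}. t i + 2 * x i :: real"
  let ?S = "{x \<in> space (leb d). (\<lambda>i\<in>{..<d}. (x i - t i) / 2) \<in> unit_cube d}"
  have [measurable]: "?T \<in> measurable (leb d) (leb d)" by measurable
  have [measurable]: "(\<lambda>x. \<lambda>i\<in>{..<d}. (x i - t i) / 2) \<in> measurable (leb d) (leb d)" by measurable
  have bk: "(\<lambda>i\<in>{..<d}. (?T x i - t i) / 2) = x" if "x \<in> space (leb d)" for x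
    using that by (auto simp: space_leb PiE_iff extensional_def fun_eq_iff)
  have sp: "?T x \<in> space (leb d)" for x by (simp add: space_leb)
  have "(2::ennreal) ^ d * (\<integral>\<^sup>+x. g (?T x) \<partial>tor d) = 2 ^ d * (\<integral>\<^sup>+x. g (?T x) * indicator (unit_cube d) x \<partial>leb d)"
    by (subst nn_integral_tor) auto
  also have "\<dots> = 2 ^ d * (\<integral>\<^sup>+x. g (?T x) * indicator ?S (?T x) \<partial>leb d)"
    using bk sp by (intro arg_cong[of _ _ "\<lambda>u. 2 ^ d * u"] nn_integral_cong) (auto simp: indicator_def)
  also have "\<dots> = (\<integral>\<^sup>+x. g x * indicator ?S x \<partial>leb d)"
    by (subst leb_affine[of d "\<lambda>_. 2" "\<lambda>x. g x * indicator ?S x" t]) (auto simp flip: ennreal_power)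
  also have "\<dots> = 2 ^ d * (\<integral>\<^sup>+x. g x \<partial>tor d)"
  proof (rule leb_periodic[OF g per])
    have "emeasure (count_space (int_pts d)) {v \<in> int_pts d. ishift d v x \<in> ?S} = 2 ^ d" for x
    proof -
      let ?f = "\<lambda>i. - \<lfloor>x i - t i\<rfloor>"
      have eq: "{v \<in> int_pts d. ishift d v x \<in> ?S} = PiE {..<d} (\<lambda>i. {?f i, ?f i + 1})"
      proof -
        have "v \<in> int_pts d \<and> ishift d v x \<in> ?S \<longleftrightarrow> v \<in> PiE {..<d} (\<lambda>i. {?f i, ?f i + 1})" for v
        proof -
          have "0 \<le> x i + real_of_int n - t i \<and> x i + real_of_int n - t i < 2 \<longleftrightarrow> n = ?f i \<or> n = ?f i + 1" for i n
            by linarith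
          then have "ishift d v x \<in> ?S \<longleftrightarrow> (\<forall>i<d. v i = ?f i \<or> v i = ?f i + 1)"
            by (auto simp: unit_cube_def shift_def space_leb PiE_iff)
          then show ?thesis
            by (auto simp: int_pts_def PiE_iff)
        qed
        then show ?thesis by blast
      qed
      have "card (PiE {..<d} (\<lambda>i. {?f i, ?f i + 1})) = (\<Prod>i<d. 2)"
        by (subst card_PiE) (auto simp: numeral_2_eq_2)
      then show ?thesis
        unfolding eq by (subst emeasure_count_space) (auto simp: int_pts_def finite_PiE)
    qed
    then show "AE x in tor d. emeasure (count_space (int_pts d)) {v \<in> int_pts d. ishift d v x \<in> ?S} = 2 ^ d"
      by simp
  qed measurable
  finally have "ennreal (2 ^ d) * (\<integral>\<^sup>+x. g (?T x) \<partial>tor d) = ennreal (2 ^ d) * (\<integral>\<^sup>+x. g x \<partial>tor d)"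
    by (simp flip: ennreal_power)
  moreover have "\<not> (2::real) ^ d \<le> 0" by (simp add: not_le)
  ultimately show ?thesis by (subst (asm) ennreal_mult_cancel_left) (auto simp: ennreal_eq_0_iff)
qed

text \<open>Every line in the direction of coordinate \<open>k\<close> meets the hyperplane in at
  most one point.\<close>

lemma hyperplane_null:
  assumes k: "k < d" "a k \<noteq> 0"
  shows "AE x in leb d. (\<Sum>i<d. a i * x i) \<noteq> r"
proof -
  let ?I = "{..<d} - {k}"
  have ins: "{..<d} = insert k ?I" using k by auto
  let ?N = "{x \<in> space (leb d). (\<Sum>i<d. a i * x i) = r}"
  have [measurable]: "?N \<in> sets (leb d)" by measurable
  have "emeasure (leb d) ?N = (\<integral>\<^sup>+x. indicator ?N x \<partial>leb d)" by simp
  also have "\<dots> = (\<integral>\<^sup>+x. (\<integral>\<^sup>+y. indicator ?N (x(k := y)) \<partial>lborel) \<partial>(PiM ?I (\<lambda>_. lborel)))"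
    using lebp.product_nn_integral_insert[of ?I k "indicator ?N"] ins by (simp add: borel_measurable_indicator)
  also have "\<dots> = (\<integral>\<^sup>+x. 0 \<partial>(PiM ?I (\<lambda>_. lborel :: real measure)))"
  proof (rule nn_integral_cong)
    fix x :: "nat \<Rightarrow> real"
    let ?y = "(r - (\<Sum>i\<in>?I. a i * x i)) / a k"
    have "(\<Sum>i<d. a i * (x(k := y)) i) = a k * y + (\<Sum>i\<in>?I. a i * x i)" for y
      using k by (subst sum.remove[of _ k]) (auto intro!: sum.cong)
    then have "indicator ?N (x(k := y)) \<le> (indicator {?y} y :: ennreal)" for y
      using k by (auto simp: indicator_def field_simps)
    then have "(\<integral>\<^sup>+y. indicator ?N (x(k := y)) \<partial>lborel) \<le> (\<integral>\<^sup>+y. indicator {?y} y \<partial>lborel)"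
      by (intro nn_integral_mono)
    then show "(\<integral>\<^sup>+y. indicator ?N (x(k := y)) \<partial>lborel) = 0" by simp
  qed
  finally have "emeasure (leb d) ?N = 0" by simp
  then show ?thesis by (subst AE_iff_null) (auto simp: null_sets_def)
qed

lemma AE_tor: "AE x in leb d. P x \<Longrightarrow> AE x in tor d. P x"
  unfolding tor_def by (subst AE_density) (auto elim: eventually_mono)

section \<open>Voronoi cells and the second moment\<close>

lemma voronoi_cell_iff: "z \<in> voronoi_cell L \<longleftrightarrow> (\<forall>w\<in>L. norm z \<le> norm (z - w))"
proof -
  have "z \<bullet> w \<le> (norm w)\<^sup>2 / 2 \<longleftrightarrow> norm z \<le> norm (z - w)" for w
  proof -
    have "(norm (z - w))\<^sup>2 = (norm z)\<^sup>2 - 2 * (z \<bullet> w) + (norm w)\<^sup>2"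
      by (simp add: power2_norm_eq_inner inner_diff_left inner_diff_right inner_commute)
    then have "z \<bullet> w \<le> (norm w)\<^sup>2 / 2 \<longleftrightarrow> (norm z)\<^sup>2 \<le> (norm (z - w))\<^sup>2" by linarith
    then show ?thesis by (simp add: power2_le_iff_abs_le)
  qed
  then show ?thesis by (auto simp: voronoi_cell_def)
qed

text \<open>Lattice vectors longer than \<open>2 * norm z\<close> are farther from \<open>z\<close>
  than the origin is, so only finitely many candidates remain.\<close>

lemma closest_lattice_point:
  fixes b :: "nat \<Rightarrow> 'a::euclidean_space"
  assumes "lin_indep d b"
  obtains w where "w \<in> zspan d b" "\<And>w'. w' \<in> zspan d b \<Longrightarrow> norm (z - w) \<le> norm (z - w')"
proof -
  let ?W = "{w \<in> zspan d b. norm w \<le> 2 * norm z}"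
  have "finite ?W" "?W \<noteq> {}" using finite_zspan_ball[OF assms] zspan_0[of d b] by auto
  then obtain w where w: "w \<in> ?W" "\<And>w'. w' \<in> ?W \<Longrightarrow> norm (z - w) \<le> norm (z - w')"
    using ex_min_if_finite[of "(\<lambda>w. norm (z - w)) ` ?W"] by (auto simp: not_less)
  have "norm (z - w) \<le> norm (z - w')" if "w' \<in> zspan d b" for w'
  proof (cases "norm w' \<le> 2 * norm z")
    case False
    have "norm (z - w) \<le> norm z" using w(2)[of 0] zspan_0[of d b] by simp
    also have "\<dots> \<le> norm w' - norm z" using False by simp
    also have "\<dots> \<le> norm (z - w')" by (metis norm_minus_commute norm_triangle_ineq2)
    finally show ?thesis .
  qed (use w that in auto)
  then show ?thesis using that w(1) by blast
qed

lemma infdist_eq_norm: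
  assumes "w \<in> L" "\<And>w'. w' \<in> L \<Longrightarrow> norm (z - w) \<le> norm (z - w')"
  shows "infdist z L = norm (z - w)"
  by (metis (no_types, lifting) antisym assms cInf_eq_minimum dist_norm empty_iff image_iff infdist_def)

lemma infdist_voronoi: "0 \<in> L \<Longrightarrow> z \<in> voronoi_cell L \<Longrightarrow> infdist z L = norm z"
  using infdist_eq_norm[of 0 L z] by (simp add: voronoi_cell_iff)

lemma infdist_zspan_add:
  fixes b :: "nat \<Rightarrow> 'a::real_normed_vector"
  assumes "w \<in> zspan d b" shows "infdist (z + w) (zspan d b) = infdist z (zspan d b)"
proof -
  have le: "infdist (z + w) (zspan d b) \<le> infdist z (zspan d b)" if "w \<in> zspan d b" for z w
    unfolding infdist_notempty[OF ex_in_conv[THEN iffD1, OF exI, OF zspan_0], of z]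
  proof (rule cINF_greatest)
    fix l assume "l \<in> zspan d b"
    then show "infdist (z + w) (zspan d b) \<le> dist z l"
      using infdist_le[OF zspan_add[OF _ that], of l "z + w"] by simp
  qed (use zspan_0 in auto)
  show ?thesis using le[of w z] le[of "- w" "z + w"] assms zspan_uminus by fastforce
qed

lemma infdist_le_norm: "infdist z (zspan d b) \<le> norm z" for z :: "'a::real_normed_vector"
  using infdist_le[OF zspan_0, of z d b] by simp

lemma lincomb_shift: "lincomb d b (shift d t x) = lincomb d b x + lincomb d b t"
  unfolding lincomb_add[symmetric] shift_def by (intro lincomb_cong) auto

lemma measurable_lincomb [measurable]:
  fixes b :: "nat \<Rightarrow> 'a::euclidean_space"
  shows "lincomb d b \<in> borel_measurable (leb d)"
  unfolding lincomb_def by measurable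

lemma inner_lincomb_left: "lincomb d b x \<bullet> q = (\<Sum>i<d. (b i \<bullet> q) * x i)"
  by (simp add: lincomb_def inner_sum_left mult.commute)

section \<open>The Voronoi cell as a fundamental domain\<close>

lemma closed_voronoi_cell: "closed (voronoi_cell L)"
proof -
  have "voronoi_cell L = (\<Inter>y\<in>L. {x. x \<bullet> y \<le> (norm y)\<^sup>2 / 2})" by (auto simp: voronoi_cell_def)
  then show ?thesis
    by (simp only:) (intro closed_INT ballI closed_Collect_le continuous_intros)
qed

text \<open>In rank below the dimension the Voronoi cell is a cylinder extending orthogonally to the
  lattice; the coordinates capture its intersection with the span.\<close>

definition vcell :: "nat \<Rightarrow> (nat \<Rightarrow> 'a::euclidean_space) \<Rightarrow> (nat \<Rightarrow> real) set" where
  "vcell d b = {x \<in> space (leb d). lincomb d b x \<in> voronoi_cell (zspan d b)}"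

lemma vcell_sets [measurable]: "vcell d b \<in> sets (leb d)"
proof -
  have "vcell d b = lincomb d b -` voronoi_cell (zspan d b) \<inter> space (leb d)"
    by (auto simp: vcell_def)
  then show ?thesis
    using measurable_sets[OF measurable_lincomb borel_closed[OF closed_voronoi_cell]] by metis
qed

text \<open>A point at equal distance from two lattice points lies on their bisecting hyperplane,
  and there are only countably many pairs.\<close>

lemma AE_distinct_norms:
  fixes b :: "nat \<Rightarrow> 'a::euclidean_space"
  assumes "lin_indep d b"
  shows "AE x in leb d. \<forall>w\<in>zspan d b. \<forall>w'\<in>zspan d b. w \<noteq> w' \<longrightarrow> norm (lincomb d b x - w) \<noteq> norm (lincomb d b x - w')"
proof -
  have c: "countable (zspan d b)"
  proof -
    have "zspan d b \<subseteq> (\<lambda>v. lincomb d b (\<lambda>i. real_of_int (v i))) ` int_pts d"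
    proof
      fix w assume "w \<in> zspan d b"
      then obtain c where "w = lincomb d b (\<lambda>i. real_of_int (c i))" by (auto simp: zspan_def)
      then have "w = lincomb d b (\<lambda>i. real_of_int (restrict c {..<d} i))"
        by (simp only:) (intro lincomb_cong, auto)
      moreover have "restrict c {..<d} \<in> int_pts d" by (auto simp: int_pts_def)
      ultimately show "w \<in> (\<lambda>v. lincomb d b (\<lambda>i. real_of_int (v i))) ` int_pts d" by blast
    qed
    then show ?thesis using countable_int_pts by (meson countable_image countable_subset)
  qed
  have one: "AE x in leb d. norm (lincomb d b x - w) \<noteq> norm (lincomb d b x - w')"
    if w: "w \<in> zspan d b" "w' \<in> zspan d b" "w \<noteq> w'" for w w'
  proof -
    define q where "q = w - w'"
    obtain v where v: "q = lincomb d b (\<lambda>i. real_of_int (v i))"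
      using zspan_diff[OF w(1,2)] by (auto simp: zspan_def q_def)
    \<comment> \<open>The hyperplane must not degenerate in coordinates: \<open>q\<close> is nonzero
      and lies in the span of \<open>b\<close>, so it cannot be orthogonal to every
      \<open>b i\<close>.\<close>
    have "\<exists>i<d. b i \<bullet> q \<noteq> 0"
    proof (rule ccontr)
      assume "\<not> ?thesis"
      then have "q \<bullet> q = 0" by (subst v) (simp add: inner_lincomb_left)
      then show False using w by (simp add: q_def)
    qed
    then obtain k where k: "k < d" "b k \<bullet> q \<noteq> 0" by blast
    have "AE x in leb d. (\<Sum>i<d. (b i \<bullet> q) * x i) \<noteq> ((norm w)\<^sup>2 - (norm w')\<^sup>2) / 2"
      by (rule hyperplane_null[where a = "\<lambda>i. b i \<bullet> q", OF k])
    then show ?thesis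
    proof eventually_elim
      case (elim x)
      show ?case
      proof
        assume "norm (lincomb d b x - w) = norm (lincomb d b x - w')"
        then have "(lincomb d b x - w) \<bullet> (lincomb d b x - w) = (lincomb d b x - w') \<bullet> (lincomb d b x - w')"
          by (simp add: norm_eq)
        then have "lincomb d b x \<bullet> q = ((norm w)\<^sup>2 - (norm w')\<^sup>2) / 2"
          by (simp add: q_def power2_norm_eq_inner inner_diff_left inner_diff_right inner_commute)
        then show False using elim by (simp add: inner_lincomb_left)
      qed
    qed
  qed
  have "AE x in leb d. w \<noteq> w' \<longrightarrow> norm (lincomb d b x - w) \<noteq> norm (lincomb d b x - w')"
    if "w \<in> zspan d b" "w' \<in> zspan d b" for w w'
    using one[OF that] by (cases "w = w'") auto
  then show ?thesis by (subst AE_ball_countable[OF c], intro ballI, subst AE_ball_countable[OF c]) auto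
qed

text \<open>Where no ties occur, the nearest lattice point is unique, and subtracting it is the only
  translation by a lattice vector that leads into the cell. So the count in
  \<open>leb_periodic\<close> is one.\<close>

lemma leb_voronoi:
  fixes b :: "nat \<Rightarrow> 'a::euclidean_space"
  assumes b: "lin_indep d b" and g [measurable]: "g \<in> borel_measurable (leb d)" and per: "periodic d g"
  shows "(\<integral>\<^sup>+x. g x * indicator (vcell d b) x \<partial>leb d) = (\<integral>\<^sup>+x. g x \<partial>tor d)"
proof -
  have "AE x in leb d. emeasure (count_space (int_pts d)) {v \<in> int_pts d. ishift d v x \<in> vcell d b} = 1"
    using AE_distinct_norms[OF b]
  proof eventually_elim
    case (elim x)
    let ?B = "lincomb d b" and ?L = "zspan d b"
    obtain w where w: "w \<in> ?L" "\<And>w'. w' \<in> ?L \<Longrightarrow> norm (?B x - w) \<le> norm (?B x - w')"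
      using closest_lattice_point[OF b] by blast
    obtain c where c: "w = ?B (\<lambda>i. real_of_int (c i))" using w(1) by (auto simp: zspan_def)
    define v where "v = (\<lambda>i\<in>{..<d}. - c i)"
    have Bv: "?B (\<lambda>i. real_of_int (v i)) = - w"
      unfolding c lincomb_uminus[symmetric] by (intro lincomb_cong) (auto simp: v_def)
    have mem: "ishift d u x \<in> vcell d b \<longleftrightarrow> (\<forall>w'\<in>?L. norm (?B x + ?B (\<lambda>i. real_of_int (u i))) \<le> norm (?B x + ?B (\<lambda>i. real_of_int (u i)) - w'))" for u
      by (auto simp: vcell_def lincomb_shift voronoi_cell_iff shift_space)
    have "{v \<in> int_pts d. ishift d v x \<in> vcell d b} = {v}"
    proof (intro equalityI subsetI)
      fix u assume "u \<in> {v \<in> int_pts d. ishift d v x \<in> vcell d b}"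
      then have u: "u \<in> int_pts d" "ishift d u x \<in> vcell d b" by auto
      let ?u = "?B (\<lambda>i. real_of_int (u i))"
      have "norm (?B x + ?u) \<le> norm (?B x + ?u - (?u + w))"
        using u(2) w(1) zspan_lincomb zspan_add unfolding mem by blast
      moreover have "norm (?B x - w) \<le> norm (?B x - (- ?u))"
        using w(2)[of "- ?u"] zspan_uminus zspan_lincomb by blast
      ultimately have "norm (?B x - w) = norm (?B x - (- ?u))" by simp
      then have "w = - ?u" using elim w(1) zspan_uminus[OF zspan_lincomb[of d b u]] by blast
      then have "?u = ?B (\<lambda>i. real_of_int (v i))" using Bv by simp
      then have "\<forall>i<d. u i = v i" using lin_indep_unique[OF b, of "\<lambda>i. real_of_int (u i)" "\<lambda>i. real_of_int (v i)"] by auto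
      then show "u \<in> {v}" using u(1) by (auto simp: v_def int_pts_def PiE_iff extensional_def fun_eq_iff)
    next
      fix u assume "u \<in> {v}"
      then have u: "u = v" by simp
      have "norm (?B x - w) \<le> norm (?B x - w - w')" if "w' \<in> ?L" for w'
        using w(2)[OF zspan_add[OF w(1) that]] by (simp add: algebra_simps)
      then show "u \<in> {v \<in> int_pts d. ishift d v x \<in> vcell d b}"
        unfolding u mem mem_Collect_eq Bv by (auto simp: v_def int_pts_def)
    qed
    then show ?case by (simp add: v_def int_pts_def)
  qed
  from AE_tor[OF this] show ?thesis
    using leb_periodic[OF g per vcell_sets, of b 1] by simp
qed

text \<open>By distance instead of by cell, so that a deformation of the basis affects the integrand
  alone. In coordinates the total mass is one, so no determinant appears.\<close>

definition mean_sq :: "nat \<Rightarrow> (nat \<Rightarrow> 'a::euclidean_space) \<Rightarrow> real" where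
  "mean_sq d b = (LINT x|tor d. (infdist (lincomb d b x) (zspan d b))\<^sup>2)"

lemma measurable_infdist_lincomb [measurable]:
  fixes b :: "nat \<Rightarrow> 'a::euclidean_space"
  shows "(\<lambda>x. infdist (lincomb d b x) S) \<in> borel_measurable (leb d)"
proof -
  have "(\<lambda>z. infdist z S) \<in> borel_measurable (borel :: 'a measure)"
    by (intro borel_measurable_continuous_onI continuous_on_infdist continuous_on_id)
  from measurable_compose[OF measurable_lincomb this] show ?thesis .
qed

lemma AE_tor_unit_cube: "AE x in tor d. x \<in> unit_cube d"
  unfolding tor_def by (subst AE_density) (auto simp: indicator_def)

lemma norm_lincomb_unit_cube: "x \<in> unit_cube d \<Longrightarrow> norm (lincomb d b x) \<le> (\<Sum>i<d. norm (b i))"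
  unfolding lincomb_def
  by (intro sum_norm_le) (auto simp: unit_cube_def PiE_iff less_imp_le intro!: mult_left_le_one_le)

lemma mean_sq_nn:
  fixes b :: "nat \<Rightarrow> 'a::euclidean_space"
  shows "(\<integral>\<^sup>+x. ennreal ((infdist (lincomb d b x) (zspan d b))\<^sup>2) \<partial>tor d) = ennreal (mean_sq d b)"
  unfolding mean_sq_def
proof (rule nn_integral_eq_integral)
  show "integrable (tor d) (\<lambda>x. (infdist (lincomb d b x) (zspan d b))\<^sup>2)"
  proof (rule finite_measure.integrable_const_bound[OF finite_measure_tor])
    show "AE x in tor d. norm ((infdist (lincomb d b x) (zspan d b))\<^sup>2) \<le> (\<Sum>i<d. norm (b i))\<^sup>2"
      using AE_tor_unit_cube
    proof eventually_elim
      case (elim x)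
      then have "infdist (lincomb d b x) (zspan d b) \<le> (\<Sum>i<d. norm (b i))"
        using infdist_le_norm norm_lincomb_unit_cube order_trans by blast
      then show ?case by (simp add: power_mono infdist_nonneg)
    qed
  qed measurable
qed auto

lemma mean_sq_nonneg: "0 \<le> mean_sq d b"
  by (simp add: mean_sq_def)

lemma periodic_infdist:
  fixes b :: "nat \<Rightarrow> 'a::real_normed_vector"
  shows
  "periodic d (\<lambda>x. f (infdist (lincomb d b x) (zspan d b)))"
  unfolding periodic_def by (simp add: lincomb_shift infdist_zspan_add zspan_lincomb)

lemma mean_sq_eq_voronoi:
  fixes b :: "nat \<Rightarrow> 'a::euclidean_space"
  assumes "lin_indep d b"
  shows "(\<integral>\<^sup>+x. ennreal ((norm (lincomb d b x))\<^sup>2) * indicator (vcell d b) x \<partial>leb d) = ennreal (mean_sq d b)"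
proof -
  have "(\<integral>\<^sup>+x. ennreal ((norm (lincomb d b x))\<^sup>2) * indicator (vcell d b) x \<partial>leb d) =
      (\<integral>\<^sup>+x. ennreal ((infdist (lincomb d b x) (zspan d b))\<^sup>2) * indicator (vcell d b) x \<partial>leb d)"
    by (intro nn_integral_cong) (auto simp: indicator_def vcell_def infdist_voronoi zspan_0)
  also have "\<dots> = (\<integral>\<^sup>+x. ennreal ((infdist (lincomb d b x) (zspan d b))\<^sup>2) \<partial>tor d)"
    by (intro leb_voronoi assms periodic_infdist) measurable
  finally show ?thesis by (simp add: mean_sq_nn)
qed

lemma infdist_sq_le_mean_sq:
  fixes b :: "nat \<Rightarrow> 'a::euclidean_space"
  assumes b: "lin_indep d b"
  shows "(infdist (lincomb d b z) (zspan d b))\<^sup>2 \<le> 3 * mean_sq d b"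
proof -
  let ?f = "\<lambda>x. (infdist (lincomb d b x) (zspan d b))\<^sup>2"
  let ?F = "\<lambda>x. ennreal (?f x)"
  have per: "periodic d ?F" by (rule periodic_infdist)
  have [measurable]: "?F \<in> borel_measurable (leb d)" by measurable
  have [measurable]: "(\<lambda>x. \<lambda>i\<in>{..<d}. - z i + 2 * x i) \<in> measurable (leb d) (leb d)" by measurable
  \<comment> \<open>Here \<open>x - z\<close> stands for \<open>z - x\<close>. With shortest
    representatives \<open>p\<close> of \<open>x\<close> and \<open>q\<close> of
    \<open>x - z\<close>, the vectors \<open>p - q\<close> and \<open>p + q\<close> represent
    \<open>z\<close> and \<open>2 x - z\<close>, and any representative bounds the distance from
    above.\<close>
  have pt: "?f z + ?f (\<lambda>i\<in>{..<d}. - z i + 2 * x i) \<le> 2 * (?f x + ?f (shift d (\<lambda>i. - z i) x))" for x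
  proof -
    let ?B = "lincomb d b" and ?L = "zspan d b"
    have e1: "?B (shift d (\<lambda>i. - z i) x) = ?B x - ?B z" by (simp add: lincomb_shift lincomb_uminus)
    have e2: "?B (\<lambda>i\<in>{..<d}. - z i + 2 * x i) = 2 *\<^sub>R ?B x - ?B z"
    proof -
      have "?B (\<lambda>i\<in>{..<d}. - z i + 2 * x i) = ?B (\<lambda>i. 2 * x i - z i)" by (intro lincomb_cong) auto
      then show ?thesis by (simp add: lincomb_diff lincomb_scale)
    qed
    obtain w where w: "w \<in> ?L" "\<And>w'. w' \<in> ?L \<Longrightarrow> norm (?B x - w) \<le> norm (?B x - w')"
      using closest_lattice_point[OF b] by blast
    obtain u where u: "u \<in> ?L" "\<And>w'. w' \<in> ?L \<Longrightarrow> norm (?B x - ?B z - u) \<le> norm (?B x - ?B z - w')"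
      using closest_lattice_point[OF b] by blast
    define p where "p = ?B x - w"
    define q where "q = ?B x - ?B z - u"
    have 1: "?f x = (norm p)\<^sup>2" using infdist_eq_norm[OF w] by (simp add: p_def)
    have 2: "?f (shift d (\<lambda>i. - z i) x) = (norm q)\<^sup>2" using infdist_eq_norm[OF u] by (simp add: q_def e1)
    have "infdist (?B z) ?L \<le> norm (p - q)"
      using infdist_le[of "w - u" ?L "?B z"] zspan_diff[OF w(1) u(1)]
      by (simp add: p_def q_def dist_norm algebra_simps)
    then have 3: "?f z \<le> (norm (p - q))\<^sup>2" by (intro power_mono infdist_nonneg)
    have "infdist (2 *\<^sub>R ?B x - ?B z) ?L \<le> norm (p + q)"
      using infdist_le[of "w + u" ?L "2 *\<^sub>R ?B x - ?B z"] zspan_add[OF w(1) u(1)]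
      by (simp add: p_def q_def dist_norm algebra_simps scaleR_2)
    then have 4: "?f (\<lambda>i\<in>{..<d}. - z i + 2 * x i) \<le> (norm (p + q))\<^sup>2"
      unfolding e2 by (intro power_mono infdist_nonneg)
    have "(norm (p - q))\<^sup>2 + (norm (p + q))\<^sup>2 = 2 * ((norm p)\<^sup>2 + (norm q)\<^sup>2)"
      by (simp add: power2_norm_eq_inner inner_diff_left inner_diff_right inner_add_left inner_add_right inner_commute)
    with add_mono[OF 3 4] show ?thesis by (simp only: 1 2)
  qed
  have "ennreal (?f z) + ennreal (mean_sq d b) =
      (\<integral>\<^sup>+x. ?F z \<partial>tor d) + (\<integral>\<^sup>+x. ?F (\<lambda>i\<in>{..<d}. - z i + 2 * x i) \<partial>tor d)"
    by (subst tor_double[OF _ per]) (simp_all add: emeasure_tor_space[unfolded space_tor] mean_sq_nn)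
  also have "\<dots> = (\<integral>\<^sup>+x. ?F z + ?F (\<lambda>i\<in>{..<d}. - z i + 2 * x i) \<partial>tor d)"
    by (intro nn_integral_add[symmetric]) measurable
  also have "\<dots> \<le> (\<integral>\<^sup>+x. 2 * (?F x + ?F (shift d (\<lambda>i. - z i) x)) \<partial>tor d)"
  proof (rule nn_integral_mono)
    fix x
    have "ennreal (?f z + ?f (\<lambda>i\<in>{..<d}. - z i + 2 * x i)) \<le> ennreal (2 * (?f x + ?f (shift d (\<lambda>i. - z i) x)))"
      using pt by (rule ennreal_leI)
    then show "?F z + ?F (\<lambda>i\<in>{..<d}. - z i + 2 * x i) \<le> 2 * (?F x + ?F (shift d (\<lambda>i. - z i) x))"
      by (simp add: ennreal_mult)
  qed
  also have "\<dots> = 2 * ((\<integral>\<^sup>+x. ?F x \<partial>tor d) + (\<integral>\<^sup>+x. ?F (shift d (\<lambda>i. - z i) x) \<partial>tor d))"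
    by (subst nn_integral_cmult, measurable) (subst nn_integral_add, measurable)
  also have "\<dots> = 2 * (ennreal (mean_sq d b) + ennreal (mean_sq d b))"
    by (subst tor_shift[OF _ per]) (simp_all add: mean_sq_nn)
  also have "\<dots> = ennreal (4 * mean_sq d b)"
    using mean_sq_nonneg[of d b] by (simp add: ennreal_mult flip: ennreal_plus)
  finally have "ennreal (?f z + mean_sq d b) \<le> ennreal (4 * mean_sq d b)"
    using mean_sq_nonneg[of d b] by simp
  then have "?f z + mean_sq d b \<le> 4 * mean_sq d b"
    using mean_sq_nonneg[of d b] by (subst (asm) ennreal_le_iff) auto
  then show ?thesis by simp
qed

section \<open>Lebesgue measure on a span\<close>

text \<open>The normalization depends on \<open>b\<close>: the parallelepiped of an independent
  family has measure one. For Gram determinant one this is the usual Lebesgue measure of the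
  span.\<close>

definition span_leb :: "nat \<Rightarrow> (nat \<Rightarrow> 'a::euclidean_space) \<Rightarrow> 'a measure" where
  "span_leb d b = distr (leb d) borel (lincomb d b)"

definition ons :: "(nat \<Rightarrow> 'a::real_inner) \<Rightarrow> nat \<Rightarrow> 'a" where
  "ons b i = gso b i /\<^sub>R norm (gso b i)"

definition orthonormal :: "nat \<Rightarrow> (nat \<Rightarrow> 'a::real_inner) \<Rightarrow> bool" where
  "orthonormal d u \<longleftrightarrow> (\<forall>i<d. \<forall>j<d. u i \<bullet> u j = (if i = j then 1 else 0))"

lemma sets_span_leb [simp, measurable_cong]: "sets (span_leb d b) = sets borel"
  by (simp add: span_leb_def)

lemma space_span_leb [simp]: "space (span_leb d b) = UNIV"
  by (simp add: span_leb_def)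

lemma nn_integral_span_leb:
  "h \<in> borel_measurable borel \<Longrightarrow> (\<integral>\<^sup>+z. h z \<partial>span_leb d b) = (\<integral>\<^sup>+x. h (lincomb d b x) \<partial>leb d)"
  unfolding span_leb_def by (rule nn_integral_distr) auto

lemma measure_eqI_nn_integral:
  assumes "sets M = sets borel" "sets N = sets borel"
    "\<And>h. h \<in> borel_measurable borel \<Longrightarrow> (\<integral>\<^sup>+z. h z \<partial>M) = (\<integral>\<^sup>+z. h z \<partial>N)"
  shows "M = N"
proof (rule measure_eqI)
  fix A assume "A \<in> sets M"
  then show "emeasure M A = emeasure N A"
    using assms(3)[of "indicator A"] assms(1,2) by (simp add: nn_integral_indicator)
qed (use assms in simp)

lemma orthonormal_ons:
  assumes "lin_indep d b" shows "orthonormal d (ons b)"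
  unfolding orthonormal_def
proof (intro allI impI)
  fix i j assume ij: "i < d" "j < d"
  show "ons b i \<bullet> ons b j = (if i = j then 1 else 0)"
  proof (cases "i = j")
    case True
    have "gso b i \<noteq> 0" using assms ij lin_indep_iff_gram_det gram_det_nonzero_iff by blast
    then show ?thesis using True by (simp add: ons_def power2_norm_eq_inner[symmetric] power2_eq_square)
  qed (simp add: ons_def gso_orthogonal)
qed

lemma inner_lincomb_orthonormal:
  assumes "orthonormal d u" "i < d" shows "lincomb d u x \<bullet> u i = x i"
proof -
  have "lincomb d u x \<bullet> u i = (\<Sum>j<d. if j = i then x i else 0)"
    unfolding lincomb_def inner_sum_left using assms by (intro sum.cong) (auto simp: orthonormal_def)
  then show ?thesis using assms by simp
qed

lemma norm_lincomb_orthonormal: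
  assumes "orthonormal d u" shows "(norm (lincomb d u x))\<^sup>2 = (\<Sum>i<d. (x i)\<^sup>2)"
proof -
  have "lincomb d u x \<bullet> lincomb d u x = (\<Sum>i<d. x i * (lincomb d u x \<bullet> u i))"
    by (subst (2) lincomb_def) (simp add: inner_sum_right)
  also have "\<dots> = (\<Sum>i<d. (x i)\<^sup>2)"
    using inner_lincomb_orthonormal[OF assms] by (intro sum.cong) (auto simp: power2_eq_square)
  finally show ?thesis by (simp add: power2_norm_eq_inner)
qed

lemma span_ons: "lin_indep d b \<Longrightarrow> span (ons b ` {..<d}) = span (b ` {..<d})"
proof -
  assume li: "lin_indep d b"
  have g: "gso b i = norm (gso b i) *\<^sub>R ons b i" for i by (cases "gso b i = 0") (simp_all add: ons_def)
  have "ons b ` {..<d} \<subseteq> span (gso b ` {..<d})"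
    unfolding ons_def by (auto intro: span_scale span_base)
  moreover have "gso b ` {..<d} \<subseteq> span (ons b ` {..<d})"
    by (rule image_subsetI, subst g) (auto intro: span_scale span_base)
  ultimately have "span (ons b ` {..<d}) = span (gso b ` {..<d})"
    by (meson antisym span_minimal subspace_span)
  then show ?thesis by (simp add: span_gso)
qed

text \<open>When the basis is factored through \<open>gso b\<close>, the unitriangular factor
  preserves the measure, and the diagonal factor scales it by the product of the norms, the square
  root of the Gram determinant.\<close>

lemma span_leb_ons:
  fixes b :: "nat \<Rightarrow> 'a::euclidean_space"
  assumes "gram_det d b = 1"
  shows "span_leb d b = span_leb d (ons b)"
proof (rule measure_eqI_nn_integral)
  fix h :: "'a \<Rightarrow> ennreal" assume [measurable]: "h \<in> borel_measurable borel"
  have nz: "gso b i \<noteq> 0" if "i < d" for i using assms gram_det_nonzero_iff[of d b] that by simp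
  have "(\<Prod>i<d. norm (gso b i))\<^sup>2 = 1"
    using assms unfolding gram_det_gso by (simp add: prod_power_distrib)
  then have prod1: "(\<Prod>i<d. norm (gso b i)) = 1"
    using prod_nonneg[of "{..<d}" "\<lambda>i. norm (gso b i)"] by (auto simp: power2_eq_1_iff)
  let ?m = "\<lambda>i j. b j \<bullet> gso b i / (gso b i \<bullet> gso b i)"
  have tri: "lincomb d (gso b) (\<lambda>i\<in>{..<d}. x i + (\<Sum>j\<in>{i<..<d}. ?m i j * x j)) = lincomb d b x" for x
  proof -
    let ?U = "\<lambda>i j. if i < j then ?m i j else if i = j then 1 else 0"
    have "lincomb d b x = (\<Sum>j<d. x j *\<^sub>R lincomb d (gso b) (\<lambda>i. ?U i j))"
      unfolding lincomb_def[of d b x] by (intro sum.cong refl arg_cong[of _ _ "\<lambda>z. _ *\<^sub>R z"] gso_expansion) simp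
    also have "\<dots> = (\<Sum>i<d. (\<Sum>j<d. x j * ?U i j) *\<^sub>R gso b i)"
      unfolding lincomb_def scaleR_sum_right scaleR_sum_left by (subst sum.swap) simp
    also have "\<dots> = lincomb d (gso b) (\<lambda>i\<in>{..<d}. x i + (\<Sum>j\<in>{i<..<d}. ?m i j * x j))"
      unfolding lincomb_def
    proof (intro sum.cong refl arg_cong[of _ _ "\<lambda>z. z *\<^sub>R _"])
      fix i assume "i \<in> {..<d}"
      then have i: "i < d" by simp
      have "(\<Sum>j<d. x j * ?U i j) = (\<Sum>j\<in>{i..<d}. x j * ?U i j)"
        by (intro sum.mono_neutral_right) auto
      also have "{i..<d} = insert i {i<..<d}" using i by auto
      also have "(\<Sum>j\<in>insert i {i<..<d}. x j * ?U i j) = x i + (\<Sum>j\<in>{i<..<d}. ?m i j * x j)"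
        by (simp, intro sum.cong) auto
      finally show "(\<Sum>j<d. x j * ?U i j) = (\<lambda>i\<in>{..<d}. x i + (\<Sum>j\<in>{i<..<d}. ?m i j * x j)) i"
        using i by simp
    qed
    finally show ?thesis by simp
  qed
  have sc: "lincomb d (ons b) (\<lambda>i\<in>{..<d}. 0 + norm (gso b i) * x i) = lincomb d (gso b) x" for x
    unfolding lincomb_def using nz by (intro sum.cong) (auto simp: ons_def)
  have "(\<integral>\<^sup>+z. h z \<partial>span_leb d b) = (\<integral>\<^sup>+x. h (lincomb d b x) \<partial>leb d)" by (rule nn_integral_span_leb) simp
  also have "\<dots> = (\<integral>\<^sup>+x. h (lincomb d (gso b) x) \<partial>leb d)"
    using leb_unitriangular[of "\<lambda>x. h (lincomb d (gso b) x)" d ?m, unfolded tri] by simp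
  also have "\<dots> = (\<integral>\<^sup>+x. h (lincomb d (ons b) x) \<partial>leb d)"
    using leb_affine[of d "\<lambda>i. norm (gso b i)" "\<lambda>x. h (lincomb d (ons b) x)" "\<lambda>_. 0", unfolded sc] nz prod1
    by simp
  also have "\<dots> = (\<integral>\<^sup>+z. h z \<partial>span_leb d (ons b))" by (rule nn_integral_span_leb[symmetric]) simp
  finally show "(\<integral>\<^sup>+z. h z \<partial>span_leb d b) = (\<integral>\<^sup>+z. h z \<partial>span_leb d (ons b))" .
qed simp_all

lemma nn_integral_lborel_shift:
  fixes c :: "'a::euclidean_space"
  assumes [measurable]: "f \<in> borel_measurable borel"
  shows "(\<integral>\<^sup>+x. f (c + x) \<partial>lborel) = (\<integral>\<^sup>+x. f x \<partial>lborel)"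
proof -
  have "(\<integral>\<^sup>+x. f x \<partial>lborel) = (\<integral>\<^sup>+x. f x \<partial>distr lborel borel ((+) c))" by (simp add: lborel_distr_plus)
  also have "\<dots> = (\<integral>\<^sup>+x. f (c + x) \<partial>lborel)" by (subst nn_integral_distr) auto
  finally show ?thesis by simp
qed

text \<open>The classical Fubini argument for the uniqueness of Haar measure.\<close>

lemma invariant_measure_unique:
  fixes \<mu> \<nu> :: "'a::euclidean_space measure"
  assumes sets [simp, measurable_cong]: "sets \<mu> = sets borel" "sets \<nu> = sets borel"
    and sf: "sigma_finite_measure \<mu>" "sigma_finite_measure \<nu>"
    and inv_\<mu>: "\<And>f s. s \<in> S \<Longrightarrow> f \<in> borel_measurable borel \<Longrightarrow> (\<integral>\<^sup>+x. f (s + x) \<partial>\<mu>) = (\<integral>\<^sup>+x. f x \<partial>\<mu>)"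
    and inv_\<nu>: "\<And>f s. s \<in> S \<Longrightarrow> f \<in> borel_measurable borel \<Longrightarrow> (\<integral>\<^sup>+x. f (s + x) \<partial>\<nu>) = (\<integral>\<^sup>+x. f x \<partial>\<nu>)"
    and S: "AE x in \<mu>. x \<in> S" "AE x in \<nu>. x \<in> S" "\<And>x. x \<in> S \<Longrightarrow> - x \<in> S"
    and B [measurable]: "B \<in> sets borel" and sym: "\<And>x. x \<in> B \<Longrightarrow> - x \<in> B"
    and \<beta>: "emeasure \<mu> B = \<beta>" "emeasure \<nu> B = \<beta>" "\<beta> \<noteq> 0" "\<beta> \<noteq> \<infinity>"
  shows "\<mu> = \<nu>"
proof (rule measure_eqI_nn_integral)
  fix f :: "'a \<Rightarrow> ennreal" assume f [measurable]: "f \<in> borel_measurable borel"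
  interpret P: pair_sigma_finite \<nu> \<mu> using sf by (intro pair_sigma_finite.intro)
  \<comment> \<open>The double integral of \<open>f (x + y) * g y\<close> is evaluated in both
    orders. Invariance holds only for translations in \<open>S\<close>, which carries both measures,
    so the inner integrals are compared almost everywhere.\<close>
  define g :: "'a \<Rightarrow> ennreal" where "g = indicator B"
  have [measurable]: "g \<in> borel_measurable borel" unfolding g_def by (intro borel_measurable_indicator) auto
  have "(\<integral>\<^sup>+y. (\<integral>\<^sup>+x. f (x + y) * g y \<partial>\<mu>) \<partial>\<nu>) = (\<integral>\<^sup>+y. g y * (\<integral>\<^sup>+x. f x \<partial>\<mu>) \<partial>\<nu>)"
  proof (rule nn_integral_cong_AE)
    show "AE y in \<nu>. (\<integral>\<^sup>+x. f (x + y) * g y \<partial>\<mu>) = g y * (\<integral>\<^sup>+x. f x \<partial>\<mu>)"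
      using S(2)
    proof eventually_elim
      case (elim y)
      have "(\<integral>\<^sup>+x. f (x + y) * g y \<partial>\<mu>) = (\<integral>\<^sup>+x. f (y + x) \<partial>\<mu>) * g y"
        by (subst nn_integral_multc) (auto simp: add.commute)
      then show ?case by (simp add: inv_\<mu>[OF elim] mult.commute)
    qed
  qed
  also have "\<dots> = \<beta> * (\<integral>\<^sup>+x. f x \<partial>\<mu>)"
    by (subst nn_integral_multc) (auto simp: \<beta> g_def)
  finally have 1: "(\<integral>\<^sup>+y. (\<integral>\<^sup>+x. f (x + y) * g y \<partial>\<mu>) \<partial>\<nu>) = \<beta> * (\<integral>\<^sup>+x. f x \<partial>\<mu>)" .
  have "(\<integral>\<^sup>+y. (\<integral>\<^sup>+x. f (x + y) * g y \<partial>\<mu>) \<partial>\<nu>) = (\<integral>\<^sup>+x. (\<integral>\<^sup>+y. f (x + y) * g y \<partial>\<nu>) \<partial>\<mu>)"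
    by (rule P.Fubini'[symmetric]) measurable
  also have "\<dots> = (\<integral>\<^sup>+x. (\<integral>\<^sup>+y. f y * g (y - x) \<partial>\<nu>) \<partial>\<mu>)"
  proof (rule nn_integral_cong_AE)
    show "AE x in \<mu>. (\<integral>\<^sup>+y. f (x + y) * g y \<partial>\<nu>) = (\<integral>\<^sup>+y. f y * g (y - x) \<partial>\<nu>)"
      using S(1)
    proof eventually_elim
      case (elim x)
      show ?case using inv_\<nu>[OF elim, of "\<lambda>y. f y * g (y - x)"] by simp
    qed
  qed
  also have "\<dots> = (\<integral>\<^sup>+y. (\<integral>\<^sup>+x. f y * g (y - x) \<partial>\<mu>) \<partial>\<nu>)"
    by (rule P.Fubini') measurable
  also have "\<dots> = (\<integral>\<^sup>+y. \<beta> * f y \<partial>\<nu>)"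
  proof (rule nn_integral_cong_AE)
    show "AE y in \<nu>. (\<integral>\<^sup>+x. f y * g (y - x) \<partial>\<mu>) = \<beta> * f y"
      using S(2)
    proof eventually_elim
      case (elim y)
      \<comment> \<open>By symmetry of \<open>B\<close>, the argument becomes the translate of
        \<open>x\<close> by \<open>- y\<close>, to which the invariance of \<open>\<mu>\<close>
        applies.\<close>
      have "g (y - x) = g (- y + x)" for x
        using sym[of "y - x"] sym[of "x - y"] by (auto simp: g_def indicator_def)
      then have "(\<integral>\<^sup>+x. f y * g (y - x) \<partial>\<mu>) = f y * (\<integral>\<^sup>+x. g (- y + x) \<partial>\<mu>)"
        by (simp only:) (rule nn_integral_cmult, measurable)
      also have "\<dots> = f y * \<beta>" by (subst inv_\<mu>[OF S(3)[OF elim]]) (auto simp: \<beta> g_def)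
      finally show ?case by (simp add: mult.commute)
    qed
  qed
  also have "\<dots> = \<beta> * (\<integral>\<^sup>+y. f y \<partial>\<nu>)" by (rule nn_integral_cmult) measurable
  finally show "(\<integral>\<^sup>+x. f x \<partial>\<mu>) = (\<integral>\<^sup>+x. f x \<partial>\<nu>)" using 1 \<beta> by (simp add: ennreal_mult_cancel_left)
qed simp_all

lemma sigma_finite_span_leb:
  fixes b :: "nat \<Rightarrow> 'a::euclidean_space"
  assumes "lin_indep d b" shows "sigma_finite_measure (span_leb d b)"
proof -
  obtain C where C: "C > 0" "\<And>x i. i < d \<Longrightarrow> \<bar>x i\<bar> \<le> C * norm (lincomb d b x)"
    using lin_indep_coeff_bound[OF assms] by blast
  have "emeasure (span_leb d b) (ball 0 (real n)) \<noteq> \<infinity>" for n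
  proof -
    have "lincomb d b -` ball 0 (real n) \<inter> space (leb d) \<subseteq> PiE {..<d} (\<lambda>_. {- (C * real n)..C * real n})"
    proof
      fix x assume x: "x \<in> lincomb d b -` ball 0 (real n) \<inter> space (leb d)"
      have "\<bar>x i\<bar> \<le> C * real n" if "i < d" for i
      proof -
        have "norm (lincomb d b x) \<le> real n" using x by simp
        then show ?thesis using C(2)[OF that, of x] mult_left_mono[of "norm (lincomb d b x)" "real n" C] C(1) by linarith
      qed
      then have "\<And>i. i < d \<Longrightarrow> - (C * real n) \<le> x i \<and> x i \<le> C * real n"
        by (simp add: abs_le_iff minus_le_iff)
      then show "x \<in> PiE {..<d} (\<lambda>_. {- (C * real n)..C * real n})"
        using x by (simp add: space_leb PiE_iff)
    qed
    then have "emeasure (span_leb d b) (ball 0 (real n)) \<le> emeasure (leb d) (PiE {..<d} (\<lambda>_. {- (C * real n)..C * real n}))"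
      unfolding span_leb_def by (subst emeasure_distr) (auto intro!: emeasure_mono sets_PiM_I_finite)
    also have "\<dots> = (\<Prod>i<d. ennreal (C * real n + C * real n))"
      using C(1) by (subst lebp.emeasure_PiM) auto
    also have "\<dots> < \<infinity>" using C(1) by (subst prod_ennreal) auto
    finally show ?thesis by simp
  qed
  moreover have "(\<Union>n. ball 0 (real n)) = (UNIV :: 'a set)"
    using reals_Archimedean2 by (auto simp: dist_norm)
  ultimately show ?thesis
    by (intro sigma_finite_measure.intro exI[of _ "range (\<lambda>n. ball 0 (real n))"]) auto
qed

lemma span_leb_shift:
  fixes b :: "nat \<Rightarrow> 'a::euclidean_space"
  assumes s: "s \<in> span (b ` {..<d})" and [measurable]: "f \<in> borel_measurable borel"
  shows "(\<integral>\<^sup>+z. f (s + z) \<partial>span_leb d b) = (\<integral>\<^sup>+z. f z \<partial>span_leb d b)"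
proof -
  obtain t where t: "s = lincomb d b t" using s by (auto simp: span_eq_range_lincomb)
  have "(\<integral>\<^sup>+z. f (s + z) \<partial>span_leb d b) = (\<integral>\<^sup>+x. f (lincomb d b (shift d t x)) \<partial>leb d)"
    by (subst nn_integral_span_leb) (auto simp: t lincomb_shift add.commute)
  also have "\<dots> = (\<integral>\<^sup>+x. f (lincomb d b x) \<partial>leb d)" by (rule leb_shift) measurable
  also have "\<dots> = (\<integral>\<^sup>+z. f z \<partial>span_leb d b)" by (subst nn_integral_span_leb) auto
  finally show ?thesis .
qed

lemma AE_span_leb: "AE z in span_leb d b. z \<in> span (b ` {..<d})"
  for b :: "nat \<Rightarrow> 'a::euclidean_space"
  unfolding span_leb_def by (subst AE_distr_iff) (auto simp: lincomb_in_span closed_subspace borel_closed)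

lemma orthonormal_lin_indep: "orthonormal d u \<Longrightarrow> lin_indep d u"
  unfolding lin_indep_def by (metis inner_lincomb_orthonormal inner_zero_left)

text \<open>For the standard basis the two measures agree on boxes. Any other orthonormal family
  also gives an invariant measure, and the unit ball fixes its normalization, since the ball is
  described by the same inequality in all orthonormal coordinates.\<close>

lemma span_leb_orthonormal:
  fixes u :: "nat \<Rightarrow> 'a::euclidean_space"
  assumes u: "orthonormal DIM('a) u"
  shows "span_leb DIM('a) u = lborel"
proof -
  obtain e where e: "bij_betw e {..<DIM('a)} (Basis :: 'a set)"
    using ex_bij_betw_nat_finite[OF finite_Basis] by (auto simp: atLeast0LessThan)
  then have eB: "e i \<in> Basis" if "i < DIM('a)" for i using that by (auto simp: bij_betw_def)
  have oe: "orthonormal DIM('a) e" unfolding orthonormal_def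
    using e eB by (auto simp: bij_betw_def inj_on_def inner_Basis)
  have "lborel = span_leb DIM('a) e"
  proof (rule lborel_eqI)
    fix l v :: 'a assume le: "\<And>b. b \<in> Basis \<Longrightarrow> l \<bullet> b \<le> v \<bullet> b"
    let ?A = "PiE {..<DIM('a)} (\<lambda>i. {l \<bullet> e i<..<v \<bullet> e i})"
    have "lincomb DIM('a) e x \<in> box l v \<longleftrightarrow> (\<forall>i<DIM('a). l \<bullet> e i < x i \<and> x i < v \<bullet> e i)" for x
    proof -
      have "lincomb DIM('a) e x \<in> box l v \<longleftrightarrow> (\<forall>b\<in>e ` {..<DIM('a)}. l \<bullet> b < lincomb DIM('a) e x \<bullet> b \<and> lincomb DIM('a) e x \<bullet> b < v \<bullet> b)"
        using e by (auto simp: bij_betw_def mem_box)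
      then show ?thesis using inner_lincomb_orthonormal[OF oe] by auto
    qed
    then have "lincomb DIM('a) e -` box l v \<inter> space (leb DIM('a)) = ?A"
      by (auto simp: space_leb PiE_iff)
    then have "emeasure (span_leb DIM('a) e) (box l v) = emeasure (leb DIM('a)) ?A"
      unfolding span_leb_def by (subst emeasure_distr) auto
    also have "\<dots> = (\<Prod>i<DIM('a). emeasure lborel {l \<bullet> e i<..<v \<bullet> e i})"
      by (rule lebp.emeasure_PiM) auto
    also have "\<dots> = (\<Prod>i<DIM('a). ennreal ((v - l) \<bullet> e i))"
      using le[OF eB] by (intro prod.cong) (auto simp: inner_diff_left)
    also have "\<dots> = (\<Prod>b\<in>Basis. ennreal ((v - l) \<bullet> b))"
      using e by (rule prod.reindex_bij_betw)
    also have "\<dots> = ennreal (\<Prod>b\<in>Basis. (v - l) \<bullet> b)"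
      using le by (intro prod_ennreal) (auto simp: inner_diff_left)
    finally show "emeasure (span_leb DIM('a) e) (box l v) = (\<Prod>b\<in>Basis. (v - l) \<bullet> b)" .
  qed simp
  note lb = this
  have ball: "emeasure (span_leb DIM('a) w) (ball 0 1) = emeasure (leb DIM('a)) {x \<in> space (leb DIM('a)). (\<Sum>i<DIM('a). (x i)\<^sup>2) < 1}"
    if "orthonormal DIM('a) w" for w :: "nat \<Rightarrow> 'a"
  proof -
    have "norm (lincomb DIM('a) w x) < 1 \<longleftrightarrow> (\<Sum>i<DIM('a). (x i)\<^sup>2) < 1" for x
      unfolding norm_lincomb_orthonormal[OF that, symmetric] by (simp add: abs_square_less_1)
    then have "lincomb DIM('a) w -` ball 0 1 \<inter> space (leb DIM('a)) = {x \<in> space (leb DIM('a)). (\<Sum>i<DIM('a). (x i)\<^sup>2) < 1}"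
      by (simp add: set_eq_iff conj_commute)
    then show ?thesis unfolding span_leb_def by (subst emeasure_distr) simp_all
  qed
  have li: "lin_indep DIM('a) u" by (rule orthonormal_lin_indep[OF u])
  have "span (u ` {..<DIM('a)}) = UNIV"
    using dim_lin_indep[OF li] dim_eq_full[of "u ` {..<DIM('a)}"] by simp
  then have inv: "(\<integral>\<^sup>+z. f (s + z) \<partial>span_leb DIM('a) u) = (\<integral>\<^sup>+z. f z \<partial>span_leb DIM('a) u)"
    if "f \<in> borel_measurable borel" for f s
    using span_leb_shift[of s u "DIM('a)" f] that by simp
  show ?thesis
  proof (rule invariant_measure_unique[where S = UNIV and B = "ball 0 1" and \<beta> = "emeasure lborel (ball (0::'a) 1)"])
    show "sigma_finite_measure (span_leb DIM('a) u)" by (rule sigma_finite_span_leb[OF li])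
    show "sigma_finite_measure (lborel :: 'a measure)" by (rule sigma_finite_lborel)
    show "emeasure (span_leb DIM('a) u) (ball 0 1) = emeasure lborel (ball (0::'a) 1)"
      unfolding ball[OF u] by (subst lb) (rule ball[OF oe, symmetric])
  qed (auto simp: inv nn_integral_lborel_shift emeasure_ball ennreal_eq_0_iff not_le)
qed

lemma emeasure_voronoi:
  fixes b :: "nat \<Rightarrow> 'a::euclidean_space"
  assumes "lin_indep d b" shows "emeasure (span_leb d b) (voronoi_cell (zspan d b)) = 1"
proof -
  have "emeasure (span_leb d b) (voronoi_cell (zspan d b)) = emeasure (leb d) (vcell d b)"
    unfolding span_leb_def vcell_def
    by (subst emeasure_distr) (auto simp: closed_voronoi_cell borel_closed intro!: arg_cong[of _ _ "emeasure _"])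
  also have "\<dots> = (\<integral>\<^sup>+x. 1 * indicator (vcell d b) x \<partial>leb d)" by simp
  also have "\<dots> = (\<integral>\<^sup>+x. 1 \<partial>tor d)"
    by (rule leb_voronoi[OF assms]) (auto simp: periodic_def)
  also have "\<dots> = 1" by (simp add: emeasure_tor_space[unfolded space_tor])
  finally show ?thesis .
qed

lemma nn_integral_voronoi:
  fixes b :: "nat \<Rightarrow> 'a::euclidean_space"
  assumes "lin_indep d b"
  shows "(\<integral>\<^sup>+z. ennreal ((norm z)\<^sup>2) * indicator (voronoi_cell (zspan d b)) z \<partial>span_leb d b) = ennreal (mean_sq d b)"
proof -
  have [measurable]: "voronoi_cell (zspan d b) \<in> sets borel" by (intro borel_closed closed_voronoi_cell)
  have "(\<integral>\<^sup>+z. ennreal ((norm z)\<^sup>2) * indicator (voronoi_cell (zspan d b)) z \<partial>span_leb d b) =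
    (\<integral>\<^sup>+x. ennreal ((norm (lincomb d b x))\<^sup>2) * indicator (voronoi_cell (zspan d b)) (lincomb d b x) \<partial>leb d)"
    by (intro nn_integral_span_leb) measurable
  also have "\<dots> = (\<integral>\<^sup>+x. ennreal ((norm (lincomb d b x))\<^sup>2) * indicator (vcell d b) x \<partial>leb d)"
    by (intro nn_integral_cong) (auto simp: vcell_def indicator_def)
  finally show ?thesis using mean_sq_eq_voronoi[OF assms] by simp
qed

lemma integral_voronoi_norm:
  fixes b :: "nat \<Rightarrow> 'a::euclidean_space"
  assumes "lin_indep d b"
  shows "(LINT z:voronoi_cell (zspan d b)|span_leb d b. (norm z)\<^sup>2) = mean_sq d b"
proof -
  have [measurable]: "voronoi_cell (zspan d b) \<in> sets borel" by (intro borel_closed closed_voronoi_cell)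
  have "(LINT z:voronoi_cell (zspan d b)|span_leb d b. (norm z)\<^sup>2) =
    enn2real (\<integral>\<^sup>+z. ennreal (indicator (voronoi_cell (zspan d b)) z *\<^sub>R (norm z)\<^sup>2) \<partial>span_leb d b)"
    unfolding set_lebesgue_integral_def by (intro integral_eq_nn_integral) (auto simp: indicator_def)
  also have "(\<integral>\<^sup>+z. ennreal (indicator (voronoi_cell (zspan d b)) z *\<^sub>R (norm z)\<^sup>2) \<partial>span_leb d b) =
    (\<integral>\<^sup>+z. ennreal ((norm z)\<^sup>2) * indicator (voronoi_cell (zspan d b)) z \<partial>span_leb d b)"
    by (intro nn_integral_cong) (auto simp: indicator_def)
  finally show ?thesis using nn_integral_voronoi[OF assms] by (simp add: mean_sq_nonneg[of d b])
qed

text \<open>Both measures are invariant on the same span, and the Voronoi cell, which depends on the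
  lattice alone, has measure one for both. This makes \<open>mean_sq\<close> an invariant of the
  lattice.\<close>

lemma span_leb_eq_if_zspan_eq:
  fixes b c :: "nat \<Rightarrow> 'a::euclidean_space"
  assumes b: "lin_indep d b" and eq: "zspan d c = zspan d b"
  shows "span_leb d c = span_leb d b"
proof -
  have c: "lin_indep d c" by (rule lin_indep_if_zspan_eq[OF assms])
  have sp: "span (c ` {..<d}) = span (b ` {..<d})" using eq span_zspan by metis
  have neg: "- z \<in> voronoi_cell (zspan d b)" if "z \<in> voronoi_cell (zspan d b)" for z
    unfolding voronoi_cell_def
  proof (intro CollectI ballI)
    fix w assume "w \<in> zspan d b"
    then have "z \<bullet> (- w) \<le> (norm (- w))\<^sup>2 / 2"
      using that zspan_uminus unfolding voronoi_cell_def by blast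
    then show "- z \<bullet> w \<le> (norm w)\<^sup>2 / 2" by simp
  qed
  show ?thesis
  proof (rule invariant_measure_unique[where S = "span (b ` {..<d})" and B = "voronoi_cell (zspan d b)" and \<beta> = 1])
    show "emeasure (span_leb d c) (voronoi_cell (zspan d b)) = 1"
      using emeasure_voronoi[OF c] eq by simp
    show "AE z in span_leb d c. z \<in> span (b ` {..<d})" using AE_span_leb[of c d] sp by simp
  qed (use b c sp in \<open>auto simp: sigma_finite_span_leb span_leb_shift AE_span_leb span_neg emeasure_voronoi neg
    borel_closed closed_voronoi_cell\<close>)
qed

lemma mean_sq_eq_if_zspan_eq:
  fixes b c :: "nat \<Rightarrow> 'a::euclidean_space"
  assumes "lin_indep d b" "zspan d c = zspan d b"
  shows "mean_sq d c = mean_sq d b"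
  using integral_voronoi_norm[OF assms(1)] integral_voronoi_norm[OF lin_indep_if_zspan_eq[OF assms]]
    span_leb_eq_if_zspan_eq[OF assms] assms(2) by simp

section \<open>Isotropic bodies\<close>

text \<open>Turns extensional functions, undefined from \<open>d\<close> on, into functions
  vanishing from \<open>d\<close> on, the points of \<open>Euclidean_space d\<close>.\<close>

definition embed :: "nat \<Rightarrow> (nat \<Rightarrow> real) \<Rightarrow> (nat \<Rightarrow> real)" where
  "embed d x = (\<lambda>i. if i < d then x i else 0)"

text \<open>For orthonormal \<open>u\<close>, an isometric copy of the part of \<open>V\<close> in
  the span.\<close>

definition coord_body :: "nat \<Rightarrow> (nat \<Rightarrow> 'a::real_vector) \<Rightarrow> 'a set \<Rightarrow> (nat \<Rightarrow> real) set" where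
  "coord_body d u V = {y. (\<forall>i\<ge>d. y i = 0) \<and> lincomb d u y \<in> V}"

lemma measurable_embed [measurable]: "embed d \<in> borel_measurable (leb d)"
proof (rule measurable_coordinatewise_then_product)
  fix i show "(\<lambda>x. embed d x i) \<in> borel_measurable (leb d)"
    by (cases "i < d") (auto simp: embed_def)
qed

lemma lborel_Euclidean_embed: "lborel_Euclidean d = distr (leb d) borel (embed d)"
  unfolding lborel_Euclidean_def embed_def ..

lemma sets_lborel_Euclidean [simp, measurable_cong]: "sets (lborel_Euclidean d) = sets borel"
  by (simp add: lborel_Euclidean_embed)

lemma space_lborel_Euclidean [simp]: "space (lborel_Euclidean d) = UNIV"
  by (simp add: lborel_Euclidean_embed)

lemma lincomb_embed: "lincomb d u (embed d x) = lincomb d u x"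
  by (intro lincomb_cong) (auto simp: embed_def)

lemma continuous_on_lincomb:
  fixes u :: "nat \<Rightarrow> 'a::real_normed_vector"
  shows "continuous_on A (lincomb d u)"
  unfolding lincomb_def by (intro continuous_intros continuous_on_subset[OF continuous_on_product_coordinates]) auto

lemma closed_zero_beyond: "closed {y :: nat \<Rightarrow> real. \<forall>i\<ge>d. y i = 0}"
proof -
  have "{y :: nat \<Rightarrow> real. \<forall>i\<ge>d. y i = 0} = (\<Inter>i\<in>{d..}. {y. y i = 0})" by auto
  then show ?thesis
    by (simp only:) (intro closed_INT ballI closed_Collect_eq continuous_on_product_coordinates continuous_intros)
qed

lemma closed_coord_body:
  fixes u :: "nat \<Rightarrow> 'a::real_normed_vector"
  assumes "closed V" shows "closed (coord_body d u V)"
proof -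
  have "coord_body d u V = {y. \<forall>i\<ge>d. y i = 0} \<inter> lincomb d u -` V"
    by (auto simp: coord_body_def)
  then show ?thesis
    using continuous_closed_vimage[OF assms, of "lincomb d u"] continuous_on_lincomb[of UNIV d u]
    by (auto intro!: closed_Int closed_zero_beyond simp: continuous_on_eq_continuous_at)
qed

lemma integral_coord_body:
  fixes u :: "nat \<Rightarrow> 'a::euclidean_space" and F :: "'a \<Rightarrow> real"
  assumes V: "closed V" and F [measurable]: "F \<in> borel_measurable borel"
  shows "(LINT y:coord_body d u V|lborel_Euclidean d. F (lincomb d u y)) = (LINT z:V|span_leb d u. F z)"
proof -
  have [measurable]: "coord_body d u V \<in> sets borel" "V \<in> sets borel"
    using V closed_coord_body by (auto intro: borel_closed)
  have [measurable]: "lincomb d u \<in> borel_measurable (borel :: (nat \<Rightarrow> real) measure)"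
    by (intro borel_measurable_continuous_onI continuous_on_lincomb)
  have ind: "indicator (coord_body d u V) (embed d x) = (indicator V (lincomb d u x) :: real)" for x
    unfolding indicator_def coord_body_def by (auto simp: lincomb_embed) (auto simp: embed_def)
  have "(LINT y:coord_body d u V|lborel_Euclidean d. F (lincomb d u y)) =
    (LINT x|leb d. indicator V (lincomb d u x) *\<^sub>R F (lincomb d u x))"
    unfolding set_lebesgue_integral_def lborel_Euclidean_embed
    by (subst integral_distr) (auto simp: ind lincomb_embed)
  also have "\<dots> = (LINT z:V|span_leb d u. F z)"
    unfolding set_lebesgue_integral_def span_leb_def by (subst integral_distr) auto
  finally show ?thesis .
qed

lemma emeasure_coord_body:
  fixes u :: "nat \<Rightarrow> 'a::euclidean_space"
  assumes V: "closed V"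
  shows "emeasure (lborel_Euclidean d) (coord_body d u V) = emeasure (span_leb d u) V"
proof -
  have "embed d -` coord_body d u V \<inter> space (leb d) = lincomb d u -` V \<inter> space (leb d)"
    by (auto simp: coord_body_def lincomb_embed) (auto simp: embed_def)
  moreover have "coord_body d u V \<in> sets borel" "V \<in> sets borel"
    using V closed_coord_body by (auto intro: borel_closed)
  ultimately show ?thesis
    unfolding lborel_Euclidean_embed span_leb_def by (simp add: emeasure_distr)
qed

text \<open>The lattice vector obtained by rounding down the coordinates of \<open>z\<close> is no
  closer to \<open>z\<close> than the origin is, and it leaves a remainder with coordinates in the
  unit interval.\<close>

lemma norm_voronoi_le:
  fixes b :: "nat \<Rightarrow> 'a::euclidean_space"
  assumes "z \<in> voronoi_cell (zspan d b)" "z \<in> span (b ` {..<d})"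
  shows "norm z \<le> (\<Sum>i<d. norm (b i))"
proof -
  obtain x where x: "z = lincomb d b x" using assms(2) by (auto simp: span_eq_range_lincomb)
  let ?w = "lincomb d b (\<lambda>i. real_of_int \<lfloor>x i\<rfloor>)"
  have "norm z \<le> norm (z - ?w)"
  proof -
    have "z \<bullet> ?w \<le> (norm ?w)\<^sup>2 / 2" using assms(1) zspan_lincomb[of d b "\<lambda>i. \<lfloor>x i\<rfloor>"] unfolding voronoi_cell_def by blast
    moreover have "(norm (z - ?w))\<^sup>2 = (norm z)\<^sup>2 - 2 * (z \<bullet> ?w) + (norm ?w)\<^sup>2"
      by (simp add: power2_norm_eq_inner inner_diff_left inner_diff_right inner_commute)
    ultimately have "(norm z)\<^sup>2 \<le> (norm (z - ?w))\<^sup>2" by linarith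
    then show ?thesis by (simp add: power2_le_iff_abs_le)
  qed
  also have "z - ?w = lincomb d b (\<lambda>i. frac (x i))" unfolding x frac_def lincomb_diff ..
  also have "norm \<dots> \<le> (\<Sum>i<d. norm (b i))"
    unfolding lincomb_def by (intro sum_norm_le) (auto simp: frac_lt_1 less_imp_le intro!: mult_left_le_one_le)
  finally show ?thesis .
qed

section \<open>Voronoi cells as isotropic bodies\<close>

lemma symmetric_convex_body_voronoi:
  fixes b :: "nat \<Rightarrow> 'a::euclidean_space"
  assumes li: "lin_indep d b" and ge: "\<And>w. w \<in> zspan d b \<Longrightarrow> w \<noteq> 0 \<Longrightarrow> 1 \<le> norm w"
  shows "symmetric_convex_body d (coord_body d (ons b) (voronoi_cell (zspan d b)))"
proof -
  let ?V = "voronoi_cell (zspan d b)" and ?u = "ons b"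
  let ?K = "coord_body d ?u ?V"
  have on: "orthonormal d ?u" by (rule orthonormal_ons[OF li])
  have E: "Euclidean_space d = subtopology euclidean {y. \<forall>i\<ge>d. y i = 0}"
    by (simp add: Euclidean_space_def euclidean_product_topology)
  have "compactin (Euclidean_space d) ?K"
  proof -
    define R where "R = (\<Sum>i<d. norm (b i))"
    have R0: "0 \<le> R" unfolding R_def by (intro sum_nonneg) auto
    \<comment> \<open>Points are functions on all of \<open>nat\<close>, so compactness comes from
      the Tychonoff theorem for an infinite cube, of which the body is a closed subset.\<close>
    have "compactin (powertop_real UNIV) (PiE UNIV (\<lambda>_::nat. {-R..R}))"
      by (subst compactin_PiE) auto
    then have c: "compact (PiE UNIV (\<lambda>_::nat. {-R..R}))" by (simp add: euclidean_product_topology)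
    have "?K \<subseteq> PiE UNIV (\<lambda>_::nat. {-R..R})"
    proof
      fix y assume y: "y \<in> ?K"
      have "\<bar>y i\<bar> \<le> R" for i
      proof (cases "i < d")
        case True
        have "\<bar>y i\<bar> = \<bar>lincomb d ?u y \<bullet> ?u i\<bar>" by (simp add: inner_lincomb_orthonormal[OF on True])
        also have "\<dots> \<le> norm (lincomb d ?u y) * norm (?u i)" by (rule Cauchy_Schwarz_ineq2)
        also have "norm (?u i) = 1" using on True by (simp add: orthonormal_def norm_eq_1)
        also have "norm (lincomb d ?u y) \<le> R"
          unfolding R_def using y lincomb_in_span[of d ?u y] span_ons[OF li]
          by (intro norm_voronoi_le) (auto simp: coord_body_def)
        finally show ?thesis by simp
      qed (use y R0 in \<open>auto simp: coord_body_def\<close>)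
      then show "y \<in> PiE UNIV (\<lambda>_::nat. {-R..R})" by (auto simp: abs_le_iff) (metis minus_le_iff)
    qed
    then have "compact ?K"
      using c closed_coord_body[OF closed_voronoi_cell] by (metis closed_Int_compact inf.absorb1)
    then show ?thesis unfolding E by (auto simp: compactin_subtopology coord_body_def)
  qed
  moreover have "(\<lambda>i. (1 - t) * x i + t * y i) \<in> ?K" if "x \<in> ?K" "y \<in> ?K" "t \<in> {0..1}" for x y and t :: real
  proof -
    have "lincomb d ?u (\<lambda>i. (1 - t) * x i + t * y i) = (1 - t) *\<^sub>R lincomb d ?u x + t *\<^sub>R lincomb d ?u y"
      by (simp add: lincomb_add lincomb_scale)
    moreover have "convex ?V"
    proof (rule convexI)
      fix p q and r s :: real assume *: "p \<in> ?V" "q \<in> ?V" "0 \<le> r" "0 \<le> s" "r + s = 1"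
      show "r *\<^sub>R p + s *\<^sub>R q \<in> ?V" unfolding voronoi_cell_def
      proof (intro CollectI ballI)
        fix w assume "w \<in> zspan d b"
        then have "p \<bullet> w \<le> (norm w)\<^sup>2 / 2" "q \<bullet> w \<le> (norm w)\<^sup>2 / 2"
          using * unfolding voronoi_cell_def by blast+
        then have "r * (p \<bullet> w) \<le> r * ((norm w)\<^sup>2 / 2)" "s * (q \<bullet> w) \<le> s * ((norm w)\<^sup>2 / 2)"
          using * by (intro mult_left_mono; simp)+
        then have "(r *\<^sub>R p + s *\<^sub>R q) \<bullet> w \<le> (r + s) * ((norm w)\<^sup>2 / 2)"
          by (simp add: inner_add_left algebra_simps)
        then show "(r *\<^sub>R p + s *\<^sub>R q) \<bullet> w \<le> (norm w)\<^sup>2 / 2" using * by simp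
      qed
    qed
    ultimately show ?thesis using that
      by (auto simp: coord_body_def intro!: convexD[of ?V])
  qed
  moreover have "Euclidean_space d interior_of ?K \<noteq> {}"
  proof -
    \<comment> \<open>Small enough that \<open>d\<close> coordinates below \<open>e\<close> give a
      norm of at most 1/2. This keeps the point in the cell, because nonzero lattice vectors have
      norm at least 1.\<close>
    define e where "e = 1 / (2 * (real d + 1))"
    have e: "e > 0" "real d * e \<le> 1 / 2" by (auto simp: e_def field_simps)
    define U where "U = {y :: nat \<Rightarrow> real. \<forall>i\<ge>d. y i = 0} \<inter> (\<Inter>i\<in>{..<d}. {y. \<bar>y i\<bar> < e})"
    have "openin (Euclidean_space d) U"
    proof -
      have "open (\<Inter>i\<in>{..<d}. {y :: nat \<Rightarrow> real. \<bar>y i\<bar> < e})"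
        by (intro open_INT finite_lessThan ballI open_Collect_less continuous_intros continuous_on_product_coordinates)
      then show ?thesis unfolding E U_def by (auto simp: openin_subtopology Int_commute)
    qed
    moreover have "U \<subseteq> ?K"
    proof
      fix y assume y: "y \<in> U"
      have "norm (lincomb d ?u y) \<le> (\<Sum>i<d. e)"
        unfolding lincomb_def
      proof (rule sum_norm_le)
        fix i assume "i \<in> {..<d}"
        then have "\<bar>y i\<bar> < e" "norm (?u i) = 1" using y on by (auto simp: U_def orthonormal_def norm_eq_1)
        then show "norm (y i *\<^sub>R ?u i) \<le> e" by simp
      qed
      then have n: "norm (lincomb d ?u y) \<le> 1 / 2" using e by simp
      have "lincomb d ?u y \<bullet> w \<le> (norm w)\<^sup>2 / 2" if w: "w \<in> zspan d b" for w
      proof (cases "w = 0")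
        case False
        have "lincomb d ?u y \<bullet> w \<le> norm (lincomb d ?u y) * norm w" by (rule norm_cauchy_schwarz)
        also have "\<dots> \<le> 1 / 2 * norm w" using n by (intro mult_right_mono) auto
        also have "\<dots> \<le> (norm w)\<^sup>2 / 2" using mult_right_mono[OF ge[OF w False], of "norm w"] by (simp add: power2_eq_square)
        finally show ?thesis .
      qed simp
      then show "y \<in> ?K" using y by (auto simp: coord_body_def voronoi_cell_def U_def)
    qed
    moreover have "(\<lambda>_. 0) \<in> U" using e by (auto simp: U_def)
    ultimately show ?thesis using interior_of_maximal[of U ?K "Euclidean_space d"] by blast
  qed
  moreover have "(\<lambda>x i. - x i) ` ?K = ?K"
  proof -
    have neg: "(\<lambda>i. - x i) \<in> ?K" if "x \<in> ?K" for x
    proof -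
      have "- lincomb d ?u x \<in> ?V" unfolding voronoi_cell_def
      proof (intro CollectI ballI)
        fix w assume "w \<in> zspan d b"
        then have "lincomb d ?u x \<bullet> (- w) \<le> (norm (- w))\<^sup>2 / 2"
          using that zspan_uminus unfolding coord_body_def voronoi_cell_def by blast
        then show "- lincomb d ?u x \<bullet> w \<le> (norm w)\<^sup>2 / 2" by simp
      qed
      then show ?thesis using that by (auto simp: coord_body_def lincomb_uminus)
    qed
    then show ?thesis by (auto intro!: image_eqI[of _ _ "\<lambda>i. - x i" for x])
  qed
  ultimately show ?thesis unfolding symmetric_convex_body_def convex_body_def by blast
qed

lemma AE_span_leb_inner_nonzero:
  fixes u :: "nat \<Rightarrow> 'a::euclidean_space"
  assumes u: "orthonormal d u" and k: "k < d"
  shows "AE z in span_leb d u. z \<bullet> u k \<noteq> 0"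
proof -
  have "AE x in leb d. (\<Sum>i<d. (if i = k then 1 else 0) * x i) \<noteq> 0"
    by (rule hyperplane_null[OF k]) simp
  moreover have "(\<Sum>i<d. (if i = k then 1 else 0) * x i) = x k" for x :: "nat \<Rightarrow> real"
    using k by (subst sum.remove[of _ k]) auto
  ultimately have "AE x in leb d. lincomb d u x \<bullet> u k \<noteq> 0"
    by (simp add: inner_lincomb_orthonormal[OF u k])
  then show ?thesis unfolding span_leb_def by (subst AE_distr_iff) auto
qed

text \<open>A symmetric matrix whose off-diagonal entries vanish in every orthonormal basis is
  scalar, and \<open>orth\<close> says this of the second moments of the cell.\<close>

lemma isotropic_body_voronoi:
  fixes b :: "nat \<Rightarrow> 'a::euclidean_space"
  assumes gd: "gram_det d b = 1" and ge: "\<And>w. w \<in> zspan d b \<Longrightarrow> w \<noteq> 0 \<Longrightarrow> 1 \<le> norm w" and d: "d > 0"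
    and orth: "\<And>p q. p \<in> span (b ` {..<d}) \<Longrightarrow> q \<in> span (b ` {..<d}) \<Longrightarrow> norm p = 1 \<Longrightarrow> norm q = 1 \<Longrightarrow> p \<bullet> q = 0 \<Longrightarrow>
      (LINT z:voronoi_cell (zspan d b)|span_leb d b. (z \<bullet> p) * (z \<bullet> q)) = 0"
  shows "coord_body d (ons b) (voronoi_cell (zspan d b)) \<in> isotropic_bodies d"
proof -
  let ?V = "voronoi_cell (zspan d b)" and ?u = "ons b" and ?M = "span_leb d b"
  let ?K = "coord_body d ?u ?V"
  have li: "lin_indep d b" using gd by (simp add: lin_indep_iff_gram_det)
  have on: "orthonormal d ?u" by (rule orthonormal_ons[OF li])
  have M: "span_leb d ?u = ?M" using span_leb_ons[OF gd] by simp
  have V [measurable]: "?V \<in> sets borel" by (intro borel_closed closed_voronoi_cell)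
  have u1: "norm (?u i) = 1" if "i < d" for i using on that by (simp add: orthonormal_def norm_eq_1)
  have us: "?u i \<in> span (b ` {..<d})" if "i < d" for i
    using that span_ons[OF li] span_base[of "?u i" "?u ` {..<d}"] by auto
  have int2: "set_integrable ?M ?V (\<lambda>z. (norm z)\<^sup>2)"
    unfolding set_integrable_def
  proof (rule integrableI_nonneg)
    have "(\<integral>\<^sup>+z. ennreal (indicator ?V z *\<^sub>R (norm z)\<^sup>2) \<partial>?M) = ennreal (mean_sq d b)"
      unfolding nn_integral_voronoi[OF li, symmetric] by (intro nn_integral_cong) (auto simp: indicator_def)
    then show "(\<integral>\<^sup>+z. ennreal (indicator ?V z *\<^sub>R (norm z)\<^sup>2) \<partial>?M) < \<infinity>" by simp
  qed (auto simp: indicator_def)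
  have int: "set_integrable ?M ?V (\<lambda>z. (z \<bullet> ?u i)\<^sup>2)" if i: "i < d" for i
    unfolding set_integrable_def
  proof (rule Bochner_Integration.integrable_bound[OF int2[unfolded set_integrable_def]])
    show "AE z in ?M. norm (indicator ?V z *\<^sub>R (z \<bullet> ?u i)\<^sup>2) \<le> norm (indicator ?V z *\<^sub>R (norm z)\<^sup>2)"
    proof (rule AE_I2)
      fix z
      have "\<bar>z \<bullet> ?u i\<bar> \<le> norm z" using Cauchy_Schwarz_ineq2[of z "?u i"] u1[OF i] by simp
      then have "(z \<bullet> ?u i)\<^sup>2 \<le> (norm z)\<^sup>2" using power_mono[of "\<bar>z \<bullet> ?u i\<bar>" "norm z" 2] by simp
      then show "norm (indicator ?V z *\<^sub>R (z \<bullet> ?u i)\<^sup>2) \<le> norm (indicator ?V z *\<^sub>R (norm z)\<^sup>2)"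
        by (auto simp: indicator_def)
    qed
  qed auto
  define \<alpha> where "\<alpha> i = (LINT z:?V|?M. (z \<bullet> ?u i)\<^sup>2)" for i
  have eq: "\<alpha> i = \<alpha> j" if ij: "i < d" "j < d" "i \<noteq> j" for i j
  proof -
    \<comment> \<open>Rotating \<open>?u i\<close> and \<open>?u j\<close> by 45 degrees turns the
      vanishing mixed moment into half the difference of the two diagonal moments.\<close>
    let ?p = "(1 / sqrt 2) *\<^sub>R (?u i + ?u j)" and ?q = "(1 / sqrt 2) *\<^sub>R (?u i - ?u j)"
    have o: "?u i \<bullet> ?u i = 1" "?u j \<bullet> ?u j = 1" "?u i \<bullet> ?u j = 0" "?u j \<bullet> ?u i = 0"
      using on ij by (auto simp: orthonormal_def)
    have "?p \<bullet> ?p = 1" "?q \<bullet> ?q = 1"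
      using o by (simp_all add: inner_add_left inner_add_right inner_diff_left inner_diff_right)
    then have "norm ?p = 1" "norm ?q = 1" by (simp_all only: norm_eq_1)
    moreover have "?p \<bullet> ?q = 0"
      using o by (simp add: inner_add_left inner_diff_right)
    moreover have "?p \<in> span (b ` {..<d})" "?q \<in> span (b ` {..<d})"
      using us ij by (auto intro!: span_scale span_add span_diff)
    ultimately have "(LINT z:?V|?M. (z \<bullet> ?p) * (z \<bullet> ?q)) = 0" by (intro orth)
    moreover have "(z \<bullet> ?p) * (z \<bullet> ?q) = (1/2) * ((z \<bullet> ?u i)\<^sup>2 - (z \<bullet> ?u j)\<^sup>2)" for z
    proof -
      have "(z \<bullet> ?p) * (z \<bullet> ?q) = (1 / sqrt 2 * (1 / sqrt 2)) * ((z \<bullet> ?u i + z \<bullet> ?u j) * (z \<bullet> ?u i - z \<bullet> ?u j))"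
        by (simp add: inner_add_right inner_diff_right)
      also have "1 / sqrt 2 * (1 / sqrt 2) = 1/2" by simp
      finally show ?thesis by (simp add: power2_eq_square algebra_simps)
    qed
    ultimately have "(LINT z:?V|?M. (1/2) * ((z \<bullet> ?u i)\<^sup>2 - (z \<bullet> ?u j)\<^sup>2)) = 0" by simp
    then have "(LINT z:?V|?M. (z \<bullet> ?u i)\<^sup>2 - (z \<bullet> ?u j)\<^sup>2) = 0"
      by (subst (asm) set_integral_mult_right) simp
    then show ?thesis unfolding \<alpha>_def using set_integral_diff(2)[OF int[OF ij(1)] int[OF ij(2)]] by simp
  qed
  \<comment> \<open>Otherwise almost all of the cell would lie in a hyperplane, but it has measure
    one.\<close>
  have pos: "\<alpha> 0 > 0"
  proof (rule ccontr)
    assume "\<not> ?thesis"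
    moreover have "\<alpha> 0 \<ge> 0" unfolding \<alpha>_def set_lebesgue_integral_def by (intro integral_nonneg_AE) auto
    ultimately have "\<alpha> 0 = 0" by linarith
    then have "(LINT z|?M. indicator ?V z *\<^sub>R (z \<bullet> ?u 0)\<^sup>2) = 0" by (simp only: \<alpha>_def set_lebesgue_integral_def)
    then have "AE z in ?M. indicator ?V z *\<^sub>R (z \<bullet> ?u 0)\<^sup>2 = 0"
      by (subst (asm) integral_nonneg_eq_0_iff_AE[OF int[OF d, unfolded set_integrable_def]]) auto
    then have "AE z in ?M. z \<notin> ?V" using AE_span_leb_inner_nonzero[OF on d] unfolding M
      by eventually_elim (auto simp: indicator_def split: if_splits)
    then have "emeasure ?M ?V = 0" by (subst (asm) AE_iff_null) auto
    then show False using emeasure_voronoi[OF li] by simp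
  qed
  have "(LINT y:?K|lborel_Euclidean d. y i * y j) = (if i = j then \<alpha> 0 else 0)" if ij: "i < d" "j < d" for i j
  proof -
    have "(LINT y:?K|lborel_Euclidean d. y i * y j) =
      (LINT y:?K|lborel_Euclidean d. (lincomb d ?u y \<bullet> ?u i) * (lincomb d ?u y \<bullet> ?u j))"
      by (simp add: inner_lincomb_orthonormal[OF on] ij)
    also have "\<dots> = (LINT z:?V|?M. (z \<bullet> ?u i) * (z \<bullet> ?u j))"
      unfolding M[symmetric] by (rule integral_coord_body[OF closed_voronoi_cell]) measurable
    also have "\<dots> = (if i = j then \<alpha> 0 else 0)"
    proof (cases "i = j")
      case True
      then show ?thesis using eq[of i 0] ij d by (cases "i = 0") (auto simp: \<alpha>_def power2_eq_square)
    next
      case False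
      then show ?thesis using orth[OF us us u1 u1, of i j] on ij by (auto simp: orthonormal_def)
    qed
    finally show ?thesis .
  qed
  then have "isotropic d ?K" unfolding isotropic_def using pos by blast
  moreover have "symmetric_convex_body d ?K" by (rule symmetric_convex_body_voronoi[OF li ge])
  moreover have "emeasure (lborel_Euclidean d) ?K = 1"
    by (simp add: emeasure_coord_body[OF closed_voronoi_cell] M emeasure_voronoi[OF li])
  ultimately show ?thesis by (simp add: isotropic_bodies_def)
qed

lemma integral_coord_body_voronoi:
  fixes b :: "nat \<Rightarrow> 'a::euclidean_space"
  assumes gd: "gram_det d b = 1"
  shows "(LINT y:coord_body d (ons b) (voronoi_cell (zspan d b))|lborel_Euclidean d. (\<Sum>i<d. (y i)\<^sup>2)) = mean_sq d b"
proof -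
  have li: "lin_indep d b" using gd by (simp add: lin_indep_iff_gram_det)
  have "(LINT y:coord_body d (ons b) (voronoi_cell (zspan d b))|lborel_Euclidean d. (\<Sum>i<d. (y i)\<^sup>2)) =
    (LINT y:coord_body d (ons b) (voronoi_cell (zspan d b))|lborel_Euclidean d. (norm (lincomb d (ons b) y))\<^sup>2)"
    by (simp add: norm_lincomb_orthonormal[OF orthonormal_ons[OF li]])
  also have "\<dots> = (LINT z:voronoi_cell (zspan d b)|span_leb d b. (norm z)\<^sup>2)"
    unfolding span_leb_ons[OF gd] by (rule integral_coord_body[OF closed_voronoi_cell]) measurable
  finally show ?thesis by (simp add: integral_voronoi_norm[OF li])
qed

text \<open>Separating a point of norm less than \<open>sqrt \<alpha>\<close> from an isotropic body would bound the second
  moment in the separating direction by less than \<open>\<alpha>\<close>.\<close>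

lemma ball_subset_isotropic_body:
  assumes K: "K \<in> isotropic_bodies d" and \<alpha>: "\<alpha> > 0"
    and iso: "\<And>i j. i < d \<Longrightarrow> j < d \<Longrightarrow> (LINT x:K|lborel_Euclidean d. x i * x j) = (if i = j then \<alpha> else 0)"
    and y0: "\<And>i. i \<ge> d \<Longrightarrow> y i = 0" and y: "(\<Sum>i<d. (y i)\<^sup>2) < \<alpha>"
  shows "y \<in> K"
proof (rule ccontr)
  assume yK: "y \<notin> K"
  let ?M = "lborel_Euclidean d"
  have cb: "convex_body d K" and sym: "(\<lambda>x i. - x i) ` K = K" and vol: "emeasure ?M K = 1"
    using K by (auto simp: isotropic_bodies_def symmetric_convex_body_def)
  have E: "Euclidean_space d = subtopology euclidean {y. \<forall>i\<ge>d. y i = 0}"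
    by (simp add: Euclidean_space_def euclidean_product_topology)
  have comp: "compact K" and K0: "\<And>x i. x \<in> K \<Longrightarrow> i \<ge> d \<Longrightarrow> x i = 0"
    using cb unfolding convex_body_def E by (auto simp: compactin_subtopology)
  have conv: "(\<lambda>i. (1 - u) * x i + u * z i) \<in> K" if "x \<in> K" "z \<in> K" "0 \<le> u" "u \<le> 1" for x z u
    using cb that unfolding convex_body_def by auto
  have [measurable]: "K \<in> sets borel" using comp by (intro borel_closed compact_imp_closed)
  have "K \<noteq> {}" using vol by auto
  define D where "D x = (\<Sum>i<d. (y i - x i)\<^sup>2)" for x
  have "continuous_on K D" unfolding D_def
    by (intro continuous_intros continuous_on_subset[OF continuous_on_product_coordinates]) auto
  then obtain p where p: "p \<in> K" "\<And>x. x \<in> K \<Longrightarrow> D p \<le> D x"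
    using continuous_attains_inf[OF comp \<open>K \<noteq> {}\<close>] by blast
  \<comment> \<open>The normal of a separating hyperplane: \<open>p\<close> is the point of
    \<open>K\<close> nearest to \<open>y\<close>, so moving from it towards another point of
    \<open>K\<close> cannot decrease the distance to first order.\<close>
  define t where "t i = y i - p i" for i
  define ip where "ip x = (\<Sum>i<d. t i * x i)" for x
  have le: "ip x \<le> ip p" if x: "x \<in> K" for x
  proof (rule ccontr)
    assume "\<not> ?thesis"
    then have pos: "0 < ip x - ip p" by simp
    define S where "S = (\<Sum>i<d. (x i - p i)\<^sup>2)"
    have S0: "0 \<le> S" unfolding S_def by (intro sum_nonneg) auto
    have ineq: "2 * u * (ip x - ip p) \<le> u\<^sup>2 * S" if u: "0 \<le> u" "u \<le> 1" for u
    proof -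
      have "D p \<le> D (\<lambda>i. (1 - u) * p i + u * x i)" by (intro p conv x u)
      also have "\<dots> = D p - 2 * u * (ip x - ip p) + u\<^sup>2 * S"
        unfolding D_def ip_def S_def t_def
        by (simp add: sum_distrib_left sum_subtractf[symmetric] sum.distrib[symmetric] power2_eq_square algebra_simps)
      finally show ?thesis by simp
    qed
    have Sp: "S > 0" using ineq[of 1] pos by simp
    \<comment> \<open>The minimizer of the squared distance along the line from \<open>p\<close> to
      \<open>x\<close>, truncated to the segment.\<close>
    define u where "u = min 1 ((ip x - ip p) / S)"
    have u: "0 < u" "u \<le> 1" using pos Sp by (auto simp: u_def)
    have "u * S \<le> ip x - ip p" using Sp by (simp add: u_def min_mult_distrib_right)
    then have "u\<^sup>2 * S \<le> u * (ip x - ip p)" using u by (simp add: power2_eq_square mult.assoc)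
    then show False using ineq[of u] u pos mult_pos_pos[OF u(1) pos] by simp
  qed
  have ipneg: "ip (\<lambda>i. - x i) = - ip x" for x by (simp add: ip_def sum_negf)
  have abs_le: "\<bar>ip x\<bar> \<le> ip p" if "x \<in> K" for x
  proof -
    have "(\<lambda>i. - x i) \<in> K" using sym that by (metis (no_types, lifting) image_eqI)
    then show ?thesis using le[OF that] le[of "\<lambda>i. - x i"] ipneg[of x] by simp
  qed
  define N where "N = (\<Sum>i<d. (t i)\<^sup>2)"
  have N: "N > 0"
  proof (rule ccontr)
    assume "\<not> N > 0"
    moreover have "0 \<le> N" unfolding N_def by (intro sum_nonneg) auto
    ultimately have "N = 0" by linarith
    then have "\<forall>i<d. t i = 0" unfolding N_def by (subst (asm) sum_nonneg_eq_0_iff) auto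
    then have "y i = p i" for i using K0[OF p(1)] y0 by (cases "i < d") (auto simp: t_def)
    then have "y = p" by auto
    then show False using p(1) yK by simp
  qed
  \<comment> \<open>A non-integrable function would have the integral 0, whereas isotropy demands
    the positive value \<open>\<alpha>\<close>.\<close>
  have intd: "set_integrable ?M K (\<lambda>x. x i * x i)" if "i < d" for i
  proof (rule ccontr)
    assume "\<not> ?thesis"
    then have "(LINT x:K|?M. x i * x i) = 0"
      unfolding set_integrable_def set_lebesgue_integral_def by (rule not_integrable_integral_eq)
    then show False using iso[OF that that] \<alpha> by simp
  qed
  have int: "set_integrable ?M K (\<lambda>x. x i * x j)" if ij: "i < d" "j < d" for i j
    unfolding set_integrable_def
  proof (rule Bochner_Integration.integrable_bound)
    show "integrable ?M (\<lambda>x. indicator K x *\<^sub>R (x i * x i + x j * x j))"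
      using set_integral_add(1)[OF intd[OF ij(1)] intd[OF ij(2)]] by (simp add: set_integrable_def)
    show "AE x in ?M. norm (indicator K x *\<^sub>R (x i * x j)) \<le> norm (indicator K x *\<^sub>R (x i * x i + x j * x j))"
    proof (rule AE_I2)
      fix x :: "nat \<Rightarrow> real"
      have "2 * \<bar>x i * x j\<bar> \<le> x i * x i + x j * x j"
        using zero_le_power2[of "\<bar>x i\<bar> - \<bar>x j\<bar>"] by (simp add: power2_eq_square algebra_simps abs_mult)
      moreover have "0 \<le> x i * x i + x j * x j" by simp
      ultimately have "\<bar>x i * x j\<bar> \<le> \<bar>x i * x i + x j * x j\<bar>" by linarith
      then show "norm (indicator K x *\<^sub>R (x i * x j)) \<le> norm (indicator K x *\<^sub>R (x i * x i + x j * x j))"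
        by (simp add: indicator_def)
    qed
  qed measurable
  have ip2: "(ip x)\<^sup>2 = (\<Sum>i<d. \<Sum>j<d. (t i * t j) * (x i * x j))" for x
    unfolding ip_def power2_eq_square sum_product by (simp add: mult_ac)
  have "(LINT x:K|?M. (ip x)\<^sup>2) = (\<Sum>i<d. \<Sum>j<d. (t i * t j) * (LINT x:K|?M. x i * x j))"
  proof -
    have ii: "integrable ?M (\<lambda>x. t i * (t j * (indicator K x * (x i * x j))))" if "i < d" "j < d" for i j
      using int[OF that] by (auto simp: set_integrable_def)
    have "(LINT x:K|?M. (ip x)\<^sup>2) = (LINT x|?M. (\<Sum>i<d. \<Sum>j<d. t i * (t j * (indicator K x * (x i * x j)))))"
      unfolding set_lebesgue_integral_def
      by (intro Bochner_Integration.integral_cong refl) (simp add: ip2 sum_distrib_left mult_ac)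
    also have "\<dots> = (\<Sum>i<d. \<Sum>j<d. (LINT x|?M. t i * (t j * (indicator K x * (x i * x j)))))"
      using ii by (subst Bochner_Integration.integral_sum) (auto intro!: sum.cong Bochner_Integration.integral_sum)
    finally show ?thesis by (simp add: set_lebesgue_integral_def mult.assoc)
  qed
  also have "\<dots> = (\<Sum>i<d. \<Sum>j<d. if i = j then \<alpha> * (t i)\<^sup>2 else 0)"
    using iso by (intro sum.cong) (auto simp: power2_eq_square)
  also have "\<dots> = \<alpha> * N" by (simp add: N_def sum_distrib_left)
  finally have I: "(LINT x:K|?M. (ip x)\<^sup>2) = \<alpha> * N" .
  have "(LINT x:K|?M. (ip x)\<^sup>2) \<le> (LINT x:K|?M. (ip p)\<^sup>2)"
    unfolding set_lebesgue_integral_def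
  proof (rule integral_mono)
    have "integrable ?M (\<lambda>x. indicator K x *\<^sub>R (ip x)\<^sup>2)"
      using I \<alpha> N not_integrable_integral_eq[of ?M "\<lambda>x. indicator K x *\<^sub>R (ip x)\<^sup>2"]
      by (auto simp: set_lebesgue_integral_def)
    then show "integrable ?M (\<lambda>x. indicator K x *\<^sub>R (ip x)\<^sup>2)" .
    show "integrable ?M (\<lambda>x. indicator K x *\<^sub>R (ip p)\<^sup>2)" using vol by (auto simp: integrable_indicator_iff)
    fix x
    show "indicator K x *\<^sub>R (ip x)\<^sup>2 \<le> indicator K x *\<^sub>R (ip p)\<^sup>2"
      using power_mono[OF abs_le, of x 2] by (auto simp: indicator_def)
  qed
  also have "\<dots> = (ip p)\<^sup>2"
    using vol by (simp add: set_lebesgue_integral_def measure_def)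
  finally have low: "\<alpha> * N \<le> (ip p)\<^sup>2" using I by simp
  have pp: "0 \<le> ip p" using abs_le[OF p(1)] by simp
  \<comment> \<open>As \<open>y\<close> lies beyond the hyperplane through \<open>p\<close>,
    Cauchy-Schwarz bounds \<open>(ip p)\<^sup>2\<close> by \<open>N\<close> times the squared norm
    of \<open>y\<close>, hence strictly below the lower bound \<open>\<alpha> * N\<close> from the
    second moment.\<close>
  have "ip y - ip p = N"
    by (simp add: ip_def N_def t_def sum_subtractf[symmetric] power2_eq_square algebra_simps)
  then have "ip p \<le> ip y" using N by simp
  then have "(ip p)\<^sup>2 \<le> (ip y)\<^sup>2" using pp by (rule power_mono)
  also have "\<dots> \<le> N * (\<Sum>i<d. (y i)\<^sup>2)"
    unfolding ip_def N_def by (rule Cauchy_Schwarz_ineq_sum)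
  also have "\<dots> < N * \<alpha>" using y N by simp
  finally show False using low by (simp add: mult.commute)
qed

text \<open>This makes the supremum over isotropic bodies a genuine upper bound, for which a crude
  estimate suffices: the cube of half side \<open>s\<close> inscribed in the ball of squared radius
  \<open>\<alpha>\<close> has volume at most one, so \<open>s \<le> 1 / 2\<close> and
  \<open>\<alpha> \<le> d / 4\<close>.\<close>

lemma isotropic_body_moment_bound:
  assumes K: "K \<in> isotropic_bodies d" and d: "d > 0"
  shows "(LINT x:K|lborel_Euclidean d. (\<Sum>i<d. (x i)\<^sup>2)) \<le> real d * (real d / 4)"
proof -
  let ?M = "lborel_Euclidean d"
  obtain \<alpha> where \<alpha>: "\<alpha> > 0" and
    iso: "\<And>i j. i < d \<Longrightarrow> j < d \<Longrightarrow> (LINT x:K|?M. x i * x j) = (if i = j then \<alpha> else 0)"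
    using K unfolding isotropic_bodies_def isotropic_def by blast
  have "emeasure ?M K = 1" using K by (auto simp: isotropic_bodies_def)
  have "compact K"
    using K unfolding isotropic_bodies_def symmetric_convex_body_def convex_body_def
    by (auto simp: Euclidean_space_def euclidean_product_topology compactin_subtopology)
  then have [measurable]: "K \<in> sets borel" by (intro borel_closed compact_imp_closed)
  define s where "s = sqrt (\<alpha> / real d)"
  have s: "s > 0" "s\<^sup>2 = \<alpha> / real d" using \<alpha> d by (auto simp: s_def)
  have sub: "PiE {..<d} (\<lambda>_. {-s<..<s}) \<subseteq> embed d -` K \<inter> space (leb d)"
  proof
    fix x :: "nat \<Rightarrow> real" assume x: "x \<in> PiE {..<d} (\<lambda>_. {-s<..<s})"
    have "embed d x \<in> K"
    proof (rule ball_subset_isotropic_body[OF K \<alpha> iso])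
      have "(\<Sum>i<d. (embed d x i)\<^sup>2) < (\<Sum>i<d. s\<^sup>2)"
      proof (rule sum_strict_mono)
        fix i assume "i \<in> {..<d}"
        then have "- s < x i" "x i < s" "i < d" using x by (auto simp: PiE_iff)
        then have "\<bar>embed d x i\<bar> < s" by (simp add: embed_def abs_less_iff)
        then show "(embed d x i)\<^sup>2 < s\<^sup>2" using power_strict_mono[of "\<bar>embed d x i\<bar>" s 2] by simp
      qed (use d in auto)
      then show "(\<Sum>i<d. (embed d x i)\<^sup>2) < \<alpha>" using s d by simp
    qed (auto simp: embed_def)
    then show "x \<in> embed d -` K \<inter> space (leb d)" using x by (auto simp: space_leb PiE_iff)
  qed
  have "ennreal ((2 * s) ^ d) = emeasure (leb d) (PiE {..<d} (\<lambda>_. {-s<..<s}))"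
    using s by (subst lebp.emeasure_PiM) (auto simp: ennreal_power)
  also have "\<dots> \<le> emeasure (leb d) (embed d -` K \<inter> space (leb d))"
    using sub by (intro emeasure_mono) measurable
  also have "\<dots> = emeasure ?M K" unfolding lborel_Euclidean_embed by (simp add: emeasure_distr)
  also have "\<dots> = 1" by fact
  finally have "(2 * s) ^ d \<le> 1" by simp
  then have "2 * s \<le> 1" using power_le_one_iff[of "2 * s" d] s d by auto
  then have "(2 * s)\<^sup>2 \<le> 1" using s by (intro power_le_one) auto
  then have a: "\<alpha> \<le> real d / 4" using s d by (simp add: power_mult_distrib field_simps)
  have int: "set_integrable ?M K (\<lambda>x. (x i)\<^sup>2)" if "i < d" for i
  proof (rule ccontr)
    assume "\<not> ?thesis"
    then have "(LINT x:K|?M. (x i)\<^sup>2) = 0"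
      unfolding set_integrable_def set_lebesgue_integral_def by (rule not_integrable_integral_eq)
    then show False using iso[OF that that] \<alpha> by (simp add: power2_eq_square)
  qed
  have "(LINT x:K|?M. (\<Sum>i<d. (x i)\<^sup>2)) = (\<Sum>i<d. LINT x:K|?M. (x i)\<^sup>2)"
    unfolding set_lebesgue_integral_def scaleR_sum_right
    by (rule Bochner_Integration.integral_sum) (use int in \<open>auto simp: set_integrable_def\<close>)
  also have "\<dots> = (\<Sum>i<d. \<alpha>)" using iso by (intro sum.cong) (auto simp: power2_eq_square)
  also have "\<dots> = real d * \<alpha>" by simp
  also have "\<dots> \<le> real d * (real d / 4)" using a by (rule mult_left_mono) simp
  finally show ?thesis .
qed

section \<open>Stable bases\<close>

text \<open>Stability of the generated lattice inside its own span, so that \<open>d\<close> may be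
  smaller than the dimension.\<close>

definition stable_basis :: "nat \<Rightarrow> (nat \<Rightarrow> 'a::euclidean_space) \<Rightarrow> bool" where
  "stable_basis d b \<longleftrightarrow> gram_det d b = 1 \<and> dets_ge 1 (zspan d b)"

lemma stable_basis_lin_indep: "stable_basis d b \<Longrightarrow> lin_indep d b"
  by (simp add: stable_basis_def lin_indep_iff_gram_det)

lemma stable_basis_if_zspan_eq: "stable_basis d b \<Longrightarrow> zspan d c = zspan d b \<Longrightarrow> stable_basis d c"
  using gram_det_eq_if_zspan_eq[of d b c] stable_basis_lin_indep[of d b] by (simp add: stable_basis_def)

text \<open>The case of rank one: the determinant of the sublattice generated by \<open>w\<close> is
  its norm.\<close>

lemma stable_basis_norm_ge:
  assumes "stable_basis d b" "w \<in> zspan d b" "w \<noteq> 0" shows "1 \<le> norm w"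
proof -
  have g: "gram_det 1 (\<lambda>_. w) = (norm w)\<^sup>2" by (simp add: gram_det_gso gso.simps[of _ 0])
  then have "lin_indep 1 (\<lambda>_. w)" using assms(3) by (simp add: lin_indep_iff_gram_det)
  then have "1 \<le> (norm w)\<^sup>2"
    using dets_geD[of 1 "zspan d b" 1 "\<lambda>_. w"] assms g by (simp add: stable_basis_def)
  then show ?thesis using power_less_one_iff[of "norm w" 2] by force
qed

section \<open>Semicontinuity of the mean squared distance\<close>

lemma vcell_bounded:
  fixes b :: "nat \<Rightarrow> 'a::euclidean_space"
  assumes "lin_indep d b"
  obtains K R where "K \<ge> 0" "R \<ge> 0" "\<And>x. x \<in> vcell d b \<Longrightarrow> norm (lincomb d b x) \<le> K"
    "\<And>x i. x \<in> vcell d b \<Longrightarrow> i < d \<Longrightarrow> \<bar>x i\<bar> \<le> R"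
proof -
  obtain C where C: "C > 0" "\<And>x i. i < d \<Longrightarrow> \<bar>x i\<bar> \<le> C * norm (lincomb d b x)"
    using lin_indep_coeff_bound[OF assms] by blast
  let ?K = "\<Sum>i<d. norm (b i)"
  have K: "norm (lincomb d b x) \<le> ?K" if "x \<in> vcell d b" for x
    using that norm_voronoi_le[OF _ lincomb_in_span] by (auto simp: vcell_def)
  show ?thesis
  proof (rule that[OF _ _ K])
    show "0 \<le> ?K" by (intro sum_nonneg) auto
    then show "0 \<le> C * ?K" using C(1) by simp
    show "\<bar>x i\<bar> \<le> C * ?K" if "x \<in> vcell d b" "i < d" for x i
      using C(2)[OF that(2), of x] mult_left_mono[OF K[OF that(1)], of C] C(1) by linarith
  qed
qed

lemma emeasure_vcell:
  fixes b :: "nat \<Rightarrow> 'a::euclidean_space"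
  assumes "lin_indep d b" shows "emeasure (leb d) (vcell d b) = 1"
  using leb_voronoi[OF assms, of "\<lambda>_. 1"] by (simp add: periodic_def emeasure_tor_space[unfolded space_tor])

text \<open>The cell belongs to one basis and the distance to another: \<open>leb_voronoi\<close>
  asks only for periodicity in the coordinates, which holds for any family \<open>c\<close>.\<close>

lemma nn_integral_vcell_infdist:
  fixes b c :: "nat \<Rightarrow> 'a::euclidean_space"
  assumes "lin_indep d b"
  shows "(\<integral>\<^sup>+x. ennreal ((infdist (lincomb d c x) (zspan d c))\<^sup>2) * indicator (vcell d b) x \<partial>leb d) = ennreal (mean_sq d c)"
  using leb_voronoi[OF assms, of "\<lambda>x. ennreal ((infdist (lincomb d c x) (zspan d c))\<^sup>2)"]
    periodic_infdist[of d "\<lambda>r. ennreal (r\<^sup>2)" c] by (simp add: mean_sq_nn)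

text \<open>The Voronoi cell of \<open>b\<close> is a fundamental domain for the coordinates of \<open>c\<close> as well, so
  \<open>mean_sq\<close> is an infimum of functions that are continuous in the basis.\<close>

lemma mean_sq_upper_semicontinuous:
  fixes b :: "nat \<Rightarrow> 'a::euclidean_space"
  assumes b: "lin_indep d b"
  obtains K R where "\<And>c. mean_sq d c \<le> mean_sq d b + 2 * K * (R * (\<Sum>i<d. norm (c i - b i))) + (R * (\<Sum>i<d. norm (c i - b i)))\<^sup>2"
proof -
  obtain K R where K: "K \<ge> 0" "\<And>x. x \<in> vcell d b \<Longrightarrow> norm (lincomb d b x) \<le> K"
    and R: "R \<ge> 0" "\<And>x i. x \<in> vcell d b \<Longrightarrow> i < d \<Longrightarrow> \<bar>x i\<bar> \<le> R"
    using vcell_bounded[OF b] by metis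
  have "mean_sq d c \<le> mean_sq d b + 2 * K * (R * (\<Sum>i<d. norm (c i - b i))) + (R * (\<Sum>i<d. norm (c i - b i)))\<^sup>2" for c
  proof -
    \<comment> \<open>Bounds how far a point of the cell moves when its coordinates are read in
      \<open>c\<close> instead of \<open>b\<close>. The distance is then estimated by the norm,
      which is exact for \<open>c = b\<close>.\<close>
    define \<delta> where "\<delta> = R * (\<Sum>i<d. norm (c i - b i))"
    have \<delta>0: "0 \<le> \<delta>" unfolding \<delta>_def using R by (intro mult_nonneg_nonneg sum_nonneg) auto
    have "ennreal (mean_sq d c) = (\<integral>\<^sup>+x. ennreal ((infdist (lincomb d c x) (zspan d c))\<^sup>2) * indicator (vcell d b) x \<partial>leb d)"
      by (rule nn_integral_vcell_infdist[OF b, symmetric])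
    also have "\<dots> \<le> (\<integral>\<^sup>+x. ennreal ((norm (lincomb d b x))\<^sup>2) * indicator (vcell d b) x
        + ennreal (2 * K * \<delta> + \<delta>\<^sup>2) * indicator (vcell d b) x \<partial>leb d)"
    proof (rule nn_integral_mono)
      fix x
      show "ennreal ((infdist (lincomb d c x) (zspan d c))\<^sup>2) * indicator (vcell d b) x \<le>
        ennreal ((norm (lincomb d b x))\<^sup>2) * indicator (vcell d b) x + ennreal (2 * K * \<delta> + \<delta>\<^sup>2) * indicator (vcell d b) x"
      proof (cases "x \<in> vcell d b")
        case True
        have "lincomb d c x = lincomb d b x + (\<Sum>i<d. x i *\<^sub>R (c i - b i))"
          by (simp add: lincomb_def scaleR_diff_right sum_subtractf)
        then have "norm (lincomb d c x) \<le> norm (lincomb d b x) + norm (\<Sum>i<d. x i *\<^sub>R (c i - b i))"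
          by (simp add: norm_triangle_ineq)
        also have "norm (\<Sum>i<d. x i *\<^sub>R (c i - b i)) \<le> (\<Sum>i<d. R * norm (c i - b i))"
          using R(2)[OF True] by (intro sum_norm_le) (auto intro!: mult_right_mono)
        also have "\<dots> = \<delta>" by (simp add: \<delta>_def sum_distrib_left)
        finally have "infdist (lincomb d c x) (zspan d c) \<le> norm (lincomb d b x) + \<delta>"
          using infdist_le_norm[of "lincomb d c x" d c] by simp
        then have "(infdist (lincomb d c x) (zspan d c))\<^sup>2 \<le> (norm (lincomb d b x) + \<delta>)\<^sup>2"
          by (intro power_mono infdist_nonneg)
        also have "\<dots> = (norm (lincomb d b x))\<^sup>2 + 2 * norm (lincomb d b x) * \<delta> + \<delta>\<^sup>2"
          by (simp add: power2_sum)
        also have "\<dots> \<le> (norm (lincomb d b x))\<^sup>2 + 2 * K * \<delta> + \<delta>\<^sup>2"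
          using mult_right_mono[OF K(2)[OF True] \<delta>0] by simp
        finally have "ennreal ((infdist (lincomb d c x) (zspan d c))\<^sup>2) \<le> ennreal ((norm (lincomb d b x))\<^sup>2 + (2 * K * \<delta> + \<delta>\<^sup>2))"
          by (intro ennreal_leI) simp
        also have "\<dots> = ennreal ((norm (lincomb d b x))\<^sup>2) + ennreal (2 * K * \<delta> + \<delta>\<^sup>2)"
          using K \<delta>0 by (intro ennreal_plus) auto
        finally show ?thesis using True by simp
      qed simp
    qed
    also have "\<dots> = ennreal (mean_sq d b) + ennreal (2 * K * \<delta> + \<delta>\<^sup>2)"
      by (subst nn_integral_add, measurable) (simp add: mean_sq_eq_voronoi[OF b] nn_integral_cmult_indicator emeasure_vcell[OF b])
    also have "\<dots> = ennreal (mean_sq d b + (2 * K * \<delta> + \<delta>\<^sup>2))"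
      using K \<delta>0 mean_sq_nonneg[of d b] by (intro ennreal_plus[symmetric]) auto
    finally have "mean_sq d c \<le> mean_sq d b + (2 * K * \<delta> + \<delta>\<^sup>2)"
      using K \<delta>0 mean_sq_nonneg[of d b] by (subst (asm) ennreal_le_iff) auto
    then show ?thesis by (simp add: \<delta>_def)
  qed
  then show ?thesis using that by blast
qed

lemma mean_sq_bound:
  fixes b :: "nat \<Rightarrow> 'a::euclidean_space"
  shows "mean_sq d b \<le> (\<Sum>i<d. norm (b i))\<^sup>2"
proof -
  have "ennreal (mean_sq d b) \<le> (\<integral>\<^sup>+x. ennreal ((\<Sum>i<d. norm (b i))\<^sup>2) \<partial>tor d)"
    unfolding mean_sq_nn[symmetric]
  proof (rule nn_integral_mono_AE)
    show "AE x in tor d. ennreal ((infdist (lincomb d b x) (zspan d b))\<^sup>2) \<le> ennreal ((\<Sum>i<d. norm (b i))\<^sup>2)"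
      using AE_tor_unit_cube
    proof eventually_elim
      case (elim x)
      then have "infdist (lincomb d b x) (zspan d b) \<le> (\<Sum>i<d. norm (b i))"
        using infdist_le_norm norm_lincomb_unit_cube order_trans by blast
      then show ?case by (intro ennreal_leI power_mono infdist_nonneg)
    qed
  qed
  also have "\<dots> = ennreal ((\<Sum>i<d. norm (b i))\<^sup>2)" by (simp add: emeasure_tor_space[unfolded space_tor])
  finally show ?thesis by (subst (asm) ennreal_le_iff) auto
qed

section \<open>Compactness and the maximizer\<close>

lemma tendsto_gram_det:
  fixes b :: "'c \<Rightarrow> nat \<Rightarrow> 'a::euclidean_space"
  assumes "\<And>i. i < d \<Longrightarrow> ((\<lambda>m. b m i) \<longlongrightarrow> c i) F"
  shows "((\<lambda>m. gram_det d (b m)) \<longlongrightarrow> gram_det d c) F"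
proof -
  \<comment> \<open>By the Leibniz formula a polynomial in the inner products, hence
    continuous.\<close>
  have e: "gram_det d b = (\<Sum>p\<in>{p. p permutes {0..<d}}. signof p * (\<Prod>i = 0..<d. b i \<bullet> b (p i)))" for b :: "nat \<Rightarrow> 'a"
    unfolding gram_det_def Determinant.det_def
    by (auto intro!: sum.cong arg_cong2[of _ _ _ _ "\<lambda>x y. x * y"] prod.cong simp: permutes_in_image)
  have "((\<lambda>m. b m (p i)) \<longlongrightarrow> c (p i)) F" if "p permutes {0..<d}" "i < d" for p i
    using assms[of "p i"] permutes_in_image[OF that(1), of i] that(2) by simp
  then show ?thesis unfolding e
    by (intro tendsto_sum tendsto_mult tendsto_const tendsto_prod tendsto_inner) (auto simp: assms)
qed

text \<open>Vectors of the limit lattice are limits of lattice vectors with the same integral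
  coefficients. For an independent family the Gram determinant is positive in the limit, so the
  approximating families are eventually independent and the bound 1 passes to the limit.\<close>

lemma stable_basis_limit:
  fixes b :: "nat \<Rightarrow> nat \<Rightarrow> 'a::euclidean_space"
  assumes st: "\<And>m. stable_basis d (b m)" and lim: "\<And>i. i < d \<Longrightarrow> (\<lambda>m. b m i) \<longlonglongrightarrow> c i"
  shows "stable_basis d c"
proof -
  have "(\<lambda>m. gram_det d (b m)) \<longlonglongrightarrow> gram_det d c" by (rule tendsto_gram_det) (rule lim)
  then have 1: "gram_det d c = 1"
    using st LIMSEQ_unique[of "\<lambda>m. gram_det d (b m)" _ 1] by (simp add: stable_basis_def)
  have "1 \<le> gram_det k e" if e: "\<And>j. j < k \<Longrightarrow> e j \<in> zspan d c" "lin_indep k e" for k e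
  proof -
    obtain U where U: "\<And>j. j < k \<Longrightarrow> e j = lincomb d c (\<lambda>i. real_of_int (U i j))"
      using zspan_matrix[of k e d c] e(1) by blast
    define e' where "e' m j = lincomb d (b m) (\<lambda>i. real_of_int (U i j))" for m j
    have "(\<lambda>m. e' m j) \<longlonglongrightarrow> e j" if "j < k" for j
      unfolding e'_def U[OF that] lincomb_def using lim by (intro tendsto_intros) auto
    then have l: "(\<lambda>m. gram_det k (e' m)) \<longlonglongrightarrow> gram_det k e" by (rule tendsto_gram_det)
    moreover have "gram_det k e > 0" using e(2) lin_indep_pos by blast
    ultimately have "eventually (\<lambda>m. gram_det k (e' m) > 0) sequentially" by (rule order_tendstoD)
    then have "eventually (\<lambda>m. 1 \<le> gram_det k (e' m)) sequentially"
    proof eventually_elim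
      case (elim m)
      show ?case
      proof (rule dets_geD)
        show "dets_ge 1 (zspan d (b m))" using st by (simp add: stable_basis_def)
        show "e' m j \<in> zspan d (b m)" for j by (simp add: e'_def zspan_lincomb)
        show "lin_indep k (e' m)" using elim lin_indep_pos by blast
      qed
    qed
    then show ?thesis using l by (intro tendsto_lowerbound[OF l]) auto
  qed
  then show ?thesis using 1 by (auto simp: stable_basis_def dets_ge_def)
qed

text \<open>Reduction changes the basis but neither the lattice nor \<open>mean_sq\<close>, so a
  maximizing sequence can be kept in a compact set. The limit of a subsequence is stable and, by
  upper semicontinuity, attains the supremum.\<close>

lemma exists_max_mean_sq:
  fixes b0 :: "nat \<Rightarrow> 'a::euclidean_space"
  assumes b0: "stable_basis d b0"
  obtains b :: "nat \<Rightarrow> 'a" where "stable_basis d b" "\<And>c :: nat \<Rightarrow> 'a. stable_basis d c \<Longrightarrow> mean_sq d c \<le> mean_sq d b"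
proof -
  \<comment> \<open>The bound of \<open>exists_reduced_basis\<close> for
    \<open>a = A = 1\<close>.\<close>
  define R where "R = real d * sqrt (2 ^ d)"
  have R0: "0 \<le> R" by (simp add: R_def)
  have red: "\<exists>e :: nat \<Rightarrow> 'a. stable_basis d e \<and> mean_sq d e = mean_sq d c \<and> (\<forall>i. norm (e i) \<le> R)"
    if c: "stable_basis d c" for c :: "nat \<Rightarrow> 'a"
  proof -
    obtain e where e: "zspan d e = zspan d c" "\<And>i. i < d \<Longrightarrow> norm (e i) \<le> R"
      using exists_reduced_basis[of d c 1 1] c stable_basis_lin_indep[OF c]
      by (auto simp: stable_basis_def R_def)
    \<comment> \<open>Entries from \<open>d\<close> on do not affect the lattice, but they must be
      bounded for the sequence to stay in a compact product over all of \<open>nat\<close>.\<close>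
    define e' where "e' i = (if i < d then e i else 0)" for i
    have z: "zspan d e' = zspan d c" unfolding e(1)[symmetric] by (rule zspan_cong) (simp add: e'_def)
    then show ?thesis
      using stable_basis_if_zspan_eq[OF c z] mean_sq_eq_if_zspan_eq[OF stable_basis_lin_indep[OF c] z] e(2) R0
      by (intro exI[of _ e']) (auto simp: e'_def)
  qed
  define S where "S = mean_sq d ` {c :: nat \<Rightarrow> 'a. stable_basis d c}"
  have Sb: "s \<le> (real d * R)\<^sup>2" if "s \<in> S" for s
  proof -
    obtain c :: "nat \<Rightarrow> 'a" where c: "stable_basis d c" "s = mean_sq d c" using \<open>s \<in> S\<close> unfolding S_def by blast
    obtain e :: "nat \<Rightarrow> 'a" where e: "mean_sq d e = mean_sq d c" "\<forall>i. norm (e i) \<le> R" using red[OF c(1)] by blast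
    have "mean_sq d e \<le> (\<Sum>i<d. norm (e i))\<^sup>2" by (rule mean_sq_bound)
    also have "\<dots> \<le> (\<Sum>i<d. R)\<^sup>2" using e(2) by (intro power_mono sum_mono sum_nonneg) auto
    finally show ?thesis using c e by simp
  qed
  have "S \<noteq> {}" using b0 by (auto simp: S_def)
  have bdd: "bdd_above S" using Sb by (intro bdd_aboveI)
  have "\<exists>e :: nat \<Rightarrow> 'a. stable_basis d e \<and> (\<forall>i. norm (e i) \<le> R) \<and> Sup S - 1 / real (Suc m) < mean_sq d e" for m
  proof -
    have "Sup S - 1 / real (Suc m) < Sup S" by simp
    then obtain s where "s \<in> S" "Sup S - 1 / real (Suc m) < s"
      using less_cSupD[OF \<open>S \<noteq> {}\<close>] by blast
    then show ?thesis using red unfolding S_def by fastforce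
  qed
  then obtain e :: "nat \<Rightarrow> nat \<Rightarrow> 'a" where e: "\<And>m. stable_basis d (e m)" "\<And>m i. norm (e m i) \<le> R"
    "\<And>m. Sup S - 1 / real (Suc m) < mean_sq d (e m)" by metis
  have "compactin (product_topology (\<lambda>_. euclidean) UNIV) (PiE UNIV (\<lambda>_::nat. cball (0::'a) R))"
    by (subst compactin_PiE) auto
  then have "compact (PiE UNIV (\<lambda>_::nat. cball (0::'a) R))" by (simp add: euclidean_product_topology)
  then have "seq_compact (PiE UNIV (\<lambda>_::nat. cball (0::'a) R))" by (rule compact_imp_seq_compact)
  moreover have "\<forall>m. e m \<in> PiE UNIV (\<lambda>_. cball 0 R)" using e(2) by auto
  ultimately obtain l r where l: "strict_mono r" "(e \<circ> r) \<longlonglongrightarrow> l" by (rule seq_compactE)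
  have li: "(\<lambda>m. e (r m) i) \<longlonglongrightarrow> l i" for i
  proof -
    have "continuous_on UNIV (\<lambda>x :: nat \<Rightarrow> 'a. x i)" by (rule continuous_on_product_coordinates)
    then have "isCont (\<lambda>x :: nat \<Rightarrow> 'a. x i) l" unfolding continuous_on_eq_continuous_at[OF open_UNIV] by simp
    from isCont_tendsto_compose[OF this l(2)] show ?thesis by (simp add: o_def)
  qed
  have stl: "stable_basis d l" using stable_basis_limit[of d "\<lambda>m. e (r m)" l] e(1) li by blast
  obtain K R' where usc: "\<And>c. mean_sq d c \<le> mean_sq d l + 2 * K * (R' * (\<Sum>i<d. norm (c i - l i))) + (R' * (\<Sum>i<d. norm (c i - l i)))\<^sup>2"
    using mean_sq_upper_semicontinuous[OF stable_basis_lin_indep[OF stl]] by blast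
  have "Sup S \<le> mean_sq d l"
  proof (rule LIMSEQ_le)
    have "(\<lambda>m. Sup S - 1 / real (Suc m)) \<longlonglongrightarrow> Sup S - 0"
      by (intro tendsto_diff tendsto_const LIMSEQ_Suc lim_1_over_n)
    from LIMSEQ_subseq_LIMSEQ[OF this l(1)]
    show "(\<lambda>m. Sup S - 1 / real (Suc (r m))) \<longlonglongrightarrow> Sup S" by (simp add: o_def)
    have "(\<lambda>m. mean_sq d l + 2 * K * (R' * (\<Sum>i<d. norm (e (r m) i - l i))) + (R' * (\<Sum>i<d. norm (e (r m) i - l i)))\<^sup>2)
      \<longlonglongrightarrow> mean_sq d l + 2 * K * (R' * (\<Sum>i<d. norm (l i - l i))) + (R' * (\<Sum>i<d. norm (l i - l i)))\<^sup>2"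
      by (intro tendsto_intros li)
    then show "(\<lambda>m. mean_sq d l + 2 * K * (R' * (\<Sum>i<d. norm (e (r m) i - l i))) + (R' * (\<Sum>i<d. norm (e (r m) i - l i)))\<^sup>2)
      \<longlonglongrightarrow> mean_sq d l" by simp
    show "\<exists>N. \<forall>m\<ge>N. Sup S - 1 / real (Suc (r m)) \<le>
        mean_sq d l + 2 * K * (R' * (\<Sum>i<d. norm (e (r m) i - l i))) + (R' * (\<Sum>i<d. norm (e (r m) i - l i)))\<^sup>2"
      using order_trans[OF less_imp_le[OF e(3)] usc] by blast
  qed
  then have "mean_sq d c \<le> mean_sq d l" if "stable_basis d c" for c :: "nat \<Rightarrow> 'a"
    using cSup_upper[OF _ bdd, of "mean_sq d c"] that by (force simp: S_def)
  then show ?thesis using that stl by blast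
qed

section \<open>Splitting along a sublattice\<close>

definition join :: "nat \<Rightarrow> nat \<Rightarrow> (nat \<Rightarrow> 'b) \<Rightarrow> (nat \<Rightarrow> 'b) \<Rightarrow> nat \<Rightarrow> 'b" where
  "join k m x y = (\<lambda>i\<in>{..<k + m}. if i < k then x i else y (i - k))"

lemma lessThan_add_split: "{..<k + m} = {..<k} \<union> (\<lambda>i. k + i) ` {..<m :: nat}"
proof -
  have *: "i \<in> (\<lambda>i. k + i) ` {..<m}" if "\<not> i < k" "i < k + m" for i
    using that by (intro image_eqI[of _ _ "i - k"]) auto
  show ?thesis
  proof (intro equalityI subsetI)
    fix i assume "i \<in> {..<k + m}"
    then show "i \<in> {..<k} \<union> (\<lambda>i. k + i) ` {..<m}" using *[of i] by (cases "i < k") auto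
  qed auto
qed

lemma prod_add_split: "(\<Prod>i<k + m. f i) = (\<Prod>i<k. f i) * (\<Prod>i<m. f (k + i))" for f :: "nat \<Rightarrow> 'b::comm_monoid_mult"
  unfolding lessThan_add_split by (subst prod.union_disjoint) (auto simp: prod.reindex)

lemma sum_add_split: "(\<Sum>i<k + m. f i) = (\<Sum>i<k. f i) + (\<Sum>i<m. f (k + i))" for f :: "nat \<Rightarrow> 'b::comm_monoid_add"
  unfolding lessThan_add_split by (subst sum.union_disjoint) (auto simp: sum.reindex)

section \<open>Product decomposition of coordinates\<close>

lemma measurable_join [measurable]:
  "(\<lambda>p. join k m (fst p) (snd p)) \<in> measurable (leb k \<Otimes>\<^sub>M leb m) (leb (k + m))"
  unfolding join_def
proof (rule measurable_restrict)
  fix i assume i: "i \<in> {..<k + m}"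
  show "(\<lambda>p. if i < k then fst p i else snd p (i - k)) \<in> measurable (leb k \<Otimes>\<^sub>M leb m) lborel"
  proof (cases "i < k")
    case True
    then have "(\<lambda>x. x i) \<in> measurable (leb k) lborel" by (intro measurable_component_singleton) auto
    then show ?thesis using True measurable_compose[OF measurable_fst] by auto
  next
    case False
    then have "(\<lambda>x. x (i - k)) \<in> measurable (leb m) lborel" using i by (intro measurable_component_singleton) auto
    then show ?thesis using False measurable_compose[OF measurable_snd] by auto
  qed
qed

lemma distr_join: "distr (leb k \<Otimes>\<^sub>M leb m) (leb (k + m)) (\<lambda>p. join k m (fst p) (snd p)) = leb (k + m)"
proof (rule lebp.PiM_eqI)
  interpret M: sigma_finite_measure "leb m" by (rule lebp.sigma_finite) simp
  fix A :: "nat \<Rightarrow> real set" assume A: "\<And>i. i \<in> {..<k + m} \<Longrightarrow> A i \<in> sets lborel"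
  have pre: "(\<lambda>p. join k m (fst p) (snd p)) -` PiE {..<k + m} A \<inter> space (leb k \<Otimes>\<^sub>M leb m) =
      PiE {..<k} A \<times> PiE {..<m} (\<lambda>i. A (k + i))"
    unfolding lessThan_add_split join_def
    by (auto simp: space_pair_measure space_leb PiE_iff ball_Un)
  have "emeasure (distr (leb k \<Otimes>\<^sub>M leb m) (leb (k + m)) (\<lambda>p. join k m (fst p) (snd p))) (PiE {..<k + m} A) =
    emeasure (leb k \<Otimes>\<^sub>M leb m) (PiE {..<k} A \<times> PiE {..<m} (\<lambda>i. A (k + i)))"
    using A by (subst emeasure_distr) (auto simp: pre intro!: sets_PiM_I_finite)
  also have "\<dots> = emeasure (leb k) (PiE {..<k} A) * emeasure (leb m) (PiE {..<m} (\<lambda>i. A (k + i)))"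
    using A by (intro M.emeasure_pair_measure_Times sets_PiM_I_finite) auto
  also have "\<dots> = (\<Prod>i<k. emeasure lborel (A i)) * (\<Prod>i<m. emeasure lborel (A (k + i)))"
    using A by (subst (1 2) lebp.emeasure_PiM) auto
  finally show "emeasure (distr (leb k \<Otimes>\<^sub>M leb m) (leb (k + m)) (\<lambda>p. join k m (fst p) (snd p))) (PiE {..<k + m} A) =
    (\<Prod>i<k + m. emeasure lborel (A i))" by (simp add: prod_add_split)
qed auto

lemma nn_integral_join:
  assumes [measurable]: "G \<in> borel_measurable (leb (k + m))"
  shows "(\<integral>\<^sup>+z. G z \<partial>leb (k + m)) = (\<integral>\<^sup>+y. (\<integral>\<^sup>+x. G (join k m x y) \<partial>leb k) \<partial>leb m)"
proof -
  have sf: "sigma_finite_measure (leb j)" for j by (rule lebp.sigma_finite) simp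
  interpret P: pair_sigma_finite "leb k" "leb m" using sf by (intro pair_sigma_finite.intro)
  have "(\<integral>\<^sup>+z. G z \<partial>leb (k + m)) = (\<integral>\<^sup>+z. G z \<partial>distr (leb k \<Otimes>\<^sub>M leb m) (leb (k + m)) (\<lambda>p. join k m (fst p) (snd p)))"
    by (simp only: distr_join)
  also have "\<dots> = (\<integral>\<^sup>+p. G (join k m (fst p) (snd p)) \<partial>(leb k \<Otimes>\<^sub>M leb m))"
    by (rule nn_integral_distr) measurable
  also have "\<dots> = (\<integral>\<^sup>+y. (\<integral>\<^sup>+x. G (join k m x y) \<partial>leb k) \<partial>leb m)"
    by (subst P.nn_integral_snd[symmetric]) auto
  finally show ?thesis .
qed

lemma nn_integral_tor_join:
  assumes G [measurable]: "G \<in> borel_measurable (leb (k + m))"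
  shows "(\<integral>\<^sup>+z. G z \<partial>tor (k + m)) = (\<integral>\<^sup>+y. (\<integral>\<^sup>+x. G (join k m x y) \<partial>tor k) \<partial>tor m)"
proof -
  interpret K: sigma_finite_measure "leb k" by (rule lebp.sigma_finite) simp
  have Gj: "(\<lambda>(y, x). G (join k m x y)) \<in> borel_measurable (leb m \<Otimes>\<^sub>M leb k)"
  proof -
    have "(\<lambda>p. G (join k m (snd p) (fst p))) \<in> borel_measurable (leb m \<Otimes>\<^sub>M leb k)"
      using measurable_compose[OF measurable_compose[OF measurable_pair_swap' measurable_join] G]
      by (simp add: case_prod_beta)
    then show ?thesis by (simp add: case_prod_beta)
  qed
  have cube: "indicator (unit_cube (k + m)) (join k m x y) = (indicator (unit_cube k) x * indicator (unit_cube m) y :: ennreal)"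
    if "x \<in> space (leb k)" "y \<in> space (leb m)" for x y
    using that unfolding unit_cube_def lessThan_add_split join_def
    by (auto simp: indicator_def space_leb PiE_iff ball_Un)
  have "(\<integral>\<^sup>+z. G z \<partial>tor (k + m)) = (\<integral>\<^sup>+z. G z * indicator (unit_cube (k + m)) z \<partial>leb (k + m))"
    by (rule nn_integral_tor) measurable
  also have "\<dots> = (\<integral>\<^sup>+y. (\<integral>\<^sup>+x. G (join k m x y) * indicator (unit_cube (k + m)) (join k m x y) \<partial>leb k) \<partial>leb m)"
    by (rule nn_integral_join) measurable
  also have "\<dots> = (\<integral>\<^sup>+y. (\<integral>\<^sup>+x. (G (join k m x y) * indicator (unit_cube k) x) * indicator (unit_cube m) y \<partial>leb k) \<partial>leb m)"
    by (intro nn_integral_cong) (simp add: cube mult.assoc)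
  also have "\<dots> = (\<integral>\<^sup>+y. (\<integral>\<^sup>+x. G (join k m x y) * indicator (unit_cube k) x \<partial>leb k) * indicator (unit_cube m) y \<partial>leb m)"
  proof (rule nn_integral_cong)
    fix y assume "y \<in> space (leb m)"
    then have [measurable]: "(\<lambda>x. G (join k m x y)) \<in> borel_measurable (leb k)"
      using measurable_Pair2[OF Gj] by simp
    show "(\<integral>\<^sup>+x. (G (join k m x y) * indicator (unit_cube k) x) * indicator (unit_cube m) y \<partial>leb k) =
      (\<integral>\<^sup>+x. G (join k m x y) * indicator (unit_cube k) x \<partial>leb k) * indicator (unit_cube m) y"
      by (rule nn_integral_multc) measurable
  qed
  also have "\<dots> = (\<integral>\<^sup>+y. (\<integral>\<^sup>+x. G (join k m x y) * indicator (unit_cube k) x \<partial>leb k) \<partial>tor m)"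
  proof (rule nn_integral_tor[symmetric])
    have "(\<lambda>(y, x). G (join k m x y) * indicator (unit_cube k) x) \<in> borel_measurable (leb m \<Otimes>\<^sub>M leb k)"
      using Gj unfolding case_prod_beta by measurable
    from K.borel_measurable_nn_integral[OF this]
    show "(\<lambda>y. \<integral>\<^sup>+x. G (join k m x y) * indicator (unit_cube k) x \<partial>leb k) \<in> borel_measurable (leb m)" by simp
  qed
  also have "\<dots> = (\<integral>\<^sup>+y. (\<integral>\<^sup>+x. G (join k m x y) \<partial>tor k) \<partial>tor m)"
  proof (rule nn_integral_cong)
    fix y assume "y \<in> space (tor m)"
    then have "y \<in> space (leb m)" by simp
    then have "(\<lambda>x. G (join k m x y)) \<in> borel_measurable (leb k)"
      using measurable_Pair2[OF Gj] by simp
    then show "(\<integral>\<^sup>+x. G (join k m x y) * indicator (unit_cube k) x \<partial>leb k) = (\<integral>\<^sup>+x. G (join k m x y) \<partial>tor k)"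
      by (rule nn_integral_tor[symmetric])
  qed
  finally show ?thesis .
qed

definition proj_off :: "nat \<Rightarrow> (nat \<Rightarrow> 'a::real_inner) \<Rightarrow> 'a \<Rightarrow> 'a" where
  "proj_off k e y = y - (\<Sum>j<k. (y \<bullet> ons e j) *\<^sub>R ons e j)"

section \<open>Projection off a sublattice\<close>

lemma linear_proj_off: "linear (proj_off k e)"
  unfolding proj_off_def
  by (intro linearI) (auto simp: inner_add_left scaleR_add_left sum.distrib scaleR_sum_right scaleR_diff_right)

context
  fixes k :: nat and e :: "nat \<Rightarrow> 'a::euclidean_space"
  assumes e: "lin_indep k e"
begin

lemma proj_off_diff: "y - proj_off k e y \<in> span (e ` {..<k})"
proof -
  have "(\<Sum>j<k. (y \<bullet> ons e j) *\<^sub>R ons e j) \<in> span (ons e ` {..<k})"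
    by (intro span_sum span_scale span_base) auto
  then show ?thesis by (simp add: proj_off_def span_ons[OF e])
qed

lemma proj_off_orthogonal: "z \<in> span (e ` {..<k}) \<Longrightarrow> proj_off k e y \<bullet> z = 0"
proof -
  have "proj_off k e y \<bullet> ons e i = 0" if "i < k" for i
  proof -
    have "(\<Sum>j<k. (y \<bullet> ons e j) * (ons e j \<bullet> ons e i)) = (\<Sum>j<k. if j = i then y \<bullet> ons e i else 0)"
      using orthonormal_ons[OF e] that by (intro sum.cong) (auto simp: orthonormal_def)
    then show ?thesis using that by (simp add: proj_off_def inner_diff_left inner_sum_left)
  qed
  then show "z \<in> span (e ` {..<k}) \<Longrightarrow> proj_off k e y \<bullet> z = 0"
    using orthogonal_span_of_gens[of z "ons e ` {..<k}"] span_ons[OF e] by auto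
qed

lemma proj_off_eq:
  assumes "\<And>j. j < k \<Longrightarrow> y \<bullet> e j = 0" shows "proj_off k e y = y"
proof -
  have "y \<bullet> z = 0" if "z \<in> span (e ` {..<k})" for z
    using that assms by (intro orthogonal_span_of_gens[OF that]) auto
  then have "y \<bullet> ons e j = 0" if "j < k" for j
    using that span_ons[OF e] span_base[of "ons e j" "ons e ` {..<k}"] by auto
  then show ?thesis by (simp add: proj_off_def)
qed

lemma proj_off_zero: "j < k \<Longrightarrow> proj_off k e (e j) = 0"
proof -
  assume "j < k"
  then have "proj_off k e (e j) \<in> span (e ` {..<k})"
    using proj_off_diff[of "e j"] span_diff[OF span_base[of "e j" "e ` {..<k}"] proj_off_diff[of "e j"]] by auto
  then have "proj_off k e (e j) \<bullet> proj_off k e (e j) = 0" by (rule proj_off_orthogonal)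
  then show ?thesis by simp
qed

text \<open>The Gram-Schmidt vectors from \<open>k\<close> on are already orthogonal to the first
  \<open>k\<close> vectors, so projecting off the latter does not change them. The remaining entries
  of \<open>a\<close> are arbitrary, so that lifts of projected families are covered.\<close>

lemma gram_det_proj_off:
  assumes a: "\<And>i. i < k \<Longrightarrow> a i = e i"
  shows "gram_det (k + m) a = gram_det k e * gram_det m (\<lambda>i. proj_off k e (a (k + i)))"
proof -
  let ?f = "\<lambda>i. proj_off k e (a (k + i))"
  have "gso ?f i = gso a (k + i)" for i
  proof (rule gso_eqI)
    have orth: "gso a (k + i) \<bullet> a j = 0" if "j < k + i" for j
      using that by (intro gso_orthogonal_span span_base) auto
    then have "gso a (k + i) \<bullet> e j = 0" if "j < k" for j using a[OF that] that orth[of j] by auto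
    then have pg: "proj_off k e (gso a (k + i)) = gso a (k + i)" by (rule proj_off_eq)
    have "proj_off k e (a (k + i) - gso a (k + i)) \<in> proj_off k e ` span (a ` {..<k + i})"
      using gso_diff_in_span by blast
    also have "\<dots> = span (proj_off k e ` a ` {..<k + i})"
      by (rule linear_span_image[OF linear_proj_off, symmetric])
    also have "\<dots> \<subseteq> span (?f ` {..<i})"
    proof (intro span_minimal subspace_span subsetI)
      fix z assume "z \<in> proj_off k e ` a ` {..<k + i}"
      then obtain j where j: "j < k + i" "z = proj_off k e (a j)" by auto
      show "z \<in> span (?f ` {..<i})"
      proof (cases "j < k")
        case True
        then show ?thesis using j a proj_off_zero by (simp add: span_zero)
      next
        case False
        then have "z = ?f (j - k)" "j - k < i" using j by auto
        then show ?thesis by (auto intro: span_base)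
      qed
    qed
    finally show "?f i - gso a (k + i) \<in> span (?f ` {..<i})"
      using pg by (simp add: linear_diff[OF linear_proj_off])
    fix j assume "j < i"
    have "gso a (k + i) \<bullet> (a (k + j) - proj_off k e (a (k + j))) = 0"
    proof (rule orthogonal_span_of_gens[OF proj_off_diff])
      fix z assume "z \<in> e ` {..<k}"
      then show "gso a (k + i) \<bullet> z = 0" using \<open>\<And>j. j < k \<Longrightarrow> gso a (k + i) \<bullet> e j = 0\<close> by auto
    qed
    then show "gso a (k + i) \<bullet> ?f j = 0" using orth[of "k + j"] \<open>j < i\<close> by (simp add: inner_diff_right)
  qed
  then have "gram_det m ?f = (\<Prod>i<m. (norm (gso a (k + i)))\<^sup>2)" by (simp add: gram_det_gso)
  moreover have "gram_det k e = gram_det k a" using a by (intro gram_det_cong) auto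
  ultimately show ?thesis by (simp add: gram_det_gso prod_add_split)
qed

end

lemma lincomb_join:
  "lincomb (k + m) b (join k m x y) = lincomb k b x + lincomb m (\<lambda>i. b (k + i)) y"
  unfolding lincomb_def sum_add_split join_def by (intro arg_cong2[of _ _ _ _ "\<lambda>x y. x + y"] sum.cong) auto

lemma stable_basis_sub:
  assumes "stable_basis d e" "k \<le> d" "gram_det k e = 1" shows "stable_basis k e"
  using assms zspan_mono[of k d e] unfolding stable_basis_def dets_ge_def by blast

text \<open>A family in the projected lattice lifts to lattice vectors. Preceded by the first
  \<open>k\<close> vectors of \<open>e\<close>, the lift has the same determinant as the family,
  since \<open>gram_det k e = 1\<close>.\<close>

lemma stable_basis_quotient:
  fixes e :: "nat \<Rightarrow> 'a::euclidean_space"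
  assumes st: "stable_basis (k + m) e" and k: "gram_det k e = 1"
  shows "stable_basis m (\<lambda>i. proj_off k e (e (k + i)))"
proof -
  let ?f = "\<lambda>i. proj_off k e (e (k + i))"
  have li: "lin_indep k e" using k by (simp add: lin_indep_iff_gram_det)
  have "gram_det m ?f = 1"
    using gram_det_proj_off[OF li, of e m] st k by (simp add: stable_basis_def)
  moreover have "1 \<le> gram_det l c" if c: "\<And>j. j < l \<Longrightarrow> c j \<in> zspan m ?f" "lin_indep l c" for l c
  proof -
    obtain U where U: "\<And>j. j < l \<Longrightarrow> c j = lincomb m ?f (\<lambda>i. real_of_int (U i j))"
      using zspan_matrix[of l c m ?f] c(1) by blast
    define y where "y j = lincomb m (\<lambda>i. e (k + i)) (\<lambda>i. real_of_int (U i j))" for j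
    define a where "a i = (if i < k then e i else y (i - k))" for i
    have py: "proj_off k e (a (k + j)) = c j" if "j < l" for j
      unfolding U[OF that] a_def y_def by (simp add: lincomb_linear[OF linear_proj_off])
    have yz: "y j \<in> zspan (k + m) e" for j
    proof -
      have "zspan m (\<lambda>i. e (k + i)) \<subseteq> zspan (k + m) e"
        by (intro zspan_subsetI zspan_base) auto
      then show ?thesis unfolding y_def by (rule subsetD) (rule zspan_lincomb)
    qed
    have "gram_det (k + l) a = gram_det k e * gram_det l (\<lambda>i. proj_off k e (a (k + i)))"
      by (rule gram_det_proj_off[OF li]) (simp add: a_def)
    also have "gram_det l (\<lambda>i. proj_off k e (a (k + i))) = gram_det l c"
      using py by (intro gram_det_cong)
    finally have g: "gram_det (k + l) a = gram_det l c" using k by simp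
    have "1 \<le> gram_det (k + l) a"
    proof (rule dets_geD)
      show "dets_ge 1 (zspan (k + m) e)" using st by (simp add: stable_basis_def)
      show "a j \<in> zspan (k + m) e" if "j < k + l" for j
        using yz zspan_base[of j "k + m" e] by (auto simp: a_def)
      show "lin_indep (k + l) a" using g c(2) by (simp add: lin_indep_iff_gram_det)
    qed
    then show ?thesis using g by simp
  qed
  ultimately show ?thesis by (auto simp: stable_basis_def dets_ge_def)
qed

text \<open>A lattice vector near a given point is chosen in two stages: a lift of the nearest
  projected lattice vector, then the nearest vector of \<open>zspan k e\<close>. The two remainders
  are orthogonal, so their squares add; the choice need not be optimal, hence the inequality. The
  first stage displaces the coordinates of the second by a shift \<open>s\<close> that depends on
  \<open>y\<close> only and disappears in the average over the torus.\<close>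

lemma mean_sq_subadditive:
  fixes e :: "nat \<Rightarrow> 'a::euclidean_space"
  assumes li: "lin_indep (k + m) e"
  shows "mean_sq (k + m) e \<le> mean_sq k e + mean_sq m (\<lambda>i. proj_off k e (e (k + i)))"
proof -
  let ?f = "\<lambda>i. proj_off k e (e (k + i))" and ?g = "\<lambda>i. e (k + i)"
  have lik: "lin_indep k e" using lin_indep_mono[OF li] by simp
  have "gram_det m ?f \<noteq> 0"
    using gram_det_proj_off[OF lik, of e m] li by (simp add: lin_indep_iff_gram_det)
  then have lif: "lin_indep m ?f" by (simp add: lin_indep_iff_gram_det)
  let ?F = "\<lambda>z. ennreal ((infdist (lincomb (k + m) e z) (zspan (k + m) e))\<^sup>2)"
  have inner: "(\<integral>\<^sup>+x. ?F (join k m x y) \<partial>tor k) \<le> ennreal (mean_sq k e) + ennreal ((infdist (lincomb m ?f y) (zspan m ?f))\<^sup>2)" for y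
  proof -
    obtain w where w: "w \<in> zspan m ?f" "\<And>w'. w' \<in> zspan m ?f \<Longrightarrow> norm (lincomb m ?f y - w) \<le> norm (lincomb m ?f y - w')"
      using closest_lattice_point[OF lif] by blast
    obtain n where n: "w = lincomb m ?f (\<lambda>i. real_of_int (n i))" using w(1) by (auto simp: zspan_def)
    define v where "v = lincomb m ?g (\<lambda>i. real_of_int (n i))"
    define r where "r = lincomb m ?g y - v"
    have pr: "proj_off k e r = lincomb m ?f y - w"
      unfolding r_def v_def n by (simp add: linear_diff[OF linear_proj_off] lincomb_linear[OF linear_proj_off])
    have iw: "infdist (lincomb m ?f y) (zspan m ?f) = norm (proj_off k e r)"
      unfolding pr by (rule infdist_eq_norm[OF w])
    obtain s where s: "r - proj_off k e r = lincomb k e s"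
      using proj_off_diff[OF lik, of r] by (auto simp: span_eq_range_lincomb)
    have vz: "v \<in> zspan (k + m) e"
    proof -
      have "zspan m ?g \<subseteq> zspan (k + m) e" by (intro zspan_subsetI zspan_base) auto
      then show ?thesis unfolding v_def by (rule subsetD) (rule zspan_lincomb)
    qed
    have kz: "zspan k e \<subseteq> zspan (k + m) e" by (rule zspan_mono) simp
    have pt: "(infdist (lincomb (k + m) e (join k m x y)) (zspan (k + m) e))\<^sup>2 \<le>
      (infdist (lincomb k e (shift k s x)) (zspan k e))\<^sup>2 + (norm (proj_off k e r))\<^sup>2" for x
    proof -
      obtain l where l: "l \<in> zspan k e" "\<And>w'. w' \<in> zspan k e \<Longrightarrow> norm (lincomb k e (shift k s x) - l) \<le> norm (lincomb k e (shift k s x) - w')"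
        using closest_lattice_point[OF lik] by blast
      have "l + v \<in> zspan (k + m) e" using l(1) kz vz by (intro zspan_add) auto
      then have "infdist (lincomb (k + m) e (join k m x y)) (zspan (k + m) e) \<le> norm (lincomb (k + m) e (join k m x y) - (l + v))"
        using infdist_le[of "l + v" "zspan (k + m) e"] by (simp add: dist_norm)
      also have "lincomb (k + m) e (join k m x y) - (l + v) = (lincomb k e (shift k s x) - l) + proj_off k e r"
        using s by (simp add: lincomb_join lincomb_shift r_def algebra_simps)
      finally have "(infdist (lincomb (k + m) e (join k m x y)) (zspan (k + m) e))\<^sup>2 \<le>
        (norm ((lincomb k e (shift k s x) - l) + proj_off k e r))\<^sup>2"
        by (intro power_mono infdist_nonneg)
      also have "\<dots> = (norm (lincomb k e (shift k s x) - l))\<^sup>2 + (norm (proj_off k e r))\<^sup>2"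
      proof (rule norm_add_Pythagorean)
        have "lincomb k e (shift k s x) - l \<in> span (e ` {..<k})"
          using l(1) zspan_subset_span lincomb_in_span by (blast intro: span_diff)
        from proj_off_orthogonal[OF lik this, of r]
        show "real_inner_class.orthogonal (lincomb k e (shift k s x) - l) (proj_off k e r)"
          by (simp add: real_inner_class.orthogonal_def inner_commute)
      qed
      also have "norm (lincomb k e (shift k s x) - l) = infdist (lincomb k e (shift k s x)) (zspan k e)"
        by (rule infdist_eq_norm[OF l, symmetric])
      finally show ?thesis .
    qed
    have "(\<integral>\<^sup>+x. ?F (join k m x y) \<partial>tor k) \<le>
      (\<integral>\<^sup>+x. ennreal ((infdist (lincomb k e (shift k s x)) (zspan k e))\<^sup>2) + ennreal ((norm (proj_off k e r))\<^sup>2) \<partial>tor k)"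
    proof (rule nn_integral_mono)
      fix x
      show "?F (join k m x y) \<le> ennreal ((infdist (lincomb k e (shift k s x)) (zspan k e))\<^sup>2) + ennreal ((norm (proj_off k e r))\<^sup>2)"
        using ennreal_leI[OF pt[of x]] by simp
    qed
    also have "\<dots> = (\<integral>\<^sup>+x. ennreal ((infdist (lincomb k e (shift k s x)) (zspan k e))\<^sup>2) \<partial>tor k) + ennreal ((norm (proj_off k e r))\<^sup>2)"
      by (subst nn_integral_add, measurable) (simp add: emeasure_tor_space[unfolded space_tor])
    also have "(\<integral>\<^sup>+x. ennreal ((infdist (lincomb k e (shift k s x)) (zspan k e))\<^sup>2) \<partial>tor k) =
      (\<integral>\<^sup>+x. ennreal ((infdist (lincomb k e x) (zspan k e))\<^sup>2) \<partial>tor k)"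
      using periodic_infdist[of k "\<lambda>r. ennreal (r\<^sup>2)" e]
      by (intro tor_shift[of "\<lambda>x. ennreal ((infdist (lincomb k e x) (zspan k e))\<^sup>2)"]) auto
    also have "\<dots> = ennreal (mean_sq k e)" by (rule mean_sq_nn)
    finally show ?thesis by (simp add: iw)
  qed
  have "ennreal (mean_sq (k + m) e) = (\<integral>\<^sup>+y. (\<integral>\<^sup>+x. ?F (join k m x y) \<partial>tor k) \<partial>tor m)"
    unfolding mean_sq_nn[symmetric] by (rule nn_integral_tor_join) measurable
  also have "\<dots> \<le> (\<integral>\<^sup>+y. ennreal (mean_sq k e) + ennreal ((infdist (lincomb m ?f y) (zspan m ?f))\<^sup>2) \<partial>tor m)"
    by (intro nn_integral_mono inner)
  also have "\<dots> = ennreal (mean_sq k e) + ennreal (mean_sq m ?f)"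
    by (subst nn_integral_add, measurable) (simp add: emeasure_tor_space[unfolded space_tor] mean_sq_nn)
  finally have "ennreal (mean_sq (k + m) e) \<le> ennreal (mean_sq k e + mean_sq m ?f)"
    by (simp add: mean_sq_nonneg)
  then show ?thesis by (subst (asm) ennreal_le_iff) (auto simp: mean_sq_nonneg)
qed

text \<open>The family \<open>c\<close> may generate a proper sublattice of the lattice points in
  its span. Passing to an adapted basis divides its Gram determinant by the square of the index;
  stability keeps the result at least 1, so it is exactly 1.\<close>

lemma split_at_det_one:
  fixes b :: "nat \<Rightarrow> 'a::euclidean_space"
  assumes st: "stable_basis d b" and c: "\<And>j. j < k \<Longrightarrow> c j \<in> zspan d b" "lin_indep k c" "gram_det k c \<le> 1" and k: "k \<le> d"
  obtains e :: "nat \<Rightarrow> 'a" where "stable_basis k e" "stable_basis (d - k) (\<lambda>i. proj_off k e (e (k + i)))"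
    "mean_sq d b \<le> mean_sq k e + mean_sq (d - k) (\<lambda>i. proj_off k e (e (k + i)))"
proof -
  have lib: "lin_indep d b" by (rule stable_basis_lin_indep[OF st])
  obtain e where e: "zspan d e = zspan d b" "\<And>j. j < k \<Longrightarrow> e j \<in> span (c ` {..<k})"
    using adapted_basis[OF lib c(2) c(1) k] by blast
  have ste: "stable_basis d e" by (rule stable_basis_if_zspan_eq[OF st e(1)])
  have lie: "lin_indep d e" by (rule stable_basis_lin_indep[OF ste])
  have lik: "lin_indep k e" by (rule lin_indep_mono[OF lie k])
  have "span (e ` {..<k}) = span (c ` {..<k})"
  proof -
    have "e ` {..<k} \<subseteq> span (c ` {..<k})" using e(2) by auto
    then show ?thesis
      using dim_lin_indep[OF lik] dim_lin_indep[OF c(2)]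
      by (metis dim_eq_span dim_span order_refl span_span)
  qed
  then have cs: "c j \<in> span (e ` {..<k})" if "j < k" for j using that by (auto intro: span_base)
  \<comment> \<open>Coordinates in \<open>e\<close> are unique: they are integral, and those from
    \<open>k\<close> on vanish because \<open>c j\<close> lies in the span of the first
    \<open>k\<close> vectors.\<close>
  have "c j \<in> zspan k e" if j: "j < k" for j
  proof -
    obtain n where n: "c j = lincomb d e (\<lambda>i. real_of_int (n i))" using c(1)[OF j] e(1) by (auto simp: zspan_def)
    obtain x where x: "c j = lincomb k e x" using cs[OF j] by (auto simp: span_eq_range_lincomb)
    have "lincomb d e (\<lambda>i. real_of_int (n i)) = lincomb d e (\<lambda>i. if i < k then x i else 0)"
    proof -
      have "lincomb d e (\<lambda>i. if i < k then x i else 0) = lincomb k e (\<lambda>i. if i < k then x i else 0)"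
        unfolding lincomb_def using k by (intro sum.mono_neutral_right) auto
      also have "\<dots> = lincomb k e x" by (intro lincomb_cong) auto
      finally show ?thesis using n x by simp
    qed
    then have "real_of_int (n i) = (if i < k then x i else 0)" if "i < d" for i
      using lin_indep_unique[OF lie, of "\<lambda>i. real_of_int (n i)" "\<lambda>i. if i < k then x i else 0"] that by blast
    then have "c j = lincomb k e (\<lambda>i. real_of_int (n i))" unfolding x using k by (intro lincomb_cong) auto
    then show ?thesis by (simp only: zspan_lincomb)
  qed
  then obtain M :: int where M: "gram_det k c = (real_of_int M)\<^sup>2 * gram_det k e"
    by (rule gram_det_zspan)
  have ge: "1 \<le> gram_det k e"
  proof (rule dets_geD[OF _ _ lik])
    show "dets_ge 1 (zspan d e)" using ste by (simp add: stable_basis_def)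
    show "e j \<in> zspan d e" if "j < k" for j using that k by (intro zspan_base) auto
  qed
  have "M \<noteq> 0" using M c(2) by (auto simp: lin_indep_iff_gram_det)
  then have "1 \<le> \<bar>real_of_int M\<bar>" by linarith
  then have "1 \<le> (real_of_int M)\<^sup>2" using one_le_power[of "\<bar>real_of_int M\<bar>" 2] by simp
  then have "1 * gram_det k e \<le> gram_det k c" unfolding M using ge by (intro mult_right_mono) auto
  then have gk: "gram_det k e = 1" using ge c(3) by linarith
  have d: "k + (d - k) = d" using k by simp
  have "mean_sq d b = mean_sq d e" by (rule mean_sq_eq_if_zspan_eq[OF lib e(1), symmetric])
  also have "\<dots> \<le> mean_sq k e + mean_sq (d - k) (\<lambda>i. proj_off k e (e (k + i)))"
    using mean_sq_subadditive[of k "d - k" e] lie d by simp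
  finally have le: "mean_sq d b \<le> mean_sq k e + mean_sq (d - k) (\<lambda>i. proj_off k e (e (k + i)))" .
  have q: "stable_basis (d - k) (\<lambda>i. proj_off k e (e (k + i)))"
    using stable_basis_quotient[of k "d - k" e] ste gk d by simp
  show ?thesis by (rule that[OF stable_basis_sub[OF ste k gk] q le])
qed

section \<open>Perturbation by transvections\<close>

definition transvection :: "'a::real_inner \<Rightarrow> 'a \<Rightarrow> real \<Rightarrow> 'a \<Rightarrow> 'a" where
  "transvection p q t y = y + (t * (y \<bullet> q)) *\<^sub>R p"

lemma linear_transvection: "linear (transvection p q t)"
  unfolding transvection_def
  by (intro linearI) (auto simp: inner_add_left algebra_simps scaleR_add_left)

lemma norm_transvection_diff:
  assumes "norm p = 1" "norm q = 1" shows "norm (transvection p q t y - y) \<le> \<bar>t\<bar> * norm y"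
proof -
  have "\<bar>y \<bullet> q\<bar> \<le> norm y" using Cauchy_Schwarz_ineq2[of y q] assms by simp
  then show ?thesis using assms by (simp add: transvection_def abs_mult mult_left_mono)
qed

lemma norm_transvection_bounds:
  assumes "norm p = 1" "norm q = 1"
  shows "(1 - \<bar>t\<bar>) * norm y \<le> norm (transvection p q t y)" "norm (transvection p q t y) \<le> (1 + \<bar>t\<bar>) * norm y"
proof -
  have "norm y - norm (transvection p q t y) \<le> norm (transvection p q t y - y)"
    by (metis norm_minus_commute norm_triangle_ineq2)
  then show "(1 - \<bar>t\<bar>) * norm y \<le> norm (transvection p q t y)"
    using norm_transvection_diff[OF assms, of t y] by (simp add: algebra_simps)
  have "norm (transvection p q t y) \<le> norm y + norm (transvection p q t y - y)"
    by (metis norm_triangle_sub)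
  then show "norm (transvection p q t y) \<le> (1 + \<bar>t\<bar>) * norm y"
    using norm_transvection_diff[OF assms, of t y] by (simp add: algebra_simps)
qed

lemma transvection_in_span: "p \<in> span S \<Longrightarrow> y \<in> span S \<Longrightarrow> transvection p q t y \<in> span S"
  unfolding transvection_def by (intro span_add span_scale)

lemma transvection_inverse: "p \<bullet> q = 0 \<Longrightarrow> transvection p q t (transvection p q (- t) y) = y"
  by (simp add: transvection_def inner_add_left inner_diff_left)

text \<open>The coefficients of \<open>c\<close> over \<open>b\<close> are also those of the images,
  so both pairs of determinants differ by the same square. Thus a linear map has a single scaling
  factor on the span.\<close>

lemma gram_det_linear_image_cross:
  assumes T: "linear T" and c: "\<And>j. j < d \<Longrightarrow> c j \<in> span (b ` {..<d})"
  shows "gram_det d (\<lambda>j. T (c j)) * gram_det d b = gram_det d (\<lambda>j. T (b j)) * gram_det d c"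
proof -
  have "\<forall>j. \<exists>w. j < d \<longrightarrow> c j = lincomb d b w" using c by (auto simp: span_eq_range_lincomb)
  then obtain w where w: "\<And>j. j < d \<Longrightarrow> c j = lincomb d b (w j)" by metis
  let ?W = "coldet d (\<lambda>i j. w j i)"
  have "gram_det d c = gram_det d (\<lambda>j. lincomb d b (\<lambda>i. w j i))"
    using w by (intro gram_det_cong) auto
  also have "\<dots> = ?W\<^sup>2 * gram_det d b" by (rule gram_det_lincomb)
  finally have 1: "gram_det d c = ?W\<^sup>2 * gram_det d b" .
  have "gram_det d (\<lambda>j. T (c j)) = gram_det d (\<lambda>j. lincomb d (\<lambda>i. T (b i)) (\<lambda>i. w j i))"
    using w by (intro gram_det_cong) (metis lincomb_linear[OF T])
  also have "\<dots> = ?W\<^sup>2 * gram_det d (\<lambda>i. T (b i))" by (rule gram_det_lincomb)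
  finally have 2: "gram_det d (\<lambda>j. T (c j)) = ?W\<^sup>2 * gram_det d (\<lambda>i. T (b i))" .
  show ?thesis by (simp only: 1 2 mult.assoc mult.commute mult.left_commute)
qed

text \<open>The reflection in \<open>q\<close> conjugates a transvection into its inverse, so both scale Gram
  determinants by the same factor.\<close>

lemma gram_det_transvection:
  fixes b :: "nat \<Rightarrow> 'a::euclidean_space"
  assumes b: "lin_indep d b" and p: "p \<in> span (b ` {..<d})" and q: "q \<in> span (b ` {..<d})" "norm q = 1" and pq: "p \<bullet> q = 0"
  shows "gram_det d (\<lambda>i. transvection p q t (b i)) = gram_det d b"
proof -
  define R where "R y = y - (2 * (y \<bullet> q)) *\<^sub>R q" for y
  have qq: "q \<bullet> q = 1" using q by (simp add: norm_eq_1)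
  have qp: "q \<bullet> p = 0" using pq by (simp add: inner_commute)
  have Riso: "R y \<bullet> R z = y \<bullet> z" for y z
    by (simp add: R_def inner_diff_left inner_diff_right qq inner_commute algebra_simps)
  have Rg: "gram_det d (\<lambda>i. R (c i)) = gram_det d c" for c
    unfolding gram_det_def by (simp add: Riso)
  have Rs: "R (b j) \<in> span (b ` {..<d})" if "j < d" for j
    unfolding R_def using that by (intro span_diff span_scale q(1)) (auto intro: span_base)
  have comm: "transvection p q t (R y) = R (transvection p q (- t) y)" for y
    by (simp add: transvection_def R_def inner_add_left inner_diff_left qq pq qp algebra_simps)
  let ?T = "\<lambda>t. gram_det d (\<lambda>i. transvection p q t (b i))"
  have pos: "gram_det d b > 0" using b lin_indep_pos by blast
  have "gram_det d (\<lambda>j. transvection p q t (R (b j))) * gram_det d b = ?T t * gram_det d (\<lambda>j. R (b j))"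
    by (rule gram_det_linear_image_cross[OF linear_transvection Rs])
  then have "?T (- t) * gram_det d b = ?T t * gram_det d b"
    unfolding comm Rg[of b] Rg[of "\<lambda>j. transvection p q (- t) (b j)"] .
  then have eq: "?T (- t) = ?T t" using pos by simp
  \<comment> \<open>Composing with the inverse multiplies two equal factors to one, and Gram
    determinants are nonnegative.\<close>
  have "gram_det d (\<lambda>j. transvection p q t (transvection p q (- t) (b j))) * gram_det d b = ?T t * ?T (- t)"
    by (rule gram_det_linear_image_cross[OF linear_transvection]) (rule transvection_in_span[OF p], auto intro: span_base)
  then have "(gram_det d b)\<^sup>2 = (?T t)\<^sup>2" unfolding eq transvection_inverse[OF pq] by (simp add: power2_eq_square)
  then show ?thesis
    using gram_det_nonneg[of d b] gram_det_nonneg[of d "\<lambda>i. transvection p q t (b i)"] by (simp add: power2_eq_iff_nonneg)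
qed

text \<open>The norm of a Gram-Schmidt vector is the distance to the span of its predecessors, which
  \<open>T\<close> shrinks at most by the factor \<open>a\<close>. Each of the \<open>k\<close>
  norms enters squared.\<close>

lemma gram_det_linear_ge:
  assumes T: "linear T" and a: "0 \<le> a" and le: "\<And>y. a * norm y \<le> norm (T y)"
  shows "a ^ (2 * k) * gram_det k c \<le> gram_det k (\<lambda>i. T (c i))"
proof -
  have "a\<^sup>2 * (norm (gso c i))\<^sup>2 \<le> (norm (gso (\<lambda>i. T (c i)) i))\<^sup>2" for i
  proof -
    have "T (c i) - gso (\<lambda>i. T (c i)) i \<in> span ((\<lambda>i. T (c i)) ` {..<i})" by (rule gso_diff_in_span)
    also have "(\<lambda>i. T (c i)) ` {..<i} = T ` c ` {..<i}" by auto
    also have "span (T ` c ` {..<i}) = T ` span (c ` {..<i})" by (rule linear_span_image[OF T])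
    finally obtain v where v: "v \<in> span (c ` {..<i})" "T (c i) - gso (\<lambda>i. T (c i)) i = T v" by auto
    have "a * norm (gso c i) \<le> a * norm (c i - v)" using norm_gso_le[OF v(1)] a by (rule mult_left_mono)
    also have "\<dots> \<le> norm (T (c i - v))" by (rule le)
    also have "T (c i - v) = gso (\<lambda>i. T (c i)) i" using v(2) by (simp add: linear_diff[OF T] algebra_simps)
    finally have "(a * norm (gso c i))\<^sup>2 \<le> (norm (gso (\<lambda>i. T (c i)) i))\<^sup>2" using a by (intro power_mono) auto
    then show ?thesis by (simp add: power_mult_distrib)
  qed
  then have "(\<Prod>i<k. a\<^sup>2 * (norm (gso c i))\<^sup>2) \<le> (\<Prod>i<k. (norm (gso (\<lambda>i. T (c i)) i))\<^sup>2)"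
    by (intro prod_mono) auto
  then show ?thesis by (simp add: gram_det_gso prod.distrib power_mult)
qed

section \<open>Stability of nearby lattices\<close>

lemma zspan_linear_image:
  assumes T: "linear T" shows "zspan d (\<lambda>i. T (b i)) = T ` zspan d b"
  unfolding zspan_def image_image lincomb_linear[OF T] ..

text \<open>Only finitely many sublattices have a bounded determinant, since they have bases of bounded
  length.\<close>

lemma sublattice_det_gap:
  fixes b :: "nat \<Rightarrow> 'a::euclidean_space"
  assumes st: "stable_basis d b"
    and strict: "\<And>k c. 0 < k \<Longrightarrow> k < d \<Longrightarrow> (\<And>j. j < k \<Longrightarrow> c j \<in> zspan d b) \<Longrightarrow> lin_indep k c \<Longrightarrow> 1 < gram_det k c"
  obtains \<eta> where "\<eta> > 0" "\<And>k c. 0 < k \<Longrightarrow> k < d \<Longrightarrow> (\<And>j. j < k \<Longrightarrow> c j \<in> zspan d b) \<Longrightarrow> lin_indep k c \<Longrightarrow> 1 + \<eta> \<le> gram_det k c"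
proof -
  have li: "lin_indep d b" by (rule stable_basis_lin_indep[OF st])
  \<comment> \<open>The bound of \<open>exists_reduced_basis\<close> for \<open>a = 1\<close> and
    \<open>A = 2\<close>, in rank \<open>k\<close>.\<close>
  define R where "R k = real k * sqrt (2 ^ k * max 1 (2 / 1))" for k :: nat
  define F where "F k = PiE {..<k} (\<lambda>_. {z \<in> zspan d b. norm z \<le> R k})" for k
  have fin: "finite (F k)" for k unfolding F_def by (intro finite_PiE finite_zspan_ball[OF li]) simp
  \<comment> \<open>The value 2 keeps the set nonempty and stands for all families of larger
    determinant, to which the length bound does not apply.\<close>
  define G where "G = insert 2 (\<Union>k\<in>{0<..<d}. (gram_det k ` {c \<in> F k. lin_indep k c}))"
  have finG: "finite G" unfolding G_def using fin by auto
  have G1: "1 < g" if "g \<in> G" for g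
    using that strict unfolding G_def F_def by (auto simp: PiE_iff)
  define \<eta> where "\<eta> = Min G - 1"
  have MinG: "Min G \<in> G" using finG by (intro Min_in) (auto simp: G_def)
  have \<eta>: "\<eta> > 0" using G1[OF MinG] by (simp add: \<eta>_def)
  have "1 + \<eta> \<le> gram_det k c" if k: "0 < k" "k < d" and c: "\<And>j. j < k \<Longrightarrow> c j \<in> zspan d b" "lin_indep k c" for k c
  proof (cases "gram_det k c \<le> 2")
    case True
    have sub: "zspan k c \<subseteq> zspan d b" using c(1) by (rule zspan_subsetI)
    then have "dets_ge 1 (zspan k c)" using st unfolding stable_basis_def dets_ge_def by blast
    then obtain e where e: "zspan k e = zspan k c" "\<And>i. i < k \<Longrightarrow> norm (e i) \<le> R k"
      using exists_reduced_basis[OF c(2), of 1 2] True unfolding R_def by auto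
    define e' where "e' = restrict e {..<k}"
    have z: "zspan k e' = zspan k c" unfolding e(1)[symmetric] by (rule zspan_cong) (simp add: e'_def)
    have "e' \<in> F k"
      using e(2) sub zspan_base[of _ k e'] unfolding z by (auto simp: F_def e'_def)
    moreover have "lin_indep k e'" by (rule lin_indep_if_zspan_eq[OF c(2) z])
    ultimately have "gram_det k e' \<in> G" using k by (auto simp: G_def)
    then have "Min G \<le> gram_det k e'" using finG by simp
    then show ?thesis using gram_det_eq_if_zspan_eq[OF c(2) z] by (simp add: \<eta>_def)
  next
    case False
    have "Min G \<le> 2" using finG by (intro Min_le) (auto simp: G_def)
    then show ?thesis using False by (simp add: \<eta>_def)
  qed
  then show ?thesis using that \<eta> by blast
qed

text \<open>In ranks strictly between 0 and \<open>d\<close> the gap absorbs the distortion by a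
  small transvection; in rank \<open>d\<close> the determinant is preserved exactly.\<close>

lemma stable_basis_transvection:
  fixes b :: "nat \<Rightarrow> 'a::euclidean_space"
  assumes st: "stable_basis d b"
    and strict: "\<And>k c. 0 < k \<Longrightarrow> k < d \<Longrightarrow> (\<And>j. j < k \<Longrightarrow> c j \<in> zspan d b) \<Longrightarrow> lin_indep k c \<Longrightarrow> 1 < gram_det k c"
    and p: "p \<in> span (b ` {..<d})" "norm p = 1" and q: "q \<in> span (b ` {..<d})" "norm q = 1" and pq: "p \<bullet> q = 0"
  obtains \<epsilon> where "\<epsilon> > 0" "\<And>t. \<bar>t\<bar> < \<epsilon> \<Longrightarrow> stable_basis d (\<lambda>i. transvection p q t (b i))"
proof -
  have li: "lin_indep d b" by (rule stable_basis_lin_indep[OF st])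
  obtain \<eta> where \<eta>: "\<eta> > 0" and gap: "\<And>k c. 0 < k \<Longrightarrow> k < d \<Longrightarrow> (\<And>j. j < k \<Longrightarrow> c j \<in> zspan d b) \<Longrightarrow> lin_indep k c \<Longrightarrow> 1 + \<eta> \<le> gram_det k c"
    using sublattice_det_gap[OF st strict] by blast
  \<comment> \<open>Chosen so that
    \<open>(1 - 2 * real d * \<epsilon>) * (1 + \<eta>) \<ge> 1\<close>, where the first factor
    comes from the Bernoulli inequality with exponent \<open>2 * k\<close>.\<close>
  define \<epsilon> where "\<epsilon> = \<eta> / (2 * (real d + 1) * (1 + \<eta>))"
  have \<epsilon>: "\<epsilon> > 0" using \<eta> by (simp add: \<epsilon>_def)
  have \<epsilon>1: "\<epsilon> \<le> 1"
  proof -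
    have "\<eta> \<le> 1 * (1 + \<eta>)" by simp
    also have "\<dots> \<le> (2 * (real d + 1)) * (1 + \<eta>)" using \<eta> by (intro mult_right_mono) auto
    finally show ?thesis using \<eta> by (simp add: \<epsilon>_def divide_le_eq)
  qed
  have "stable_basis d (\<lambda>i. transvection p q t (b i))" if t: "\<bar>t\<bar> < \<epsilon>" for t
  proof -
    let ?T = "transvection p q t"
    have gd: "gram_det d (\<lambda>i. ?T (b i)) = 1"
      using gram_det_transvection[OF li p(1) q pq] st by (simp add: stable_basis_def)
    have liT: "lin_indep d (\<lambda>i. ?T (b i))" using gd by (simp add: lin_indep_iff_gram_det)
    have "1 \<le> gram_det k c" if c: "\<And>j. j < k \<Longrightarrow> c j \<in> zspan d (\<lambda>i. ?T (b i))" and lic: "lin_indep k c" for k c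
    proof -
      consider "k = 0" | "0 < k" "k < d" | "k = d" | "d < k" by linarith
      then show ?thesis
      proof cases
        case 2
        have "\<forall>j. \<exists>y. j < k \<longrightarrow> y \<in> zspan d b \<and> c j = ?T y"
          using c unfolding zspan_linear_image[OF linear_transvection] by blast
        then obtain y where y: "\<And>j. j < k \<Longrightarrow> y j \<in> zspan d b" "\<And>j. j < k \<Longrightarrow> c j = ?T (y j)" by metis
        have gc: "gram_det k c = gram_det k (\<lambda>j. ?T (y j))" using y(2) by (intro gram_det_cong)
        have "lin_indep k y" unfolding lin_indep_def
        proof (intro allI impI)
          fix x i assume x: "lincomb k y x = 0" "i < k"
          have "lincomb k c x = lincomb k (\<lambda>j. ?T (y j)) x" using y(2) by (intro lincomb_cong) auto
          also have "\<dots> = ?T (lincomb k y x)" by (rule lincomb_linear[OF linear_transvection, symmetric])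
          also have "\<dots> = 0" using x(1) linear_0[OF linear_transvection] by simp
          finally show "x i = 0" using lic x(2) by (auto simp: lin_indep_def)
        qed
        then have g1: "1 + \<eta> \<le> gram_det k y" using gap[OF 2] y(1) by blast
        have "1 \<le> (1 - 2 * real d * \<epsilon>) * (1 + \<eta>)"
        proof -
          have "2 * real d * \<epsilon> * (1 + \<eta>) \<le> 2 * (real d + 1) * \<epsilon> * (1 + \<eta>)"
            using \<epsilon> \<eta> by (intro mult_right_mono) auto
          also have "\<dots> = \<eta>" using \<eta> by (simp add: \<epsilon>_def add_eq_0_iff)
          finally show ?thesis by (simp add: algebra_simps)
        qed
        also have "\<dots> \<le> (1 - \<bar>t\<bar>) ^ (2 * k) * (1 + \<eta>)"
        proof (rule mult_right_mono)
          have "1 - 2 * real d * \<epsilon> \<le> 1 + real (2 * k) * (- \<bar>t\<bar>)"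
            using mult_mono[of "real k" "real d" "\<bar>t\<bar>" \<epsilon>] 2 t by simp
          also have "\<dots> \<le> (1 + (- \<bar>t\<bar>)) ^ (2 * k)" using t \<epsilon>1 by (intro Bernoulli_inequality) auto
          finally show "1 - 2 * real d * \<epsilon> \<le> (1 - \<bar>t\<bar>) ^ (2 * k)" by simp
        qed (use \<eta> in simp)
        also have "\<dots> \<le> (1 - \<bar>t\<bar>) ^ (2 * k) * gram_det k y"
          using g1 t \<epsilon>1 by (intro mult_left_mono) auto
        also have "\<dots> \<le> gram_det k c" unfolding gc
          using norm_transvection_bounds(1)[OF p(2) q(2)] t \<epsilon>1 by (intro gram_det_linear_ge linear_transvection) auto
        finally show ?thesis .
      next
        \<comment> \<open>A family of full rank may generate a proper sublattice; its determinant is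
          that of the whole lattice times the square of a nonzero integer.\<close>
        case 3
        then have "\<And>j. j < d \<Longrightarrow> c j \<in> zspan d (\<lambda>i. ?T (b i))" using c by simp
        then obtain m :: int where m: "gram_det d c = (real_of_int m)\<^sup>2 * gram_det d (\<lambda>i. ?T (b i))"
          by (rule gram_det_zspan)
        have "m \<noteq> 0" using m lic 3 by (auto simp: lin_indep_iff_gram_det)
        then have "1 \<le> \<bar>real_of_int m\<bar>" by linarith
        then show ?thesis using one_le_power[of "\<bar>real_of_int m\<bar>" 2] m gd 3 by simp
      next
        case 4
        have "c ` {..<k} \<subseteq> span ((\<lambda>i. ?T (b i)) ` {..<d})" using c zspan_subset_span by blast
        then have "dim (c ` {..<k}) \<le> dim ((\<lambda>i. ?T (b i)) ` {..<d})" by (metis dim_span dim_subset)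
        then show ?thesis using dim_lin_indep[OF lic] dim_lin_indep[OF liT] 4 by simp
      qed simp
    qed
    then show ?thesis using gd by (auto simp: stable_basis_def dets_ge_def)
  qed
  then show ?thesis using that \<epsilon> by blast
qed

section \<open>The derivative along a transvection\<close>

lemma infdist_linear_image_bounds:
  fixes T :: "'a::real_normed_vector \<Rightarrow> 'a"
  assumes T: "linear T" and L: "L \<noteq> {}"
  shows "(\<And>y. norm (T y) \<le> M * norm y) \<Longrightarrow> 0 < M \<Longrightarrow> infdist (T z) (T ` L) \<le> M * infdist z L"
    and "(\<And>y. a * norm y \<le> norm (T y)) \<Longrightarrow> 0 \<le> a \<Longrightarrow> a * infdist z L \<le> infdist (T z) (T ` L)"
proof -
  assume M: "\<And>y. norm (T y) \<le> M * norm y" "0 < M"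
  have "infdist (T z) (T ` L) / M \<le> infdist z L"
    unfolding infdist_notempty[OF L, of z]
  proof (rule cINF_greatest[OF L])
    fix l assume "l \<in> L"
    then have "infdist (T z) (T ` L) \<le> norm (T (z - l))"
      using infdist_le[of "T l" "T ` L" "T z"] by (simp add: dist_norm linear_diff[OF T])
    also have "\<dots> \<le> M * norm (z - l)" by (rule M)
    finally show "infdist (T z) (T ` L) / M \<le> dist z l" using M by (simp add: dist_norm divide_le_eq mult.commute)
  qed
  then show "infdist (T z) (T ` L) \<le> M * infdist z L" using M by (simp add: divide_le_eq mult.commute)
next
  assume a: "\<And>y. a * norm y \<le> norm (T y)" "0 \<le> a"
  have L': "T ` L \<noteq> {}" using L by simp
  show "a * infdist z L \<le> infdist (T z) (T ` L)"
    unfolding infdist_notempty[OF L', of "T z"]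
  proof (rule cINF_greatest[OF L'])
    fix l' assume "l' \<in> T ` L"
    then obtain l where l: "l \<in> L" "l' = T l" by auto
    have "a * infdist z L \<le> a * dist z l" using infdist_le[OF l(1)] a by (intro mult_left_mono) auto
    also have "\<dots> \<le> norm (T (z - l))" unfolding dist_norm by (rule a)
    finally show "a * infdist z L \<le> dist (T z) l'" by (simp add: l dist_norm linear_diff[OF T])
  qed
qed

lemma mean_sq_eq_integral_vcell:
  fixes b c :: "nat \<Rightarrow> 'a::euclidean_space"
  assumes "lin_indep d b"
  shows "mean_sq d c = (LINT x|leb d. indicator (vcell d b) x * (infdist (lincomb d c x) (zspan d c))\<^sup>2)"
proof -
  have "(LINT x|leb d. indicator (vcell d b) x * (infdist (lincomb d c x) (zspan d c))\<^sup>2) =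
    enn2real (\<integral>\<^sup>+x. ennreal (indicator (vcell d b) x * (infdist (lincomb d c x) (zspan d c))\<^sup>2) \<partial>leb d)"
    by (intro integral_eq_nn_integral) (auto simp: indicator_def)
  also have "(\<integral>\<^sup>+x. ennreal (indicator (vcell d b) x * (infdist (lincomb d c x) (zspan d c))\<^sup>2) \<partial>leb d) =
    (\<integral>\<^sup>+x. ennreal ((infdist (lincomb d c x) (zspan d c))\<^sup>2) * indicator (vcell d b) x \<partial>leb d)"
    by (intro nn_integral_cong) (auto simp: indicator_def)
  also have "\<dots> = ennreal (mean_sq d c)" by (rule nn_integral_vcell_infdist[OF assms])
  finally show ?thesis by (simp add: mean_sq_nonneg)
qed

text \<open>The strict inequality required of \<open>z\<close> holds almost everywhere in the Voronoi cell.\<close>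

lemma eventually_infdist_transvection:
  fixes b :: "nat \<Rightarrow> 'a::euclidean_space"
  assumes b: "lin_indep d b" and p: "norm p = 1" and q: "norm q = 1"
    and z: "z \<in> voronoi_cell (zspan d b)" "\<And>w. w \<in> zspan d b \<Longrightarrow> w \<noteq> 0 \<Longrightarrow> norm z \<noteq> norm (z - w)"
    and t: "t \<longlonglongrightarrow> (0::real)"
  shows "eventually (\<lambda>n. infdist (transvection p q (t n) z) (zspan d (\<lambda>i. transvection p q (t n) (b i)))
    = norm (transvection p q (t n) z)) sequentially"
proof -
  let ?W = "{w \<in> zspan d b. norm w \<le> 2 * norm z + 1} - {0}"
  have less: "norm z < norm (z - w)" if "w \<in> zspan d b" "w \<noteq> 0" for w
    using z(1) z(2)[OF that] that(1) by (force simp: voronoi_cell_iff)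
  \<comment> \<open>The excess in distance of the finitely many candidates; the 1 covers all longer
    lattice vectors.\<close>
  define G where "G = insert 1 ((\<lambda>w. norm (z - w) - norm z) ` ?W)"
  have fG: "finite G" unfolding G_def using finite_zspan_ball[OF b] by auto
  have "Min G \<in> G" using fG by (intro Min_in) (auto simp: G_def)
  moreover have "\<forall>g\<in>G. g > 0" by (auto simp: G_def intro!: less)
  ultimately have \<eta>: "Min G > 0" by blast
  have gap: "norm z + Min G \<le> norm (z - w)" if w: "w \<in> zspan d b" "w \<noteq> 0" for w
  proof (cases "norm w \<le> 2 * norm z + 1")
    case True
    then have "Min G \<le> norm (z - w) - norm z" using fG w by (intro Min_le) (auto simp: G_def)
    then show ?thesis by simp
  next
    case False
    have "Min G \<le> 1" using fG by (intro Min_le) (auto simp: G_def)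
    moreover have "norm w - norm z \<le> norm (z - w)" by (metis norm_minus_commute norm_triangle_ineq2)
    ultimately show ?thesis using False by simp
  qed
  have "(\<lambda>n. (1 - \<bar>t n\<bar>) * (norm z + Min G) - (1 + \<bar>t n\<bar>) * norm z) \<longlonglongrightarrow> (1 - \<bar>0\<bar>) * (norm z + Min G) - (1 + \<bar>0\<bar>) * norm z"
    by (intro tendsto_intros t)
  then have "eventually (\<lambda>n. 0 < (1 - \<bar>t n\<bar>) * (norm z + Min G) - (1 + \<bar>t n\<bar>) * norm z) sequentially"
    using \<eta> by (intro order_tendstoD(1)) auto
  moreover have "eventually (\<lambda>n. \<bar>t n\<bar> < 1) sequentially"
    using tendsto_rabs[OF t] by (intro order_tendstoD(2)) auto
  ultimately show ?thesis
  proof eventually_elim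
    case (elim n)
    let ?T = "transvection p q (t n)"
    have "infdist (?T z) (zspan d (\<lambda>i. ?T (b i))) = norm (?T z - 0)"
    proof (rule infdist_eq_norm[OF zspan_0])
      fix w' assume "w' \<in> zspan d (\<lambda>i. ?T (b i))"
      then obtain w where w: "w \<in> zspan d b" "w' = ?T w"
        unfolding zspan_linear_image[OF linear_transvection] by auto
      show "norm (?T z - 0) \<le> norm (?T z - w')"
      proof (cases "w = 0")
        case True
        moreover have "?T 0 = 0" by (rule linear_0[OF linear_transvection])
        ultimately show ?thesis by (simp add: w)
      next
        case False
        have "norm (?T z) \<le> (1 + \<bar>t n\<bar>) * norm z" by (rule norm_transvection_bounds(2)[OF p q])
        also have "\<dots> \<le> (1 - \<bar>t n\<bar>) * (norm z + Min G)" using elim by simp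
        also have "\<dots> \<le> (1 - \<bar>t n\<bar>) * norm (z - w)"
          using gap[OF w(1) False] elim by (intro mult_left_mono) auto
        also have "\<dots> \<le> norm (?T (z - w))" by (rule norm_transvection_bounds(1)[OF p q])
        finally show ?thesis by (simp add: w linear_diff[OF linear_transvection])
      qed
    qed
    then show ?case by simp
  qed
qed

text \<open>By maximality the difference quotients of \<open>mean_sq\<close> for positive
  \<open>t\<close> are at most zero, and they converge to twice this integral. The opposite
  inequality will come from \<open>- p\<close>.\<close>

lemma integral_voronoi_le_0:
  fixes b :: "nat \<Rightarrow> 'a::euclidean_space"
  assumes b: "lin_indep d b" and p: "norm p = 1" and q: "norm q = 1"
    and \<epsilon>: "\<epsilon> > 0" and max: "\<And>t. \<bar>t\<bar> < \<epsilon> \<Longrightarrow> mean_sq d (\<lambda>i. transvection p q t (b i)) \<le> mean_sq d b"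
  shows "(LINT z:voronoi_cell (zspan d b)|span_leb d b. (z \<bullet> p) * (z \<bullet> q)) \<le> 0"
proof -
  let ?B = "lincomb d b" and ?L = "zspan d b"
  \<comment> \<open>The denominators start at 2, so the sequence stays strictly below
    \<open>\<epsilon>\<close>.\<close>
  define t where "t n = min \<epsilon> 1 / real (Suc (Suc n))" for n
  have t0: "0 < t n" "t n < \<epsilon>" "t n \<le> 1" for n
  proof -
    have "min \<epsilon> 1 / real (Suc (Suc n)) < min \<epsilon> 1 / 1"
      using \<epsilon> by (intro divide_strict_left_mono) auto
    then show "0 < t n" "t n < \<epsilon>" "t n \<le> 1" using \<epsilon> by (auto simp: t_def)
  qed
  have tl: "t \<longlonglongrightarrow> 0"
    unfolding t_def using LIMSEQ_Suc[OF LIMSEQ_Suc[OF lim_const_over_n[of "min \<epsilon> 1"]]] by simp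
  define f where "f s x = (infdist (transvection p q s (?B x)) (zspan d (\<lambda>i. transvection p q s (b i))))\<^sup>2" for s x
  have fm: "mean_sq d (\<lambda>i. transvection p q s (b i)) = (LINT x|leb d. indicator (vcell d b) x * f s x)" for s
    unfolding f_def mean_sq_eq_integral_vcell[OF b] lincomb_linear[OF linear_transvection] ..
  have f0: "mean_sq d b = (LINT x|leb d. indicator (vcell d b) x * (infdist (?B x) ?L)\<^sup>2)"
    by (rule mean_sq_eq_integral_vcell[OF b])
  obtain K where K: "K \<ge> 0" "\<And>x. x \<in> vcell d b \<Longrightarrow> norm (?B x) \<le> K"
    using vcell_bounded[OF b] by metis
  have [measurable]: "f s \<in> borel_measurable (leb d)" for s
    unfolding f_def lincomb_linear[OF linear_transvection] by measurable
  have fb: "(1 - s)\<^sup>2 * (infdist (?B x) ?L)\<^sup>2 \<le> f s x" "f s x \<le> (1 + s)\<^sup>2 * (infdist (?B x) ?L)\<^sup>2"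
    if s: "0 < s" "s \<le> 1" for s x
  proof -
    have ne: "?L \<noteq> {}" using zspan_0 by blast
    have zi: "zspan d (\<lambda>i. transvection p q s (b i)) = transvection p q s ` ?L"
      by (rule zspan_linear_image[OF linear_transvection])
    have up: "infdist (transvection p q s (?B x)) (transvection p q s ` ?L) \<le> (1 + s) * infdist (?B x) ?L"
      using norm_transvection_bounds(2)[OF p q, of s] s
      by (intro infdist_linear_image_bounds(1)[OF linear_transvection ne]) auto
    have lo: "(1 - s) * infdist (?B x) ?L \<le> infdist (transvection p q s (?B x)) (transvection p q s ` ?L)"
      using norm_transvection_bounds(1)[OF p q, of s] s
      by (intro infdist_linear_image_bounds(2)[OF linear_transvection ne]) auto
    show "f s x \<le> (1 + s)\<^sup>2 * (infdist (?B x) ?L)\<^sup>2"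
      unfolding f_def zi power_mult_distrib[symmetric] using up by (intro power_mono infdist_nonneg)
    show "(1 - s)\<^sup>2 * (infdist (?B x) ?L)\<^sup>2 \<le> f s x"
      unfolding f_def zi power_mult_distrib[symmetric] using lo s by (intro power_mono mult_nonneg_nonneg infdist_nonneg) auto
  qed
  define D where "D n x = indicator (vcell d b) x * ((f (t n) x - (infdist (?B x) ?L)\<^sup>2) / t n)" for n x
  \<comment> \<open>Distances are distorted by factors between \<open>1 - s\<close> and
    \<open>1 + s\<close>, so for \<open>s \<le> 1\<close> their squares change by at most
    \<open>3 * s\<close> times their value. This dominates the difference quotients uniformly in
    \<open>n\<close>.\<close>
  have Db: "\<bar>D n x\<bar> \<le> indicator (vcell d b) x * (3 * K\<^sup>2)" for n x
  proof (cases "x \<in> vcell d b")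
    case True
    have ik: "(infdist (?B x) ?L)\<^sup>2 \<le> K\<^sup>2"
      using infdist_le_norm[of "?B x" d b] K(2)[OF True] by (intro power_mono infdist_nonneg) simp
    let ?s = "t n" and ?i = "(infdist (?B x) ?L)\<^sup>2"
    have ss: "?s\<^sup>2 \<le> ?s" using t0[of n] by (simp add: power2_eq_square mult_left_le)
    have "f ?s x - ?i \<le> (2 * ?s + ?s\<^sup>2) * ?i" using fb(2)[OF t0(1,3), of n x] by (simp add: power2_sum algebra_simps)
    also have "\<dots> \<le> (3 * ?s) * K\<^sup>2" using ss t0[of n] ik by (intro mult_mono) auto
    finally have 1: "f ?s x - ?i \<le> 3 * K\<^sup>2 * ?s" by (simp add: mult_ac)
    have "?i - f ?s x \<le> (2 * ?s - ?s\<^sup>2) * ?i" using fb(1)[OF t0(1,3), of n x] by (simp add: power2_diff algebra_simps)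
    also have "\<dots> \<le> (3 * ?s) * K\<^sup>2"
    proof (rule mult_mono)
      have "0 \<le> ?s\<^sup>2" by simp
      then show "2 * ?s - ?s\<^sup>2 \<le> 3 * ?s" using t0[of n] by linarith
    qed (use t0[of n] ik in auto)
    finally have 2: "?i - f ?s x \<le> 3 * K\<^sup>2 * ?s" by (simp add: mult_ac)
    have "\<bar>f ?s x - ?i\<bar> \<le> 3 * K\<^sup>2 * ?s" using 1 2 by linarith
    then show ?thesis using True t0(1)[of n] by (simp add: D_def divide_le_eq)
  qed (simp add: D_def)
  have limD: "AE x in leb d. (\<lambda>n. D n x) \<longlonglongrightarrow> indicator (vcell d b) x * (2 * ((?B x \<bullet> p) * (?B x \<bullet> q)))"
    using AE_distinct_norms[OF b]
  proof eventually_elim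
    case (elim x)
    show ?case
    proof (cases "x \<in> vcell d b")
      case True
      let ?z = "?B x"
      have zV: "?z \<in> voronoi_cell ?L" using True by (simp add: vcell_def)
      have iz: "infdist ?z ?L = norm ?z" by (rule infdist_voronoi[OF zspan_0 zV])
      have dist: "norm ?z \<noteq> norm (?z - w)" if "w \<in> ?L" "w \<noteq> 0" for w
        using elim that zspan_0[of d b] by force
      have "eventually (\<lambda>n. infdist (transvection p q (t n) ?z) (zspan d (\<lambda>i. transvection p q (t n) (b i)))
          = norm (transvection p q (t n) ?z)) sequentially"
        by (rule eventually_infdist_transvection[OF b p q zV _ tl]) (rule dist)
      \<comment> \<open>As long as 0 remains a nearest lattice point, the squared distance is the
        squared norm, a polynomial in \<open>t n\<close> with linear coefficient
        \<open>2 * ((?z \<bullet> p) * (?z \<bullet> q))\<close>.\<close>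
      then have ev: "eventually (\<lambda>n. 2 * ((?z \<bullet> p) * (?z \<bullet> q)) + t n * (?z \<bullet> q)\<^sup>2 = D n x) sequentially"
      proof eventually_elim
        case (elim n)
        have "(norm (transvection p q (t n) ?z))\<^sup>2 = (norm ?z)\<^sup>2 + 2 * (t n * (?z \<bullet> q)) * (?z \<bullet> p) + (t n * (?z \<bullet> q))\<^sup>2 * (p \<bullet> p)"
          unfolding transvection_def power2_norm_eq_inner
          by (simp add: inner_add_left inner_add_right inner_commute power2_eq_square algebra_simps)
        then have "f (t n) x - (infdist ?z ?L)\<^sup>2 = t n * (2 * ((?z \<bullet> p) * (?z \<bullet> q)) + t n * (?z \<bullet> q)\<^sup>2)"
          using elim p unfolding f_def iz by (simp add: norm_eq_1 power2_eq_square algebra_simps)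
        then show ?case using True t0(1)[of n] by (simp add: D_def)
      qed
      have "(\<lambda>n. 2 * ((?z \<bullet> p) * (?z \<bullet> q)) + t n * (?z \<bullet> q)\<^sup>2) \<longlonglongrightarrow> 2 * ((?z \<bullet> p) * (?z \<bullet> q)) + 0 * (?z \<bullet> q)\<^sup>2"
        by (intro tendsto_intros tl)
      then have "(\<lambda>n. D n x) \<longlonglongrightarrow> 2 * ((?z \<bullet> p) * (?z \<bullet> q)) + 0 * (?z \<bullet> q)\<^sup>2"
        using ev by (rule Lim_transform_eventually)
      then show ?thesis using True by simp
    qed (simp add: D_def)
  qed
  have dom: "integrable (leb d) (\<lambda>x. indicator (vcell d b) x * (3 * K\<^sup>2))"
    using emeasure_vcell[OF b] by (intro integrable_mult_left integrable_real_indicator) auto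
  have "(\<lambda>n. LINT x|leb d. D n x) \<longlonglongrightarrow> (LINT x|leb d. indicator (vcell d b) x * (2 * ((?B x \<bullet> p) * (?B x \<bullet> q))))"
  proof (rule integral_dominated_convergence[OF _ _ dom limD])
    show "AE x in leb d. norm (D n x) \<le> indicator (vcell d b) x * (3 * K\<^sup>2)" for n using Db by simp
    show "D n \<in> borel_measurable (leb d)" for n unfolding D_def by measurable
  qed measurable
  moreover have "(LINT x|leb d. D n x) \<le> 0" for n
  proof -
    have bd: "integrable (leb d) (\<lambda>x. indicator (vcell d b) x * g x)"
      if [measurable]: "g \<in> borel_measurable (leb d)" and g: "\<And>x. x \<in> vcell d b \<Longrightarrow> \<bar>g x\<bar> \<le> 4 * K\<^sup>2" for g :: "(nat \<Rightarrow> real) \<Rightarrow> real"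
    proof (rule Bochner_Integration.integrable_bound)
      show "integrable (leb d) (\<lambda>x. indicator (vcell d b) x * (4 * K\<^sup>2))"
        using emeasure_vcell[OF b] by (intro integrable_mult_left integrable_real_indicator) auto
      show "AE x in leb d. norm (indicator (vcell d b) x * g x) \<le> norm (indicator (vcell d b) x * (4 * K\<^sup>2))"
        using g by (auto simp: indicator_def)
    qed measurable
    have i0: "(infdist (?B x) ?L)\<^sup>2 \<le> K\<^sup>2" if "x \<in> vcell d b" for x
      using infdist_le_norm[of "?B x" d b] K(2)[OF that] by (intro power_mono infdist_nonneg) simp
    have i1: "integrable (leb d) (\<lambda>x. indicator (vcell d b) x * (infdist (?B x) ?L)\<^sup>2)"
    proof (rule bd)
      fix x assume "x \<in> vcell d b"
      have "0 \<le> (infdist (?B x) ?L)\<^sup>2" by simp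
      then show "\<bar>(infdist (?B x) ?L)\<^sup>2\<bar> \<le> 4 * K\<^sup>2" using i0[OF \<open>x \<in> vcell d b\<close>] by linarith
    qed measurable
    have i2: "integrable (leb d) (\<lambda>x. indicator (vcell d b) x * f (t n) x)"
    proof (rule bd)
      fix x assume x: "x \<in> vcell d b"
      have "f (t n) x \<le> (1 + t n)\<^sup>2 * (infdist (?B x) ?L)\<^sup>2" by (rule fb(2)[OF t0(1,3)])
      also have "\<dots> \<le> 2\<^sup>2 * K\<^sup>2"
      proof (rule mult_mono)
        show "(1 + t n)\<^sup>2 \<le> 2\<^sup>2" using t0[of n] by (intro power_mono) auto
      qed (use i0[OF x] in auto)
      finally show "\<bar>f (t n) x\<bar> \<le> 4 * K\<^sup>2" by (simp add: f_def)
    qed measurable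
    have "(LINT x|leb d. D n x) = (LINT x|leb d. (indicator (vcell d b) x * f (t n) x - indicator (vcell d b) x * (infdist (?B x) ?L)\<^sup>2) / t n)"
      unfolding D_def by (intro Bochner_Integration.integral_cong refl) (simp add: right_diff_distrib)
    also have "\<dots> = (mean_sq d (\<lambda>i. transvection p q (t n) (b i)) - mean_sq d b) / t n"
      unfolding fm f0 by (subst integral_divide_zero, subst Bochner_Integration.integral_diff[OF i2 i1]) simp
    also have "\<dots> \<le> 0" using max[of "t n"] t0[of n] by (simp add: divide_le_0_iff)
    finally show ?thesis .
  qed
  ultimately have le: "(LINT x|leb d. indicator (vcell d b) x * (2 * ((?B x \<bullet> p) * (?B x \<bullet> q)))) \<le> 0"
    by (intro LIMSEQ_le_const2) auto
  have [measurable]: "voronoi_cell ?L \<in> sets borel" by (intro borel_closed closed_voronoi_cell)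
  have "(LINT z:voronoi_cell ?L|span_leb d b. (z \<bullet> p) * (z \<bullet> q)) =
      (LINT x|leb d. indicator (voronoi_cell ?L) (?B x) *\<^sub>R ((?B x \<bullet> p) * (?B x \<bullet> q)))"
    unfolding set_lebesgue_integral_def span_leb_def by (subst integral_distr) auto
  also have "\<dots> = (LINT x|leb d. indicator (vcell d b) x * ((?B x \<bullet> p) * (?B x \<bullet> q)))"
    by (intro Bochner_Integration.integral_cong refl) (auto simp: vcell_def indicator_def)
  also have "\<dots> = (LINT x|leb d. indicator (vcell d b) x * (2 * ((?B x \<bullet> p) * (?B x \<bullet> q)))) / 2"
    by (subst integral_divide_zero[symmetric]) simp
  finally show ?thesis using le by simp
qed

section \<open>The main theorem\<close>

lemma lincomb_lincomb:
  "lincomb m (\<lambda>i. lincomb k c (\<lambda>l. U l i)) v = lincomb k c (\<lambda>l. \<Sum>i<m. U l i * v i)"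
proof -
  have "lincomb m (\<lambda>i. lincomb k c (\<lambda>l. U l i)) v = (\<Sum>i<m. \<Sum>l<k. (v i * U l i) *\<^sub>R c l)"
    by (simp add: lincomb_def scaleR_sum_right)
  also have "\<dots> = (\<Sum>l<k. \<Sum>i<m. (v i * U l i) *\<^sub>R c l)" by (rule sum.swap)
  also have "\<dots> = lincomb k c (\<lambda>l. \<Sum>i<m. U l i * v i)"
    by (simp add: lincomb_def scaleR_sum_left mult.commute)
  finally show ?thesis .
qed

lemma lincomb_delta: "j < d \<Longrightarrow> lincomb d b (\<lambda>i. if i = j then 1 else 0) = b j"
proof -
  assume j: "j < d"
  have "lincomb d b (\<lambda>i. if i = j then 1 else 0) = (\<Sum>i<d. if i = j then b j else 0)"
    unfolding lincomb_def by (intro sum.cong) auto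
  then show ?thesis using j by simp
qed

text \<open>The products of the two integral transition matrices are identity matrices; comparing their
  traces shows that both bases have the same length, without any rank argument.\<close>

lemma gram_det_int_basis:
  fixes b c :: "nat \<Rightarrow> 'a::real_inner"
  assumes c: "lin_indep k c" and eq: "zspan k c = zspan m b"
    and b: "\<And>n. lincomb m b (\<lambda>i. real_of_int (n i)) = 0 \<Longrightarrow> \<forall>i<m. n i = 0"
  shows "m = k" "gram_det m b = gram_det k c"
proof -
  have "b j \<in> zspan k c" if "j < m" for j unfolding eq using that by (rule zspan_base)
  then obtain U where U: "\<And>j. j < m \<Longrightarrow> b j = lincomb k c (\<lambda>i. real_of_int (U i j))"
    using zspan_matrix[of m b k c] by blast
  have "c j \<in> zspan m b" if "j < k" for j unfolding eq[symmetric] using that by (rule zspan_base)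
  then obtain V where V: "\<And>j. j < k \<Longrightarrow> c j = lincomb m b (\<lambda>i. real_of_int (V i j))"
    using zspan_matrix[of k c m b] by blast
  have UV: "(\<Sum>i<m. U l i * V i j) = (if l = j then 1 else 0)" if lj: "l < k" "j < k" for l j
  proof -
    have "c j = lincomb m (\<lambda>i. lincomb k c (\<lambda>l. real_of_int (U l i))) (\<lambda>i. real_of_int (V i j))"
      unfolding V[OF lj(2)] by (intro lincomb_cong) (auto simp: U)
    also have "\<dots> = lincomb k c (\<lambda>l. \<Sum>i<m. real_of_int (U l i) * real_of_int (V i j))" by (rule lincomb_lincomb)
    finally have "lincomb k c (\<lambda>i. if i = j then 1 else 0) = lincomb k c (\<lambda>l. \<Sum>i<m. real_of_int (U l i) * real_of_int (V i j))"
      using lincomb_delta[OF lj(2), of c] by simp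
    from lin_indep_unique[OF c this lj(1)]
    have "real_of_int (\<Sum>i<m. U l i * V i j) = (if l = j then 1 else 0)" by simp
    then show ?thesis by (cases "l = j") (simp_all only: if_True if_False of_int_eq_1_iff of_int_eq_0_iff simp_thms)
  qed
  have VU: "(\<Sum>l<k. V i l * U l j) = (if i = j then 1 else 0)" if ij: "i < m" "j < m" for i j
  proof -
    have "b j = lincomb k (\<lambda>l. lincomb m b (\<lambda>i. real_of_int (V i l))) (\<lambda>l. real_of_int (U l j))"
      unfolding U[OF ij(2)] by (intro lincomb_cong) (auto simp: V)
    also have "\<dots> = lincomb m b (\<lambda>i. \<Sum>l<k. real_of_int (V i l) * real_of_int (U l j))" by (rule lincomb_lincomb)
    finally have "lincomb m b (\<lambda>i. (\<Sum>l<k. real_of_int (V i l) * real_of_int (U l j)) - (if i = j then 1 else 0)) = 0"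
      unfolding lincomb_diff using lincomb_delta[OF ij(2), of b] by simp
    also have "(\<lambda>i. (\<Sum>l<k. real_of_int (V i l) * real_of_int (U l j)) - (if i = j then 1 else 0)) =
      (\<lambda>i. real_of_int ((\<Sum>l<k. V i l * U l j) - (if i = j then 1 else 0)))"
      by auto
    finally have "\<forall>i<m. (\<Sum>l<k. V i l * U l j) - (if i = j then 1 else 0) = 0" by (rule b)
    then show ?thesis using ij(1) by simp
  qed
  have "int k = (\<Sum>l<k. \<Sum>i<m. U l i * V i l)" using UV by simp
  also have "\<dots> = (\<Sum>i<m. \<Sum>l<k. V i l * U l i)" by (subst sum.swap) (simp add: mult.commute)
  also have "\<dots> = int m" using VU by simp
  finally show mk: "m = k" by simp
  have "coldet k U * coldet k V = coldet k (\<lambda>i j. \<Sum>l<k. U i l * V l j)" by (rule coldet_mult[symmetric])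
  also have "\<dots> = coldet k (\<lambda>i j. if i = j then 1 else 0)" using UV mk by (intro coldet_cong) auto
  finally have "coldet k U * coldet k V = 1" by (simp add: coldet_id)
  then have "\<bar>coldet k U\<bar> = 1" by (metis dvd_triv_left zdvd1_eq)
  then have U1: "(coldet k U)\<^sup>2 = 1" by (metis power2_abs one_power2)
  have "gram_det m b = gram_det k (\<lambda>j. lincomb k c (\<lambda>i. real_of_int (U i j)))"
    unfolding mk using U mk by (intro gram_det_cong) auto
  also have "\<dots> = (coldet k (\<lambda>i j. real_of_int (U i j)))\<^sup>2 * gram_det k c" by (rule gram_det_lincomb)
  also have "(coldet k (\<lambda>i j. real_of_int (U i j)))\<^sup>2 = 1"
    unfolding coldet_of_int using U1 by (metis of_int_1 of_int_power)
  finally show "gram_det m b = gram_det k c" by simp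
qed

lemma int_comb_lincomb: "int_comb bs c = lincomb (length bs) ((!) bs) (\<lambda>i. real_of_int (c i))"
  by (simp add: int_comb_def lincomb_def)

lemma range_int_comb: "range (int_comb bs) = zspan (length bs) ((!) bs)"
  unfolding zspan_def int_comb_lincomb ..

text \<open>The choice in \<open>lattice_det\<close> may return a basis other than \<open>c\<close>,
  but by \<open>gram_det_int_basis\<close> all integral bases have the same Gram
  determinant.\<close>

lemma lattice_det_zspan:
  fixes c :: "nat \<Rightarrow> 'a::euclidean_space"
  assumes c: "lin_indep k c"
  shows "lattice_det (zspan k c) = sqrt (gram_det k c)"
proof -
  let ?cs = "map c [0..<k]"
  have cs: "lincomb (length ?cs) ((!) ?cs) x = lincomb k c x" for x
    by (auto intro!: lincomb_cong)
  have "int_basis ?cs (zspan k c)"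
    unfolding int_basis_def
  proof
    show "range (int_comb ?cs) = zspan k c" unfolding zspan_def int_comb_lincomb cs ..
    show "\<forall>n. int_comb ?cs n = 0 \<longrightarrow> (\<forall>i<length ?cs. n i = 0)"
      unfolding int_comb_lincomb cs
    proof (intro allI impI)
      fix n i assume n: "lincomb k c (\<lambda>i. real_of_int (n i)) = 0" and i: "i < length ?cs"
      then have "real_of_int (n i) = 0" using c unfolding lin_indep_def by fastforce
      then show "n i = 0" by simp
    qed
  qed
  then have "int_basis (SOME bs. int_basis bs (zspan k c)) (zspan k c)" by (rule someI)
  then obtain bs where bs: "bs = (SOME bs. int_basis bs (zspan k c))" "int_basis bs (zspan k c)" by blast
  have "gram_det (length bs) ((!) bs) = gram_det k c"
  proof (rule gram_det_int_basis(2)[OF c])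
    show "zspan k c = zspan (length bs) ((!) bs)" using bs(2) by (simp add: int_basis_def range_int_comb)
    show "\<forall>i<length bs. n i = 0" if "lincomb (length bs) ((!) bs) (\<lambda>i. real_of_int (n i)) = 0" for n
      using bs(2) that by (simp add: int_basis_def int_comb_lincomb)
  qed
  then show ?thesis unfolding lattice_det_def bs(1)[symmetric] gram_mat_def gram_det_def by simp
qed

lemma stable_lattice_basis:
  fixes L :: "'a::euclidean_space set"
  assumes "stable_lattice L"
  obtains b where "zspan DIM('a) b = L" "stable_basis DIM('a) b"
proof -
  obtain bs where bs: "length bs = DIM('a)" "distinct bs" "independent (set bs)" "L = range (int_comb bs)"
    using assms unfolding stable_lattice_def is_lattice_def by blast
  let ?b = "(!) bs"
  have z: "zspan DIM('a) ?b = L" unfolding bs(4) range_int_comb bs(1) ..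
  have im: "?b ` {..<DIM('a)} = set bs" using bs(1) by (auto simp: set_conv_nth)
  have "inj_on ?b {..<DIM('a)}" using bs(1,2) by (auto simp: inj_on_def nth_eq_iff_index_eq)
  then have li: "lin_indep DIM('a) ?b" unfolding lin_indep_independent im using bs(3) by blast
  have "lattice_det L = 1" using assms by (simp add: stable_lattice_def)
  then have "gram_det DIM('a) ?b = 1" using lattice_det_zspan[OF li] z by simp
  moreover have "1 \<le> gram_det k c" if c: "\<And>j. j < k \<Longrightarrow> c j \<in> zspan DIM('a) ?b" "lin_indep k c" for k c
  proof -
    have "zspan k c \<subseteq> L" unfolding z[symmetric] using c(1) by (rule zspan_subsetI)
    then have "sublattice (zspan k c) L" unfolding sublattice_def by (simp add: zspan_0 zspan_diff)
    then have "1 \<le> lattice_det (zspan k c)" using assms by (simp add: stable_lattice_def)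
    then show ?thesis using lattice_det_zspan[OF c(2)] by simp
  qed
  ultimately have "stable_basis DIM('a) ?b" by (auto simp: stable_basis_def dets_ge_def)
  then show ?thesis using that z by blast
qed

section \<open>Induction on the rank\<close>

lemma mean_sq_0: "mean_sq 0 b = 0"
  by (simp add: mean_sq_def lincomb_def zspan_def)

text \<open>\<open>J\<close> is left abstract: the induction needs only one bound that is linear in
  the dimension and valid in all dimensions up to \<open>n\<close>.\<close>

lemma mean_sq_stable_le:
  fixes b :: "nat \<Rightarrow> 'a::euclidean_space"
  assumes J: "\<And>k K. 1 \<le> k \<Longrightarrow> k \<le> n \<Longrightarrow> K \<in> isotropic_bodies k \<Longrightarrow>
      (LINT x:K|lborel_Euclidean k. (\<Sum>i<k. (x i)\<^sup>2)) \<le> real k * J"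
    and "stable_basis d b" "d \<le> n"
  shows "mean_sq d b \<le> real d * J"
  using assms(2,3)
proof (induction d arbitrary: b rule: less_induct)
  case (less d)
  show ?case
  proof (cases "d = 0")
    case True
    then show ?thesis by (simp add: mean_sq_0)
  next
    case False
    \<comment> \<open>A maximizer among all stable lattices of rank \<open>d\<close> in the ambient
      space, so that its stable perturbations compete with it.\<close>
    obtain m :: "nat \<Rightarrow> 'a" where m: "stable_basis d m" "\<And>c :: nat \<Rightarrow> 'a. stable_basis d c \<Longrightarrow> mean_sq d c \<le> mean_sq d m"
      using exists_max_mean_sq[OF less.prems(1)] by blast
    have "mean_sq d m \<le> real d * J"
    proof (cases "\<exists>k c. 0 < k \<and> k < d \<and> (\<forall>j<k. c j \<in> zspan d m) \<and> lin_indep k c \<and> gram_det k c \<le> 1")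
      case True
      then obtain k c where k: "0 < k" "k < d" and c: "\<And>j. j < k \<Longrightarrow> c j \<in> zspan d m" "lin_indep k c" "gram_det k c \<le> 1"
        by blast
      obtain e :: "nat \<Rightarrow> 'a" where e: "stable_basis k e" "stable_basis (d - k) (\<lambda>i. proj_off k e (e (k + i)))"
        "mean_sq d m \<le> mean_sq k e + mean_sq (d - k) (\<lambda>i. proj_off k e (e (k + i)))"
        using split_at_det_one[OF m(1) c less_imp_le[OF k(2)]] by blast
      \<comment> \<open>Being linear in the rank, the bounds for the two parts add up to the bound
        for the whole.\<close>
      have "mean_sq d m \<le> real k * J + real (d - k) * J"
        using e(3) less.IH[OF k(2) e(1)] less.IH[OF _ e(2)] k less.prems(2) by force
      also have "\<dots> = real d * J" using k by (simp add: of_nat_diff algebra_simps)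
      finally show ?thesis .
    next
      case False
      then have strict: "1 < gram_det k c" if "0 < k" "k < d" "\<And>j. j < k \<Longrightarrow> c j \<in> zspan d m" "lin_indep k c" for k c
        using that by (meson not_le)
      have li: "lin_indep d m" by (rule stable_basis_lin_indep[OF m(1)])
      have gd: "gram_det d m = 1" using m(1) by (simp add: stable_basis_def)
      have le0: "(LINT z:voronoi_cell (zspan d m)|span_leb d m. (z \<bullet> p) * (z \<bullet> q)) \<le> 0"
        if pq: "p \<in> span (m ` {..<d})" "q \<in> span (m ` {..<d})" "norm p = 1" "norm q = 1" "p \<bullet> q = 0" for p q
      proof -
        obtain \<epsilon> where \<epsilon>: "\<epsilon> > 0" "\<And>t. \<bar>t\<bar> < \<epsilon> \<Longrightarrow> stable_basis d (\<lambda>i. transvection p q t (m i))"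
          using stable_basis_transvection[OF m(1) strict pq(1,3,2,4,5)] by blast
        show ?thesis by (rule integral_voronoi_le_0[OF li pq(3,4) \<epsilon>(1) m(2)[OF \<epsilon>(2)]])
      qed
      let ?K = "coord_body d (ons m) (voronoi_cell (zspan d m))"
      have "?K \<in> isotropic_bodies d"
      proof (rule isotropic_body_voronoi[OF gd])
        show "1 \<le> norm w" if "w \<in> zspan d m" "w \<noteq> 0" for w using stable_basis_norm_ge[OF m(1)] that by blast
        show "0 < d" using \<open>d \<noteq> 0\<close> by simp
        fix p q :: 'a assume pq: "p \<in> span (m ` {..<d})" "q \<in> span (m ` {..<d})" "norm p = 1" "norm q = 1" "p \<bullet> q = 0"
        \<comment> \<open>Replacing \<open>p\<close> by \<open>- p\<close> changes the sign of the
          integral and so gives the opposite inequality.\<close>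
        have "(LINT z:voronoi_cell (zspan d m)|span_leb d m. (z \<bullet> - p) * (z \<bullet> q)) \<le> 0"
          using pq by (intro le0) (auto simp: span_neg)
        moreover have "(LINT z:voronoi_cell (zspan d m)|span_leb d m. (z \<bullet> - p) * (z \<bullet> q)) =
            - (LINT z:voronoi_cell (zspan d m)|span_leb d m. (z \<bullet> p) * (z \<bullet> q))"
          by (simp add: set_lebesgue_integral_def)
        ultimately show "(LINT z:voronoi_cell (zspan d m)|span_leb d m. (z \<bullet> p) * (z \<bullet> q)) = 0"
          using le0[OF pq] by linarith
      qed
      then have "(LINT x:?K|lborel_Euclidean d. (\<Sum>i<d. (x i)\<^sup>2)) \<le> real d * J"
        using J \<open>d \<noteq> 0\<close> less.prems(2) by simp
      then show ?thesis by (simp add: integral_coord_body_voronoi[OF gd])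
    qed
    then show ?thesis using m(2)[OF less.prems(1)] by linarith
  qed
qed

lemma mean_covering_radius_basis:
  fixes b :: "nat \<Rightarrow> 'a::euclidean_space"
  assumes st: "stable_basis DIM('a) b"
  shows "mean_covering_radius (zspan DIM('a) b) = sqrt (mean_sq DIM('a) b)"
proof -
  have li: "lin_indep DIM('a) b" and gd: "gram_det DIM('a) b = 1"
    using st stable_basis_lin_indep by (auto simp: stable_basis_def)
  have "span_leb DIM('a) b = lborel"
    using span_leb_ons[OF gd] span_leb_orthonormal[OF orthonormal_ons[OF li]] by simp
  then have "(LINT x:voronoi_cell (zspan DIM('a) b)|lborel. (norm x)\<^sup>2) = mean_sq DIM('a) b"
    using integral_voronoi_norm[OF li] by simp
  moreover have "lattice_det (zspan DIM('a) b) = 1" using lattice_det_zspan[OF li] gd by simp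
  ultimately show ?thesis by (simp add: mean_covering_radius_def)
qed

lemma covering_radius_basis_le:
  fixes b :: "nat \<Rightarrow> 'a::euclidean_space"
  assumes li: "lin_indep DIM('a) b"
  shows "covering_radius (zspan DIM('a) b) \<le> sqrt 3 * sqrt (mean_sq DIM('a) b)"
  unfolding covering_radius_def
proof (rule cSUP_least)
  fix x :: 'a
  have "span (b ` {..<DIM('a)}) = UNIV" using dim_lin_indep[OF li] dim_eq_full[of "b ` {..<DIM('a)}"] by simp
  then obtain z where z: "x = lincomb DIM('a) b z" by (auto simp: span_eq_range_lincomb)
  have ne: "zspan DIM('a) b \<noteq> {}" using zspan_0 by blast
  have "(INF y\<in>zspan DIM('a) b. norm (x - y)) = infdist x (zspan DIM('a) b)"
    by (simp add: infdist_notempty[OF ne] dist_norm)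
  also have "\<dots> \<le> sqrt (3 * mean_sq DIM('a) b)"
    unfolding z by (rule real_le_rsqrt[OF infdist_sq_le_mean_sq[OF li]])
  finally show "(INF y\<in>zspan DIM('a) b. norm (x - y)) \<le> sqrt 3 * sqrt (mean_sq DIM('a) b)"
    by (simp add: real_sqrt_mult)
qed simp

text \<open>The real supremum bounds its members only if the set is bounded above, which
  \<open>isotropic_body_moment_bound\<close> provides.\<close>

lemma moment_le_isotropic_max:
  assumes k: "1 \<le> k" "k \<le> n" and K: "K \<in> isotropic_bodies k"
  shows "(LINT x:K|lborel_Euclidean k. (\<Sum>i<k. (x i)\<^sup>2)) \<le> real k *
    (MAX d\<in>{1..n}. 1 / real d * (SUP K\<in>isotropic_bodies d. LINT x:K|lborel_Euclidean d. (\<Sum>i<d. (x i)\<^sup>2)))"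
proof -
  let ?I = "\<lambda>d K. LINT x:K|lborel_Euclidean d. (\<Sum>i<d. (x i)\<^sup>2)"
  have "?I k K \<le> (SUP K\<in>isotropic_bodies k. ?I k K)"
    using k isotropic_body_moment_bound by (intro cSUP_upper K bdd_aboveI2[of _ _ "real k * (real k / 4)"]) auto
  also have "\<dots> = real k * (1 / real k * (SUP K\<in>isotropic_bodies k. ?I k K))" using k by simp
  also have "\<dots> \<le> real k * (MAX d\<in>{1..n}. 1 / real d * (SUP K\<in>isotropic_bodies d. ?I d K))"
    using k by (intro mult_left_mono Max_ge) auto
  finally show ?thesis .
qed

theorem theorem6p7:
  fixes L :: "(real ^ 'n) set"
  assumes "stable_lattice L"
  shows "covering_radius L \<le> sqrt 3 * mean_covering_radius L \<and>
         sqrt 3 * mean_covering_radius L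
           \<le> sqrt (3 * real CARD('n)) * isotropic_constant CARD('n)"
proof -
  obtain b :: "nat \<Rightarrow> real ^ 'n" where b: "zspan CARD('n) b = L" "stable_basis CARD('n) b"
    using stable_lattice_basis[OF assms] by auto
  have mu: "mean_covering_radius L = sqrt (mean_sq CARD('n) b)"
    using mean_covering_radius_basis[of b] b by simp
  have "covering_radius L \<le> sqrt 3 * mean_covering_radius L"
    unfolding mu using covering_radius_basis_le[of b] stable_basis_lin_indep[OF b(2)] b(1) by simp
  moreover have "sqrt 3 * mean_covering_radius L \<le> sqrt (3 * real CARD('n)) * isotropic_constant CARD('n)"
  proof -
    have "mean_sq CARD('n) b \<le> real CARD('n) *
      (MAX d\<in>{1..CARD('n)}. 1 / real d * (SUP K\<in>isotropic_bodies d. LINT x:K|lborel_Euclidean d. (\<Sum>i<d. (x i)\<^sup>2)))"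
      using moment_le_isotropic_max b(2) by (rule mean_sq_stable_le) auto
    then have "sqrt (mean_sq CARD('n) b) \<le> sqrt (real CARD('n)) * isotropic_constant CARD('n)"
      unfolding isotropic_constant_def real_sqrt_mult[symmetric] by (rule real_sqrt_le_mono)
    then have "sqrt 3 * sqrt (mean_sq CARD('n) b) \<le> sqrt 3 * (sqrt (real CARD('n)) * isotropic_constant CARD('n))"
      by (rule mult_left_mono) simp
    then show ?thesis unfolding mu by (simp add: real_sqrt_mult mult.assoc)
  qed
  ultimately show ?thesis ..
qed

end
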